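(* All locally nonequivalent structures $(M,[\lambda,\mu])$ of oriented congruences having vanishing shear, nonvanishing twist, and with $K_2\neq 0$ everywhere are described by invariant coframes $(\omega,\omega_1,\bar\omega_1)$ on $M$ ($\omega=f\lambda$ real, $\omega_1=h\mu$), obtained from the normalization $K_2=1$, satisfying the system $$d\omega=i\omega_1\wedge\bar\omega_1+(Z_1+\bar Z_2)\omega_1\wedge\omega+(Z_2+\bar Z_1)\bar\omega_1\wedge\omega,$$ $$d\omega_1=-Z_2\,\omega_1\wedge\bar\omega_1-Z_0\,\omega_1\wedge\omega,\qquad d\bar\omega_1=\bar Z_2\,\omega_1\wedge\bar\omega_1-\bar Z_0\,\bar\omega_1\wedge\omega$$ with the integrability conditions $$dZ_1=Z_{11}\omega_1+(-K_1+iZ_0-Z_1Z_2+Z_2\bar Z_2+Z_{21})\bar\omega_1+(Z_0\bar Z_2+Z_{01}-1)\omega,$$ $$dZ_2=Z_{21}\omega_1+Z_{22}\bar\omega_1+(Z_{02}+Z_0\bar Z_1+Z_0Z_2-\bar Z_0Z_2)\omega,$$ $$dZ_0=Z_{01}\omega_1+Z_{02}\bar\omega_1+Z_{00}\omega,\qquad dK_1=K_{11}\omega_1+\bar K_{11}\bar\omega_1+K_{10}\omega$$ and their complex conjugates. Here $Z_0,Z_1,Z_2$ (complex) and $K_1$ (real) are the basic scalar invariants, and $Z_{00},Z_{01},Z_{02},Z_{11},Z_{21},Z_{22},K_{11}$ (complex), $K_{10}$ (real) are higher order invariants (functions on $M$). That is: every such structure determines such a coframe, every such coframe defines (via $\lambda=\omega$,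 $\mu=\omega_1$) such a structure, and two such structures are locally equivalent iff some local diffeomorphism carries one invariant coframe to the other.
   Context: All objects are smooth. A structure of an oriented congruence $(M,[\lambda,\mu])$ on a 3-manifold $M$ is an equivalence class of pairs of 1-forms $(\lambda,\mu)$, $\lambda$ real, $\mu$ complex, with $\lambda\wedge\mu\wedge\bar\mu\neq 0$ everywhere, where $(\lambda,\mu)\sim(\lambda',\mu')$ iff $\lambda'=f\lambda$, $\mu'=h\mu$ for nonvanishing functions $f$ (real), $h$ (complex). Two structures are (locally) equivalent iff there is a (local) diffeomorphism $\varphi:M\to M'$ with $\varphi^*\lambda'=f\lambda$, $\varphi^*\mu'=h\mu$ for such $f,h$. For a representative write $d\lambda=ia\,\mu\wedge\bar\mu+b\,\mu\wedge\lambda+\bar b\,\bar\mu\wedge\lambda$, $d\mu=p\,\mu\wedge\bar\mu+q\,\mu\wedge\lambda+s\,\bar\mu\wedge\lambda$; $a$ is the twist, $s$ the shear. If $a\ne0$, $s\equiv0$, then on $P$, locally $M\times\mathbb{C}^*$ with fibre coordinate $\rho e^{i\phi}$, there is a unique coframe $(\omega,\omega_1,\bar\omega_1,\Omega,\bar\Omega)$, with $\omega=\frac{\rho^2}{a}\lambda$, $\omega_1=\rho e^{i\phi}\mu$, satisfying $d\omega=i\omega_1\wedge\bar\omega_1+(\Omega+\bar\Omega)\wedge\omega$, $d\omega_1=\Omega\wedge\omega_1$, $d\Omega=K_1\omega_1\wedge\bar\omega_1+K_2\omega_1\wedge\omega$, with $K_1=\rho^{-2}k_1$ real, $K_2=\rho^{-3}e^{-i\phi}k_2$,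 and $k_1,k_2$ functions on $M$. When $k_2$ is nowhere zero, the requirement $K_2=1$, i.e. $\rho=|k_2|^{1/3}$, $\phi=\mathrm{Arg}(k_2)$, embeds $M$ in $P$; all objects are pulled back to $M$ by this embedding, so $K_1=k_1|k_2|^{-2/3}$, and $Z_0,Z_1,Z_2$ are defined by $\Omega=Z_1\omega_1+Z_2\bar\omega_1+Z_0\omega$. *)

theory Defs
  imports "HOL-Analysis.Analysis"
begin

subsection \<open>Smooth functions on Euclidean spaces\<close>

(* Only meaningful for open S: frechet_derivative f (at x) looks at a full neighbourhood of x. *)
primrec times_diff_on ::
  "nat \<Rightarrow> 'e::real_normed_vector set \<Rightarrow> ('e \<Rightarrow> 'v::real_normed_vector) \<Rightarrow> bool"
where
  "times_diff_on 0 S f \<longleftrightarrow> continuous_on S f"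
| "times_diff_on (Suc n) S f \<longleftrightarrow>
     (\<forall>x\<in>S. f differentiable (at x)) \<and>
     (\<forall>v. times_diff_on n S (\<lambda>x. frechet_derivative f (at x) v))"

definition smooth_on ::
  "'e::real_normed_vector set \<Rightarrow> ('e \<Rightarrow> 'v::real_normed_vector) \<Rightarrow> bool" where
  "smooth_on S f \<longleftrightarrow> (\<forall>n. times_diff_on n S f)"


subsection \<open>Smooth manifolds given by an atlas\<close>

(* A chart is a domain together with a coordinate map; the manifold is the union of the domains
   of an atlas. *)
type_synonym ('a, 'e) chart = "'a set \<times> ('a \<Rightarrow> 'e)"
type_synonym ('a, 'e) atlas = "('a, 'e) chart set"

abbreviation chart_dom :: "('a, 'e) chart \<Rightarrow> 'a set" where "chart_dom \<equiv> fst"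
abbreviation chart_map :: "('a, 'e) chart \<Rightarrow> 'a \<Rightarrow> 'e" where "chart_map \<equiv> snd"
abbreviation chart_inv :: "('a, 'e) chart \<Rightarrow> 'e \<Rightarrow> 'a" where
  "chart_inv c \<equiv> inv_into (chart_dom c) (chart_map c)"

definition points :: "('a, 'e) atlas \<Rightarrow> 'a set" where
  "points A = (\<Union>c\<in>A. chart_dom c)"

definition smooth_atlas ::
  "('a::{t2_space,second_countable_topology}, 'e::euclidean_space) atlas \<Rightarrow> bool" where
  "smooth_atlas A \<longleftrightarrow>
     (\<forall>c\<in>A. open (chart_dom c) \<and> open (chart_map c ` chart_dom c) \<and>
        homeomorphism (chart_dom c) (chart_map c ` chart_dom c) (chart_map c) (chart_inv c)) \<and>
     (\<forall>c\<in>A. \<forall>d\<in>A. smooth_on (chart_map c ` (chart_dom c \<inter> chart_dom d))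
        (chart_map d \<circ> chart_inv c))"

definition smooth_fun_on ::
  "('a, 'e::euclidean_space) atlas \<Rightarrow> 'a set \<Rightarrow> ('a \<Rightarrow> 'v::real_normed_vector) \<Rightarrow> bool" where
  "smooth_fun_on A U g \<longleftrightarrow>
     (\<forall>c\<in>A. smooth_on (chart_map c ` (chart_dom c \<inter> U)) (g \<circ> chart_inv c))"

abbreviation smooth_fun ::
  "('a, 'e::euclidean_space) atlas \<Rightarrow> ('a \<Rightarrow> 'v::real_normed_vector) \<Rightarrow> bool" where
  "smooth_fun A \<equiv> smooth_fun_on A (points A)"

definition smooth_map_on ::
  "('a::topological_space, 'e::euclidean_space) atlas \<Rightarrow>
   ('b::topological_space, 'f::euclidean_space) atlas \<Rightarrow> 'a set \<Rightarrow> ('a \<Rightarrow> 'b) \<Rightarrow> bool" where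
  "smooth_map_on A B U \<phi> \<longleftrightarrow>
     continuous_on U \<phi> \<and> \<phi> ` U \<subseteq> points B \<and>
     (\<forall>c\<in>A. \<forall>d\<in>B. smooth_on (chart_map c ` (chart_dom c \<inter> U \<inter> \<phi> -` chart_dom d))
        (chart_map d \<circ> \<phi> \<circ> chart_inv c))"

definition local_diffeo ::
  "('a::topological_space, 'e::euclidean_space) atlas \<Rightarrow>
   ('b::topological_space, 'f::euclidean_space) atlas \<Rightarrow> 'a set \<Rightarrow> 'b set \<Rightarrow> ('a \<Rightarrow> 'b) \<Rightarrow> bool" where
  "local_diffeo A B U V \<phi> \<longleftrightarrow>
     open U \<and> U \<subseteq> points A \<and> open V \<and> V \<subseteq> points B \<and> bij_betw \<phi> U V \<and>
     smooth_map_on A B U \<phi> \<and> smooth_map_on B A V (inv_into U \<phi>)"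


subsection \<open>Differential forms\<close>

(* Forms are complex valued and given by their components in the charts: \<alpha> c x v is the value at
   the point x on the tangent vector that has coordinate vector v in the chart c.  Values at
   arguments with c outside the atlas or x outside the domain of c carry no meaning, so equality
   of forms is form_eq below, not equality of HOL functions. *)
type_synonym ('a, 'e) form1 = "('a, 'e) chart \<Rightarrow> 'a \<Rightarrow> 'e \<Rightarrow> complex"
type_synonym ('a, 'e) form2 = "('a, 'e) chart \<Rightarrow> 'a \<Rightarrow> 'e \<Rightarrow> 'e \<Rightarrow> complex"
type_synonym ('a, 'e) form3 = "('a, 'e) chart \<Rightarrow> 'a \<Rightarrow> 'e \<Rightarrow> 'e \<Rightarrow> 'e \<Rightarrow> complex"

definition one_form :: "('a, 'e::euclidean_space) atlas \<Rightarrow> ('a, 'e) form1 \<Rightarrow> bool" where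
  "one_form A \<alpha> \<longleftrightarrow>
     (\<forall>c\<in>A. (\<forall>x\<in>chart_dom c. linear (\<alpha> c x)) \<and>
        (\<forall>v. smooth_on (chart_map c ` chart_dom c) (\<lambda>y. \<alpha> c (chart_inv c y) v))) \<and>
     (\<forall>c\<in>A. \<forall>d\<in>A. \<forall>x\<in>chart_dom c \<inter> chart_dom d. \<forall>v.
        \<alpha> c x v = \<alpha> d x (frechet_derivative (chart_map d \<circ> chart_inv c) (at (chart_map c x)) v))"

definition real_form :: "('a, 'e) atlas \<Rightarrow> ('a, 'e) form1 \<Rightarrow> bool" where
  "real_form A \<alpha> \<longleftrightarrow> (\<forall>c\<in>A. \<forall>x\<in>chart_dom c. \<forall>v. \<alpha> c x v \<in> \<real>)"

definition form_eq_on ::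
  "('a, 'e) atlas \<Rightarrow> 'a set \<Rightarrow> ('a, 'e) form1 \<Rightarrow> ('a, 'e) form1 \<Rightarrow> bool" where
  "form_eq_on A U \<alpha> \<beta> \<longleftrightarrow> (\<forall>c\<in>A. \<forall>x\<in>chart_dom c \<inter> U. \<forall>v. \<alpha> c x v = \<beta> c x v)"

abbreviation form_eq :: "('a, 'e) atlas \<Rightarrow> ('a, 'e) form1 \<Rightarrow> ('a, 'e) form1 \<Rightarrow> bool" where
  "form_eq A \<equiv> form_eq_on A (points A)"

definition form2_eq :: "('a, 'e) atlas \<Rightarrow> ('a, 'e) form2 \<Rightarrow> ('a, 'e) form2 \<Rightarrow> bool" where
  "form2_eq A \<alpha> \<beta> \<longleftrightarrow> (\<forall>c\<in>A. \<forall>x\<in>chart_dom c. \<forall>u v. \<alpha> c x u v = \<beta> c x u v)"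

definition conj_form :: "('a, 'e) form1 \<Rightarrow> ('a, 'e) form1" where
  "conj_form \<alpha> c x v = cnj (\<alpha> c x v)"

definition wedge :: "('a, 'e) form1 \<Rightarrow> ('a, 'e) form1 \<Rightarrow> ('a, 'e) form2"
    (infixl \<open>\<and>\<^sub>1\<close> 75) where
  "(\<alpha> \<and>\<^sub>1 \<beta>) c x u v = \<alpha> c x u * \<beta> c x v - \<alpha> c x v * \<beta> c x u"

definition wedge21 :: "('a, 'e) form2 \<Rightarrow> ('a, 'e) form1 \<Rightarrow> ('a, 'e) form3"
    (infixl \<open>\<and>\<^sub>2\<close> 75) where
  "(\<beta> \<and>\<^sub>2 \<gamma>) c x u v w = \<beta> c x u v * \<gamma> c x w + \<beta> c x v w * \<gamma> c x u + \<beta> c x w u * \<gamma> c x v"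

definition fun_diff :: "('a \<Rightarrow> complex) \<Rightarrow> ('a, 'e::euclidean_space) form1" where
  "fun_diff g c x v = frechet_derivative (g \<circ> chart_inv c) (at (chart_map c x)) v"

(* The coordinate formula (d\<alpha>)(u,v) = D\<^sub>u(\<alpha>(v)) - D\<^sub>v(\<alpha>(u)) for constant
   coordinate vectors u, v. *)
definition ext_diff :: "('a, 'e::euclidean_space) form1 \<Rightarrow> ('a, 'e) form2" where
  "ext_diff \<alpha> c x u v =
     frechet_derivative (\<lambda>y. \<alpha> c (chart_inv c y) v) (at (chart_map c x)) u -
     frechet_derivative (\<lambda>y. \<alpha> c (chart_inv c y) u) (at (chart_map c x)) v"

(* The pullback along \<phi> of a form \<beta> on the manifold B.  For a 1-form \<beta> the value does not
   depend on the chart d of B chosen around \<phi> x. *)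
definition pullback ::
  "('b, 'f::euclidean_space) atlas \<Rightarrow> ('a \<Rightarrow> 'b) \<Rightarrow> ('b, 'f) form1 \<Rightarrow> ('a, 'e::euclidean_space) form1"
where
  "pullback B \<phi> \<beta> c x v =
     (let d = (SOME d. d \<in> B \<and> \<phi> x \<in> chart_dom d)
      in \<beta> d (\<phi> x) (frechet_derivative (chart_map d \<circ> \<phi> \<circ> chart_inv c) (at (chart_map c x)) v))"

(* Complex coframes: a basis of the complexified cotangent space at every point. *)
definition coframe :: "('a, 'e::euclidean_space) atlas \<Rightarrow> ('a, 'e) form1 list \<Rightarrow> bool" where
  "coframe A \<alpha>s \<longleftrightarrow>
     length \<alpha>s = DIM('e) \<and>
     (\<forall>c\<in>A. \<forall>x\<in>chart_dom c. \<forall>k :: nat \<Rightarrow> complex.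
        (\<forall>v. (\<Sum>i<length \<alpha>s. k i * (\<alpha>s ! i) c x v) = 0) \<longrightarrow> (\<forall>i<length \<alpha>s. k i = 0))"


subsection \<open>Oriented congruences\<close>

definition congruence_pair ::
  "('a, 'e::euclidean_space) atlas \<Rightarrow> ('a, 'e) form1 \<Rightarrow> ('a, 'e) form1 \<Rightarrow> bool" where
  "congruence_pair A \<kappa> \<mu> \<longleftrightarrow>
     one_form A \<kappa> \<and> real_form A \<kappa> \<and> one_form A \<mu> \<and>
     (\<forall>c\<in>A. \<forall>x\<in>chart_dom c. \<exists>u v w. (\<kappa> \<and>\<^sub>1 \<mu> \<and>\<^sub>2 conj_form \<mu>) c x u v w \<noteq> 0)"

definition congruence_class ::
  "('a, 'e::euclidean_space) atlas \<Rightarrow> ('a, 'e) form1 \<Rightarrow> ('a, 'e) form1 \<Rightarrow>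
   (('a, 'e) form1 \<times> ('a, 'e) form1) set" where
  "congruence_class A \<kappa> \<mu> =
     {(\<kappa>', \<mu>'). congruence_pair A \<kappa>' \<mu>' \<and>
        (\<exists>(f :: 'a \<Rightarrow> real) (h :: 'a \<Rightarrow> complex).
           smooth_fun A f \<and> smooth_fun A h \<and> (\<forall>x\<in>points A. f x \<noteq> 0 \<and> h x \<noteq> 0) \<and>
           form_eq A \<kappa>' (\<lambda>c x v. of_real (f x) * \<kappa> c x v) \<and>
           form_eq A \<mu>' (\<lambda>c x v. h x * \<mu> c x v))}"

definition oriented_congruence ::
  "('a, 'e::euclidean_space) atlas \<Rightarrow> (('a, 'e) form1 \<times> ('a, 'e) form1) set \<Rightarrow> bool" where
  "oriented_congruence A S \<longleftrightarrow>
     (\<exists>\<kappa> \<mu>. congruence_pair A \<kappa> \<mu> \<and> S = congruence_class A \<kappa> \<mu>)"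

definition structure_functions ::
  "('a, 'e::euclidean_space) atlas \<Rightarrow> ('a, 'e) form1 \<Rightarrow> ('a, 'e) form1 \<Rightarrow>
   ('a \<Rightarrow> real) \<Rightarrow> ('a \<Rightarrow> complex) \<Rightarrow> ('a \<Rightarrow> complex) \<Rightarrow> ('a \<Rightarrow> complex) \<Rightarrow> ('a \<Rightarrow> complex) \<Rightarrow> bool"
where
  "structure_functions A \<kappa> \<mu> a b p q s \<longleftrightarrow>
     smooth_fun A a \<and> smooth_fun A b \<and> smooth_fun A p \<and> smooth_fun A q \<and> smooth_fun A s \<and>
     form2_eq A (ext_diff \<kappa>) (\<lambda>c x u v.
        \<i> * of_real (a x) * (\<mu> \<and>\<^sub>1 conj_form \<mu>) c x u v +
        b x * (\<mu> \<and>\<^sub>1 \<kappa>) c x u v + cnj (b x) * (conj_form \<mu> \<and>\<^sub>1 \<kappa>) c x u v) \<and>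
     form2_eq A (ext_diff \<mu>) (\<lambda>c x u v.
        p x * (\<mu> \<and>\<^sub>1 conj_form \<mu>) c x u v +
        q x * (\<mu> \<and>\<^sub>1 \<kappa>) c x u v + s x * (conj_form \<mu> \<and>\<^sub>1 \<kappa>) c x u v)"


subsection \<open>The bundle P and its coframe\<close>

(* A representative (\<kappa>, \<mu>) identifies P with the product of M and the punctured plane; the fibre
   coordinate is z = \<rho> exp(i \<phi>). *)
definition bundle_atlas :: "('a, 'e) atlas \<Rightarrow> ('a \<times> complex, 'e \<times> complex) atlas" where
  "bundle_atlas A =
     (\<lambda>c. (chart_dom c \<times> (- {0}), \<lambda>(x, z). (chart_map c x, z))) ` A"

definition bundle_omega ::
  "('a, 'e::euclidean_space) atlas \<Rightarrow> ('a, 'e) form1 \<Rightarrow> ('a \<Rightarrow> real) \<Rightarrow>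
   ('a \<times> complex, 'e \<times> complex) form1" where
  "bundle_omega A \<kappa> a c xz v =
     of_real ((cmod (snd xz))\<^sup>2 / a (fst xz)) * pullback A fst \<kappa> c xz v"

definition bundle_omega1 ::
  "('a, 'e::euclidean_space) atlas \<Rightarrow> ('a, 'e) form1 \<Rightarrow> ('a \<times> complex, 'e \<times> complex) form1" where
  "bundle_omega1 A \<mu> c xz v = snd xz * pullback A fst \<mu> c xz v"

definition bundle_K1 :: "('a \<Rightarrow> real) \<Rightarrow> 'a \<times> complex \<Rightarrow> real" where
  "bundle_K1 k\<^sub>1 = (\<lambda>(x, z). k\<^sub>1 x / (cmod z)\<^sup>2)"

definition bundle_K2 :: "('a \<Rightarrow> complex) \<Rightarrow> 'a \<times> complex \<Rightarrow> complex" where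
  "bundle_K2 k\<^sub>2 = (\<lambda>(x, z). cis (- Arg z) * k\<^sub>2 x / of_real ((cmod z) ^ 3))"

definition bundle_coframe ::
  "('a, 'e::euclidean_space) atlas \<Rightarrow> ('a, 'e) form1 \<Rightarrow> ('a, 'e) form1 \<Rightarrow> ('a \<Rightarrow> real) \<Rightarrow>
   ('a \<times> complex, 'e \<times> complex) form1 \<Rightarrow> ('a \<Rightarrow> real) \<Rightarrow> ('a \<Rightarrow> complex) \<Rightarrow> bool" where
  "bundle_coframe A \<kappa> \<mu> a \<Omega> k\<^sub>1 k\<^sub>2 \<longleftrightarrow>
     (let P = bundle_atlas A; \<omega> = bundle_omega A \<kappa> a; \<omega>\<^sub>1 = bundle_omega1 A \<mu> in
      one_form P \<Omega> \<and> smooth_fun A k\<^sub>1 \<and> smooth_fun A k\<^sub>2 \<and>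
      coframe P [\<omega>, \<omega>\<^sub>1, conj_form \<omega>\<^sub>1, \<Omega>, conj_form \<Omega>] \<and>
      form2_eq P (ext_diff \<omega>) (\<lambda>c y u v.
         \<i> * (\<omega>\<^sub>1 \<and>\<^sub>1 conj_form \<omega>\<^sub>1) c y u v +
         ((\<Omega> \<and>\<^sub>1 \<omega>) c y u v + (conj_form \<Omega> \<and>\<^sub>1 \<omega>) c y u v)) \<and>
      form2_eq P (ext_diff \<omega>\<^sub>1) (\<Omega> \<and>\<^sub>1 \<omega>\<^sub>1) \<and>
      form2_eq P (ext_diff \<Omega>) (\<lambda>c y u v.
         of_real (bundle_K1 k\<^sub>1 y) * (\<omega>\<^sub>1 \<and>\<^sub>1 conj_form \<omega>\<^sub>1) c y u v +
         bundle_K2 k\<^sub>2 y * (\<omega>\<^sub>1 \<and>\<^sub>1 \<omega>) c y u v))"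

(* The representative (\<kappa>, \<mu>) has vanishing shear, nonvanishing twist, and K\<^sub>2 nonzero everywhere
   on P.  These properties do not depend on the representative of the structure. *)
definition admissible_pair ::
  "('a, 'e::euclidean_space) atlas \<Rightarrow> ('a, 'e) form1 \<Rightarrow> ('a, 'e) form1 \<Rightarrow> ('a \<Rightarrow> real) \<Rightarrow>
   ('a \<times> complex, 'e \<times> complex) form1 \<Rightarrow> ('a \<Rightarrow> real) \<Rightarrow> ('a \<Rightarrow> complex) \<Rightarrow> bool" where
  "admissible_pair A \<kappa> \<mu> a \<Omega> k\<^sub>1 k\<^sub>2 \<longleftrightarrow>
     (\<exists>b p q s. structure_functions A \<kappa> \<mu> a b p q s \<and> (\<forall>x\<in>points A. s x = 0)) \<and>
     (\<forall>x\<in>points A. a x \<noteq> 0) \<and>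
     bundle_coframe A \<kappa> \<mu> a \<Omega> k\<^sub>1 k\<^sub>2 \<and>
     (\<forall>y\<in>points (bundle_atlas A). bundle_K2 k\<^sub>2 y \<noteq> 0)"

definition admissible_congruence ::
  "('a, 'e::euclidean_space) atlas \<Rightarrow> (('a, 'e) form1 \<times> ('a, 'e) form1) set \<Rightarrow> bool" where
  "admissible_congruence A S \<longleftrightarrow>
     oriented_congruence A S \<and>
     (\<exists>(\<kappa>, \<mu>)\<in>S. \<exists>a \<Omega> k\<^sub>1 k\<^sub>2. admissible_pair A \<kappa> \<mu> a \<Omega> k\<^sub>1 k\<^sub>2)"


subsection \<open>The normalization and the invariant coframe\<close>

definition normal_section :: "('a \<Rightarrow> complex) \<Rightarrow> 'a \<Rightarrow> 'a \<times> complex" where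
  "normal_section k\<^sub>2 x = (x, rcis (cmod (k\<^sub>2 x) powr (1/3)) (Arg (k\<^sub>2 x)))"

lemma bundle_K2_normal_section:
  assumes "k\<^sub>2 x \<noteq> 0"
  shows "bundle_K2 k\<^sub>2 (normal_section k\<^sub>2 x) = 1"
proof -
  let ?r = "cmod (k\<^sub>2 x) powr (1/3)"
  have r: "?r > 0" using assms by simp
  have "?r ^ 3 = cmod (k\<^sub>2 x)"
    using assms by (simp flip: powr_realpow add: powr_powr)
  moreover have "Arg (rcis ?r (Arg (k\<^sub>2 x))) = Arg (k\<^sub>2 x)"
  proof (rule cis_Arg_unique)
    show "sgn (rcis ?r (Arg (k\<^sub>2 x))) = cis (Arg (k\<^sub>2 x))"
      using r by (simp add: rcis_def sgn_mult sgn_of_real)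
  qed (use Arg_bounded in auto)
  moreover have "cis (- Arg (k\<^sub>2 x)) * k\<^sub>2 x = cmod (k\<^sub>2 x)"
    by (metis cis_mult cis_zero add.left_inverse mult.assoc mult.commute mult_1
        rcis_cmod_Arg rcis_def)
  ultimately show ?thesis
    using assms by (simp add: bundle_K2_def normal_section_def flip: of_real_power)
qed

definition invariant_coframe ::
  "('a, 'e::euclidean_space) atlas \<Rightarrow> (('a, 'e) form1 \<times> ('a, 'e) form1) set \<Rightarrow>
   ('a, 'e) form1 \<Rightarrow> ('a, 'e) form1 \<Rightarrow>
   ('a \<Rightarrow> real) \<Rightarrow> ('a \<Rightarrow> complex) \<Rightarrow> ('a \<Rightarrow> complex) \<Rightarrow> ('a \<Rightarrow> complex) \<Rightarrow> bool" where
  "invariant_coframe A S \<omega> \<omega>\<^sub>1 K\<^sub>1 Z\<^sub>0 Z\<^sub>1 Z\<^sub>2 \<longleftrightarrow>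
     (\<exists>(\<kappa>, \<mu>)\<in>S. \<exists>a \<Omega> k\<^sub>1 k\<^sub>2. admissible_pair A \<kappa> \<mu> a \<Omega> k\<^sub>1 k\<^sub>2 \<and>
        (let P = bundle_atlas A; \<sigma> = normal_section k\<^sub>2 in
         form_eq A \<omega> (pullback P \<sigma> (bundle_omega A \<kappa> a)) \<and>
         form_eq A \<omega>\<^sub>1 (pullback P \<sigma> (bundle_omega1 A \<mu>)) \<and>
         form_eq A (pullback P \<sigma> \<Omega>) (\<lambda>c x v.
            Z\<^sub>1 x * \<omega>\<^sub>1 c x v + Z\<^sub>2 x * conj_form \<omega>\<^sub>1 c x v + Z\<^sub>0 x * \<omega> c x v) \<and>
         (\<forall>x\<in>points A. K\<^sub>1 x = bundle_K1 k\<^sub>1 (\<sigma> x))))"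

(* dZ = \<alpha> together with the complex conjugate equation *)
definition diff_eq_cc ::
  "('a, 'e::euclidean_space) atlas \<Rightarrow> ('a \<Rightarrow> complex) \<Rightarrow> ('a, 'e) form1 \<Rightarrow> bool" where
  "diff_eq_cc A Z \<alpha> \<longleftrightarrow>
     form_eq A (fun_diff Z) \<alpha> \<and> form_eq A (fun_diff (cnj \<circ> Z)) (conj_form \<alpha>)"

definition integrability_conditions ::
  "('a, 'e::euclidean_space) atlas \<Rightarrow> ('a, 'e) form1 \<Rightarrow> ('a, 'e) form1 \<Rightarrow>
   ('a \<Rightarrow> real) \<Rightarrow> ('a \<Rightarrow> complex) \<Rightarrow> ('a \<Rightarrow> complex) \<Rightarrow> ('a \<Rightarrow> complex) \<Rightarrow> bool" where
  "integrability_conditions A \<omega> \<omega>\<^sub>1 K\<^sub>1 Z\<^sub>0 Z\<^sub>1 Z\<^sub>2 \<longleftrightarrow>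
     (\<exists>(Z\<^sub>0\<^sub>0 :: 'a \<Rightarrow> complex) (Z\<^sub>0\<^sub>1 :: 'a \<Rightarrow> complex) (Z\<^sub>0\<^sub>2 :: 'a \<Rightarrow> complex)
       (Z\<^sub>1\<^sub>1 :: 'a \<Rightarrow> complex) (Z\<^sub>2\<^sub>1 :: 'a \<Rightarrow> complex) (Z\<^sub>2\<^sub>2 :: 'a \<Rightarrow> complex)
       (K\<^sub>1\<^sub>1 :: 'a \<Rightarrow> complex) (K\<^sub>1\<^sub>0 :: 'a \<Rightarrow> real).
        smooth_fun A Z\<^sub>0\<^sub>0 \<and> smooth_fun A Z\<^sub>0\<^sub>1 \<and> smooth_fun A Z\<^sub>0\<^sub>2 \<and> smooth_fun A Z\<^sub>1\<^sub>1 \<and>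
        smooth_fun A Z\<^sub>2\<^sub>1 \<and> smooth_fun A Z\<^sub>2\<^sub>2 \<and> smooth_fun A K\<^sub>1\<^sub>1 \<and> smooth_fun A K\<^sub>1\<^sub>0 \<and>
        diff_eq_cc A Z\<^sub>1 (\<lambda>c x v.
           Z\<^sub>1\<^sub>1 x * \<omega>\<^sub>1 c x v +
           (- of_real (K\<^sub>1 x) + \<i> * Z\<^sub>0 x - Z\<^sub>1 x * Z\<^sub>2 x + Z\<^sub>2 x * cnj (Z\<^sub>2 x) + Z\<^sub>2\<^sub>1 x)
             * conj_form \<omega>\<^sub>1 c x v +
           (Z\<^sub>0 x * cnj (Z\<^sub>2 x) + Z\<^sub>0\<^sub>1 x - 1) * \<omega> c x v) \<and>
        diff_eq_cc A Z\<^sub>2 (\<lambda>c x v.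
           Z\<^sub>2\<^sub>1 x * \<omega>\<^sub>1 c x v + Z\<^sub>2\<^sub>2 x * conj_form \<omega>\<^sub>1 c x v +
           (Z\<^sub>0\<^sub>2 x + Z\<^sub>0 x * cnj (Z\<^sub>1 x) + Z\<^sub>0 x * Z\<^sub>2 x - cnj (Z\<^sub>0 x) * Z\<^sub>2 x) * \<omega> c x v) \<and>
        diff_eq_cc A Z\<^sub>0 (\<lambda>c x v.
           Z\<^sub>0\<^sub>1 x * \<omega>\<^sub>1 c x v + Z\<^sub>0\<^sub>2 x * conj_form \<omega>\<^sub>1 c x v + Z\<^sub>0\<^sub>0 x * \<omega> c x v) \<and>
        diff_eq_cc A (of_real \<circ> K\<^sub>1) (\<lambda>c x v.
           K\<^sub>1\<^sub>1 x * \<omega>\<^sub>1 c x v + cnj (K\<^sub>1\<^sub>1 x) * conj_form \<omega>\<^sub>1 c x v +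
           of_real (K\<^sub>1\<^sub>0 x) * \<omega> c x v))"

definition invariant_system ::
  "('a, 'e::euclidean_space) atlas \<Rightarrow> ('a, 'e) form1 \<Rightarrow> ('a, 'e) form1 \<Rightarrow>
   ('a \<Rightarrow> real) \<Rightarrow> ('a \<Rightarrow> complex) \<Rightarrow> ('a \<Rightarrow> complex) \<Rightarrow> ('a \<Rightarrow> complex) \<Rightarrow> bool" where
  "invariant_system A \<omega> \<omega>\<^sub>1 K\<^sub>1 Z\<^sub>0 Z\<^sub>1 Z\<^sub>2 \<longleftrightarrow>
     one_form A \<omega> \<and> real_form A \<omega> \<and> one_form A \<omega>\<^sub>1 \<and> coframe A [\<omega>, \<omega>\<^sub>1, conj_form \<omega>\<^sub>1] \<and>
     smooth_fun A K\<^sub>1 \<and> smooth_fun A Z\<^sub>0 \<and> smooth_fun A Z\<^sub>1 \<and> smooth_fun A Z\<^sub>2 \<and>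
     form2_eq A (ext_diff \<omega>) (\<lambda>c x u v.
        \<i> * (\<omega>\<^sub>1 \<and>\<^sub>1 conj_form \<omega>\<^sub>1) c x u v +
        (Z\<^sub>1 x + cnj (Z\<^sub>2 x)) * (\<omega>\<^sub>1 \<and>\<^sub>1 \<omega>) c x u v +
        (Z\<^sub>2 x + cnj (Z\<^sub>1 x)) * (conj_form \<omega>\<^sub>1 \<and>\<^sub>1 \<omega>) c x u v) \<and>
     form2_eq A (ext_diff \<omega>\<^sub>1) (\<lambda>c x u v.
        - Z\<^sub>2 x * (\<omega>\<^sub>1 \<and>\<^sub>1 conj_form \<omega>\<^sub>1) c x u v - Z\<^sub>0 x * (\<omega>\<^sub>1 \<and>\<^sub>1 \<omega>) c x u v) \<and>
     form2_eq A (ext_diff (conj_form \<omega>\<^sub>1)) (\<lambda>c x u v.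
        cnj (Z\<^sub>2 x) * (\<omega>\<^sub>1 \<and>\<^sub>1 conj_form \<omega>\<^sub>1) c x u v -
        cnj (Z\<^sub>0 x) * (conj_form \<omega>\<^sub>1 \<and>\<^sub>1 \<omega>) c x u v) \<and>
     integrability_conditions A \<omega> \<omega>\<^sub>1 K\<^sub>1 Z\<^sub>0 Z\<^sub>1 Z\<^sub>2"


subsection \<open>Local equivalence\<close>

definition congruence_equivalence ::
  "('a::topological_space, 'e::euclidean_space) atlas \<Rightarrow> (('a, 'e) form1 \<times> ('a, 'e) form1) set \<Rightarrow>
   ('b::topological_space, 'e) atlas \<Rightarrow> (('b, 'e) form1 \<times> ('b, 'e) form1) set \<Rightarrow>
   'a set \<Rightarrow> 'b set \<Rightarrow> ('a \<Rightarrow> 'b) \<Rightarrow> bool" where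
  "congruence_equivalence A S A' S' U V \<phi> \<longleftrightarrow>
     local_diffeo A A' U V \<phi> \<and>
     (\<exists>(\<kappa>, \<mu>)\<in>S. \<exists>(\<kappa>', \<mu>')\<in>S'. \<exists>(f :: 'a \<Rightarrow> real) (h :: 'a \<Rightarrow> complex).
        smooth_fun_on A U f \<and> smooth_fun_on A U h \<and> (\<forall>x\<in>U. f x \<noteq> 0 \<and> h x \<noteq> 0) \<and>
        form_eq_on A U (pullback A' \<phi> \<kappa>') (\<lambda>c x v. of_real (f x) * \<kappa> c x v) \<and>
        form_eq_on A U (pullback A' \<phi> \<mu>') (\<lambda>c x v. h x * \<mu> c x v))"

definition coframe_equivalence ::
  "('a::topological_space, 'e::euclidean_space) atlas \<Rightarrow> ('a, 'e) form1 \<Rightarrow> ('a, 'e) form1 \<Rightarrow>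
   ('b::topological_space, 'e) atlas \<Rightarrow> ('b, 'e) form1 \<Rightarrow> ('b, 'e) form1 \<Rightarrow>
   'a set \<Rightarrow> 'b set \<Rightarrow> ('a \<Rightarrow> 'b) \<Rightarrow> bool" where
  "coframe_equivalence A \<omega> \<omega>\<^sub>1 A' \<omega>' \<omega>\<^sub>1' U V \<phi> \<longleftrightarrow>
     local_diffeo A A' U V \<phi> \<and>
     form_eq_on A U (pullback A' \<phi> \<omega>') \<omega> \<and> form_eq_on A U (pullback A' \<phi> \<omega>\<^sub>1') \<omega>\<^sub>1"

definition locally_equivalent ::
  "('a::topological_space, 'e::euclidean_space) atlas \<Rightarrow> (('a, 'e) form1 \<times> ('a, 'e) form1) set \<Rightarrow>
   ('b::topological_space, 'e) atlas \<Rightarrow> (('b, 'e) form1 \<times> ('b, 'e) form1) set \<Rightarrow> bool" where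
  "locally_equivalent A S A' S' \<longleftrightarrow>
     (\<exists>U V \<phi>. U \<noteq> {} \<and> congruence_equivalence A S A' S' U V \<phi>)"

definition locally_equivalent_at ::
  "('a::topological_space, 'e::euclidean_space) atlas \<Rightarrow> (('a, 'e) form1 \<times> ('a, 'e) form1) set \<Rightarrow> 'a \<Rightarrow>
   ('b::topological_space, 'e) atlas \<Rightarrow> (('b, 'e) form1 \<times> ('b, 'e) form1) set \<Rightarrow> 'b \<Rightarrow> bool" where
  "locally_equivalent_at A S x A' S' x' \<longleftrightarrow>
     (\<exists>U V \<phi>. x \<in> U \<and> \<phi> x = x' \<and> congruence_equivalence A S A' S' U V \<phi>)"

end

theory Submission
  imports Defs
begin

text \<open>The equations for \<open>d\<omega>\<close> and \<open>d\<omega>\<^sub>1\<close> determine \<open>\<Omega>\<close> pointwise, which forces \<open>\<Omega> = dz/z + \<pi>\<^sup>* \<alpha>\<close>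
  for a form \<open>\<alpha>\<close> on \<open>M\<close>, so the structure equations on \<open>P\<close> amount to equations for \<open>(\<kappa>, \<mu>, \<alpha>)\<close> on
  \<open>M\<close>.  Pulling back by the section \<open>z = h\<close> with \<open>h \<bar>h\<bar>\<^sup>2 = k\<^sub>2\<close> turns \<open>\<alpha>\<close> into \<open>\<alpha> + dh/h\<close> and
  makes the coefficient of \<open>\<omega>\<^sub>1 \<and> \<omega>\<close> in \<open>d\<alpha>\<close> equal to \<open>1\<close>.  The integrability conditions are the
  three coefficients of this equation for \<open>\<alpha> = Z\<^sub>1 \<omega>\<^sub>1 + Z\<^sub>2 conj \<omega>\<^sub>1 + Z\<^sub>0 \<omega>\<close>.  If two normalized
  coframes are related by \<open>\<theta> = f \<omega>\<close> and \<open>\<theta>\<^sub>1 = h \<omega>\<^sub>1\<close>, then \<open>f = \<bar>h\<bar>\<^sup>2\<close>, their forms differ by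
  \<open>dh/h\<close>, and comparing the exterior derivatives gives \<open>h \<bar>h\<bar>\<^sup>2 = 1\<close>, that is \<open>h = f = 1\<close>.\<close>

subsection \<open>Calculus of smooth functions\<close>

text \<open>Once \<open>dz/z\<close> is subtracted from \<Omega>, the structure equations at the
  points \<open>(x, z)\<close> of one fibre have data that depend on \<open>x\<close> only.
  Uniqueness of the solution makes the remainder independent of \<open>z\<close> and blind to
  vertical vectors, so it descends to the base; its value at \<open>z = 1\<close> serves as
  \<alpha>. Comparisons then stay on the base: choice of representative and local equivalence are
  both a comparison of two normalized triples on an open part of a single chart. The obstacle is
  smoothness and naturality rather than algebra. Forms are families of chart components, so d d = 0
  and the compatibility of d with pullbacks are derived from the symmetry of second derivatives. The
  section is given through \<open>Arg\<close>, which jumps along the negative real axis; but it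
  equals \<open>k2 / |k2|^(2/3)\<close>, which is smooth. Conversely, a coframe that solves the
  system has twist 1 and K2 = 1 at \<open>z = 1\<close>, so it is its own normalization.\<close>

abbreviation fderiv :: "('e::real_normed_vector \<Rightarrow> 'v::real_normed_vector) \<Rightarrow> 'e \<Rightarrow> 'e \<Rightarrow> 'v" (\<open>\<D>\<close>) where
  "\<D> f x \<equiv> frechet_derivative f (at x)"

lemma times_diff_on_subset: "times_diff_on n S f \<Longrightarrow> T \<subseteq> S \<Longrightarrow> times_diff_on n T f"
proof (induction n arbitrary: f)
  case 0
  then show ?case by (auto intro: continuous_on_subset)
next
  case (Suc n)
  then show ?case by auto
qed

lemma times_diff_on_Suc_D: "times_diff_on (Suc n) S f \<Longrightarrow> times_diff_on n S f"
proof (induction n arbitrary: f)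
  case 0
  then show ?case
    by (auto intro!: continuous_at_imp_continuous_on differentiable_imp_continuous_within)
next
  case (Suc n)
  then show ?case by simp
qed

lemma times_diff_on_cong:
  assumes "open S" "times_diff_on n S f" "\<And>x. x \<in> S \<Longrightarrow> f x = g x"
  shows "times_diff_on n S g"
  using assms(2,3)
proof (induction n arbitrary: f g)
  case 0
  then show ?case using continuous_on_cong[of S S f g] by auto
next
  case (Suc n)
  have f: "f differentiable at x" if "x \<in> S" for x
    using Suc.prems that by simp
  have d: "(g has_derivative \<D> f x) (at x)" if "x \<in> S" for x
    by (rule has_derivative_transform_within_open[OF _ assms(1) that Suc.prems(2)])
      (use f[OF that] in \<open>simp_all add: frechet_derivative_works\<close>)
  have "\<D> f x = \<D> g x" if "x \<in> S" for x
    using frechet_derivative_at[OF d[OF that]] .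
  then have "times_diff_on n S (\<lambda>x. \<D> g x v)" for v
    by (rule_tac Suc.IH[where f = "\<lambda>x. \<D> f x v"]) (use Suc.prems(1) in simp_all)
  moreover have "g differentiable at x" if "x \<in> S" for x
    by (rule differentiableI[OF d[OF that]])
  ultimately show ?case by simp
qed

text \<open>\<open>frechet_derivative\<close> is a choice operator. On an open set any explicit
  derivative may take its place, so the closure proofs below can work with the usual formulas of
  differentiation.\<close>

lemma times_diff_on_SucI:
  assumes "open S" "\<And>x. x \<in> S \<Longrightarrow> (f has_derivative f' x) (at x)"
    and "\<And>v. times_diff_on n S (\<lambda>x. f' x v)"
  shows "times_diff_on (Suc n) S f"
proof -
  have "times_diff_on n S (\<lambda>x. \<D> f x v)" for v
    by (rule times_diff_on_cong[OF assms(1) assms(3)[of v]]) (simp add: frechet_derivative_at[OF assms(2)])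
  moreover have "f differentiable at x" if "x \<in> S" for x
    by (rule differentiableI[OF assms(2)[OF that]])
  ultimately show ?thesis by simp
qed

lemma times_diff_on_SucD:
  assumes "times_diff_on (Suc n) S f"
  shows "x \<in> S \<Longrightarrow> (f has_derivative \<D> f x) (at x)"
    and "times_diff_on n S (\<lambda>x. \<D> f x v)"
proof -
  show "(f has_derivative \<D> f x) (at x)" if "x \<in> S"
    using assms that frechet_derivative_works[of f "at x"] by simp
  show "times_diff_on n S (\<lambda>x. \<D> f x v)"
    using assms by simp
qed

lemma times_diff_on_const: "times_diff_on n S (\<lambda>x. c)"
  by (induction n arbitrary: c) auto

lemma times_diff_on_bounded_linear:
  assumes "bounded_linear L" shows "times_diff_on n S L"
proof (cases n)
  case 0
  then show ?thesis using assms by (simp add: linear_continuous_on)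
next
  case (Suc m)
  have "\<D> L x = L" for x
    by (rule frechet_derivative_at[OF bounded_linear_imp_has_derivative[OF assms], symmetric])
  then show ?thesis
    using assms by (simp add: Suc times_diff_on_const bounded_linear_imp_differentiable)
qed

lemma times_diff_on_add:
  assumes "open S" "times_diff_on n S f" "times_diff_on n S g"
  shows "times_diff_on n S (\<lambda>x. f x + g x)"
  using assms(2,3)
proof (induction n arbitrary: f g)
  case 0
  then show ?case by (auto intro: continuous_intros)
next
  case (Suc n)
  note fg = Suc.prems[THEN times_diff_on_SucD(1)] Suc.prems[THEN times_diff_on_SucD(2)]
  show ?case
    by (rule times_diff_on_SucI[OF assms(1), OF has_derivative_add[OF fg(1,2)] Suc.IH[OF fg(3,4)]])
qed

text \<open>In the Leibniz rule each factor meets the derivative of the other, so the induction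
  needs order n of the functions as well as of their derivatives.\<close>

lemma times_diff_on_bilinear:
  assumes "bounded_bilinear B" "open S" "times_diff_on n S f" "times_diff_on n S g"
  shows "times_diff_on n S (\<lambda>x. B (f x) (g x))"
  using assms(3,4)
proof (induction n arbitrary: f g)
  case 0
  then show ?case by (auto intro: bounded_bilinear.continuous_on[OF assms(1)])
next
  case (Suc n)
  note fg = Suc.prems[THEN times_diff_on_Suc_D] Suc.prems[THEN times_diff_on_SucD(2)]
    Suc.prems[THEN times_diff_on_SucD(1)]
  show ?case
    by (rule times_diff_on_SucI[OF assms(2), OF bounded_bilinear.FDERIV[OF assms(1) fg(5,6)]
          times_diff_on_add[OF assms(2) Suc.IH[OF fg(1,4)] Suc.IH[OF fg(3,2)]]])
qed

lemma times_diff_on_linear_compose: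
  assumes "bounded_linear L" "open S" "times_diff_on n S f"
  shows "times_diff_on n S (\<lambda>x. L (f x))"
  using assms(3)
proof (induction n arbitrary: f)
  case 0
  then show ?case by (simp add: bounded_linear.continuous_on[OF assms(1)])
next
  case (Suc n)
  note f = times_diff_on_SucD[OF Suc.prems]
  show ?case
    by (rule times_diff_on_SucI[OF assms(2), OF bounded_linear.has_derivative[OF assms(1) f(1)] Suc.IH[OF f(2)]])
qed

lemma times_diff_on_sum:
  assumes "open S" "finite I" "\<And>i. i \<in> I \<Longrightarrow> times_diff_on n S (f i)"
  shows "times_diff_on n S (\<lambda>x. \<Sum>i\<in>I. f i x)"
  using assms(2,3)
  by (induction I rule: finite_induct) (auto intro!: times_diff_on_const times_diff_on_add[OF assms(1)])

lemma linear_eq_sum_Basis: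
  fixes D :: "'f::euclidean_space \<Rightarrow> 'v::real_vector"
  assumes "linear D"
  shows "D w = (\<Sum>b\<in>Basis. (w \<bullet> b) *\<^sub>R D b)"
proof -
  have "D w = D (\<Sum>b\<in>Basis. (w \<bullet> b) *\<^sub>R b)" by (simp add: euclidean_representation)
  also have "\<dots> = (\<Sum>b\<in>Basis. (w \<bullet> b) *\<^sub>R D b)"
    by (simp add: linear_sum[OF assms] linear_cmul[OF assms])
  finally show ?thesis .
qed

text \<open>The chain rule yields \<open>Dg (f x) (Df x v)\<close>, where the direction of the outer
  derivative moves with x, whereas \<open>times_diff_on\<close> speaks of derivatives in fixed
  directions. Expanding \<open>Df x v\<close> in the basis of the Euclidean target leaves fixed
  directions b and scalar coefficients.\<close>

lemma times_diff_on_compose: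
  fixes f :: "'e::real_normed_vector \<Rightarrow> 'f::euclidean_space"
    and g :: "'f \<Rightarrow> 'v::real_normed_vector"
  assumes "open S" "open T" "f ` S \<subseteq> T" "times_diff_on n S f" "times_diff_on n T g"
  shows "times_diff_on n S (\<lambda>x. g (f x))"
  using assms(4,5)
proof (induction n arbitrary: g)
  case 0
  then show ?case
    using continuous_on_compose2[of T g S f] assms(3) by simp
next
  case (Suc n)
  define Df where "Df x = \<D> f x" for x
  define Dg where "Dg x = \<D> g x" for x
  have df: "(f has_derivative Df x) (at x)" if "x \<in> S" for x
    using times_diff_on_SucD(1)[OF Suc.prems(1) that] unfolding Df_def .
  have dg: "(g has_derivative Dg (f x)) (at (f x))" if "x \<in> S" for x
    using times_diff_on_SucD(1)[OF Suc.prems(2), of "f x"] that assms(3) unfolding Dg_def by blast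
  have Df: "times_diff_on n S (\<lambda>x. Df x v)" for v
    using times_diff_on_SucD(2)[OF Suc.prems(1)] unfolding Df_def .
  have Dg: "times_diff_on n S (\<lambda>x. Dg (f x) b)" for b
    using Suc.IH[OF times_diff_on_Suc_D[OF Suc.prems(1)] times_diff_on_SucD(2)[OF Suc.prems(2)]]
    unfolding Dg_def .
  show ?case
  proof (rule times_diff_on_SucI[OF assms(1)])
    fix x assume x: "x \<in> S"
    have *: "(\<lambda>v. Dg (f x) (Df x v)) = (\<lambda>v. \<Sum>b\<in>Basis. (Df x v \<bullet> b) *\<^sub>R Dg (f x) b)"
      by (rule ext, rule linear_eq_sum_Basis[OF has_derivative_linear[OF dg[OF x]]])
    show "((\<lambda>x. g (f x)) has_derivative (\<lambda>v. \<Sum>b\<in>Basis. (Df x v \<bullet> b) *\<^sub>R Dg (f x) b)) (at x)"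
      using has_derivative_compose[OF df[OF x] dg[OF x]] unfolding * .
  next
    fix v
    show "times_diff_on n S (\<lambda>x. \<Sum>b\<in>Basis. (Df x v \<bullet> b) *\<^sub>R Dg (f x) b)"
      by (intro times_diff_on_sum[OF assms(1)] finite_Basis
          times_diff_on_bilinear[OF bounded_bilinear_scaleR assms(1)]
          times_diff_on_bilinear[OF bounded_bilinear_inner assms(1)] Df Dg times_diff_on_const)
  qed
qed

lemma times_diff_on_inverse:
  fixes f :: "'e::real_normed_vector \<Rightarrow> 'v::real_normed_field"
  assumes "open S" "times_diff_on n S f" "\<And>x. x \<in> S \<Longrightarrow> f x \<noteq> 0"
  shows "times_diff_on n S (\<lambda>x. inverse (f x))"
  using assms(2)
proof (induction n)
  case 0
  then show ?case using assms(3) by (auto intro: continuous_intros)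
next
  case (Suc n)
  note * = Suc.IH[OF times_diff_on_Suc_D[OF Suc.prems]] times_diff_on_SucD(2)[OF Suc.prems]
  \<comment> \<open>The derivative of 1/f, with its sign written as a factor -1, is an iterated
    product, so the bilinear rule and the induction hypothesis for 1/f itself suffice.\<close>
  have "times_diff_on n S (\<lambda>x. - 1 * (inverse (f x) * \<D> f x v * inverse (f x)))" for v
    by (intro times_diff_on_bilinear[OF bounded_bilinear_mult assms(1)] * times_diff_on_const)
  then show ?case
    using times_diff_on_SucD(1)[OF Suc.prems] assms(3)
    by (intro times_diff_on_SucI[OF assms(1) Deriv.has_derivative_inverse]) auto
qed

text \<open>Differentiation lowers the exponent, so the induction ranges over all exponents. The
  exponent 1/3 is the one used later, for the normalizing section.\<close>

lemma times_diff_on_powr: "times_diff_on n {0<..} (\<lambda>t::real. t powr r)"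
proof (induction n arbitrary: r)
  case 0
  then show ?case by (auto intro!: continuous_intros)
next
  case (Suc n)
  have "((\<lambda>t. t powr r) has_derivative (\<lambda>v. r * t powr (r - 1) * v)) (at t)" if "t > 0" for t
    using has_real_derivative_powr[OF that, of r] by (simp add: has_field_derivative_def)
  then show ?case
    by (intro times_diff_on_SucI)
      (auto intro!: times_diff_on_bilinear[OF bounded_bilinear_mult] times_diff_on_const Suc.IH)
qed

lemma smooth_on_subset: "smooth_on S f \<Longrightarrow> T \<subseteq> S \<Longrightarrow> smooth_on T f"
  unfolding smooth_on_def using times_diff_on_subset by blast

lemma smooth_on_cong:
  "open S \<Longrightarrow> smooth_on S f \<Longrightarrow> (\<And>x. x \<in> S \<Longrightarrow> f x = g x) \<Longrightarrow> smooth_on S g"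
  unfolding smooth_on_def using times_diff_on_cong by blast

lemma smooth_on_differentiable: "smooth_on S f \<Longrightarrow> x \<in> S \<Longrightarrow> f differentiable at x"
  unfolding smooth_on_def by (metis times_diff_on.simps(2))

lemma smooth_on_has_derivative:
  "smooth_on S f \<Longrightarrow> x \<in> S \<Longrightarrow> (f has_derivative \<D> f x) (at x)"
  using smooth_on_differentiable frechet_derivative_works by blast

lemma smooth_on_frechet: "smooth_on S f \<Longrightarrow> smooth_on S (\<lambda>x. \<D> f x v)"
  unfolding smooth_on_def by (metis times_diff_on.simps(2))

lemma smooth_on_continuous: "smooth_on S f \<Longrightarrow> continuous_on S f"
  unfolding smooth_on_def by (metis times_diff_on.simps(1))

lemma smooth_on_const: "smooth_on S (\<lambda>x. c)"
  unfolding smooth_on_def by (blast intro: times_diff_on_const)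

lemma smooth_on_bounded_linear: "bounded_linear L \<Longrightarrow> smooth_on S L"
  unfolding smooth_on_def by (blast intro: times_diff_on_bounded_linear)

lemma smooth_on_add:
  "open S \<Longrightarrow> smooth_on S f \<Longrightarrow> smooth_on S g \<Longrightarrow> smooth_on S (\<lambda>x. f x + g x)"
  unfolding smooth_on_def by (blast intro: times_diff_on_add)

lemma smooth_on_bilinear:
  "bounded_bilinear B \<Longrightarrow> open S \<Longrightarrow> smooth_on S f \<Longrightarrow> smooth_on S g \<Longrightarrow> smooth_on S (\<lambda>x. B (f x) (g x))"
  unfolding smooth_on_def by (blast intro: times_diff_on_bilinear)

lemma smooth_on_mult:
  fixes f g :: "'e::real_normed_vector \<Rightarrow> 'v::real_normed_algebra"
  shows "open S \<Longrightarrow> smooth_on S f \<Longrightarrow> smooth_on S g \<Longrightarrow> smooth_on S (\<lambda>x. f x * g x)"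
  by (rule smooth_on_bilinear[OF bounded_bilinear_mult])

lemma smooth_on_compose:
  fixes f :: "'e::real_normed_vector \<Rightarrow> 'f::euclidean_space"
  shows "open S \<Longrightarrow> open T \<Longrightarrow> f ` S \<subseteq> T \<Longrightarrow> smooth_on S f \<Longrightarrow> smooth_on T g \<Longrightarrow> smooth_on S (\<lambda>x. g (f x))"
  unfolding smooth_on_def by (blast intro: times_diff_on_compose)

lemma smooth_on_linear_compose:
  "bounded_linear L \<Longrightarrow> open S \<Longrightarrow> smooth_on S f \<Longrightarrow> smooth_on S (\<lambda>x. L (f x))"
  unfolding smooth_on_def by (blast intro: times_diff_on_linear_compose)

lemma smooth_on_minus: "open S \<Longrightarrow> smooth_on S f \<Longrightarrow> smooth_on S (\<lambda>x. - f x)"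
  by (rule smooth_on_linear_compose[OF bounded_linear_minus[OF bounded_linear_ident]])

lemma smooth_on_diff:
  "open S \<Longrightarrow> smooth_on S f \<Longrightarrow> smooth_on S g \<Longrightarrow> smooth_on S (\<lambda>x. f x - g x)"
  using smooth_on_add[of S f "\<lambda>x. - g x"] smooth_on_minus[of S g] by simp

lemma smooth_on_cnj: "open S \<Longrightarrow> smooth_on S f \<Longrightarrow> smooth_on S (\<lambda>x. cnj (f x))"
  by (rule smooth_on_linear_compose[OF bounded_linear_cnj])

lemma smooth_on_of_real:
  "open S \<Longrightarrow> smooth_on S f \<Longrightarrow> smooth_on S (\<lambda>x. complex_of_real (f x))"
  by (rule smooth_on_linear_compose[OF bounded_linear_of_real])

lemma smooth_on_Re: "open S \<Longrightarrow> smooth_on S f \<Longrightarrow> smooth_on S (\<lambda>x. Re (f x))"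
  by (rule smooth_on_linear_compose[OF bounded_linear_Re])

lemma smooth_on_inverse:
  fixes f :: "'e::real_normed_vector \<Rightarrow> 'v::real_normed_field"
  shows "open S \<Longrightarrow> smooth_on S f \<Longrightarrow> (\<And>x. x \<in> S \<Longrightarrow> f x \<noteq> 0) \<Longrightarrow> smooth_on S (\<lambda>x. inverse (f x))"
  unfolding smooth_on_def by (blast intro: times_diff_on_inverse)

lemma smooth_on_divide:
  fixes f g :: "'e::real_normed_vector \<Rightarrow> 'v::real_normed_field"
  shows "open S \<Longrightarrow> smooth_on S f \<Longrightarrow> smooth_on S g \<Longrightarrow> (\<And>x. x \<in> S \<Longrightarrow> g x \<noteq> 0) \<Longrightarrow>
    smooth_on S (\<lambda>x. f x / g x)"
  using smooth_on_mult[of S f "\<lambda>x. inverse (g x)"] smooth_on_inverse[of S g]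
  by (simp add: divide_inverse)

lemma smooth_on_powr:
  fixes f :: "'e::real_normed_vector \<Rightarrow> real"
  assumes "open S" "smooth_on S f" "\<And>x. x \<in> S \<Longrightarrow> f x > 0"
  shows "smooth_on S (\<lambda>x. f x powr r)"
  by (rule smooth_on_compose[where T = "{0<..}" and g = "\<lambda>t. t powr r"])
    (use assms in \<open>auto simp: smooth_on_def times_diff_on_powr\<close>)

section \<open>Symmetry of second derivatives\<close>

lemma has_derivative_along_line:
  assumes "(f has_derivative f') (at (x + t *\<^sub>R v))"
  shows "((\<lambda>t. f (x + t *\<^sub>R v)) has_derivative (\<lambda>s. f' (s *\<^sub>R v))) (at t)"
proof -
  have "((\<lambda>t. x + t *\<^sub>R v) has_derivative (\<lambda>s. s *\<^sub>R v)) (at t)"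
    by (auto intro!: derivative_eq_intros)
  from has_derivative_compose[OF this assms] show ?thesis .
qed

text \<open>Two applications of the mean value theorem, first in the direction \<open>v\<close>, then in the direction \<open>u\<close>.\<close>
lemma second_difference:
  fixes f :: "'e::real_normed_vector \<Rightarrow> real"
  assumes "smooth_on (ball x e) f" "t > 0" "t * norm u + t * norm v < e"
  obtains y where "dist y x \<le> t * norm u + t * norm v"
    "f (x + t *\<^sub>R u + t *\<^sub>R v) - f (x + t *\<^sub>R u) - f (x + t *\<^sub>R v) + f x =
      t * t * \<D> (\<lambda>z. \<D> f z v) y u"
proof -
  have inb: "x + s *\<^sub>R u + r *\<^sub>R v \<in> ball x e \<and> dist (x + s *\<^sub>R u + r *\<^sub>R v) x \<le> t * norm u + t * norm v"
    if "0 \<le> s" "s \<le> t" "0 \<le> r" "r \<le> t" for s r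
  proof -
    have "dist (x + s *\<^sub>R u + r *\<^sub>R v) x = norm (s *\<^sub>R u + r *\<^sub>R v)"
      by (simp add: dist_norm algebra_simps)
    also have "\<dots> \<le> s * norm u + r * norm v"
      using norm_triangle_ineq[of "s *\<^sub>R u" "r *\<^sub>R v"] that by simp
    also have "\<dots> \<le> t * norm u + t * norm v"
      using that by (intro add_mono mult_right_mono) auto
    finally show ?thesis using assms(3) by (simp add: dist_commute)
  qed
  define D where "D z = \<D> f z" for z
  have lin: "D z (s *\<^sub>R w) = s * D z w" if "z \<in> ball x e" for z s w
    using linear_cmul[OF linear_frechet_derivative[OF smooth_on_differentiable[OF assms(1) that]], of s w]
    by (simp add: D_def)
  define g where "g r = f (x + t *\<^sub>R u + r *\<^sub>R v) - f (x + r *\<^sub>R v)" for r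
  have "\<exists>r\<in>{0<..<t}. g t - g 0 = D (x + t *\<^sub>R u + r *\<^sub>R v) ((t - 0) *\<^sub>R v) - D (x + r *\<^sub>R v) ((t - 0) *\<^sub>R v)"
    unfolding g_def D_def
  proof (rule mvt_simple[OF assms(2)])
    fix r assume "0 \<le> r" "r \<le> t"
    then have "((\<lambda>r. f (x + t *\<^sub>R u + r *\<^sub>R v)) has_derivative (\<lambda>s. D (x + t *\<^sub>R u + r *\<^sub>R v) (s *\<^sub>R v))) (at r)"
       "((\<lambda>r. f (x + r *\<^sub>R v)) has_derivative (\<lambda>s. D (x + r *\<^sub>R v) (s *\<^sub>R v))) (at r)"
      using inb[of t r] inb[of 0 r] assms(2) unfolding D_def
      by (auto intro!: has_derivative_along_line smooth_on_has_derivative[OF assms(1)])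
    then show "((\<lambda>r. f (x + t *\<^sub>R u + r *\<^sub>R v) - f (x + r *\<^sub>R v)) has_derivative
        (\<lambda>s. \<D> f (x + t *\<^sub>R u + r *\<^sub>R v) (s *\<^sub>R v) -
          \<D> f (x + r *\<^sub>R v) (s *\<^sub>R v))) (at r within {0..t})"
      unfolding D_def by (auto intro: has_derivative_at_withinI has_derivative_diff)
  qed
  then obtain r where r: "0 < r" "r < t"
    and gr: "g t - g 0 = t * (D (x + t *\<^sub>R u + r *\<^sub>R v) v - D (x + r *\<^sub>R v) v)"
    using inb[of t] inb[of 0] assms(2) lin by (auto simp: algebra_simps)
  define E where "E z = \<D> (\<lambda>z. D z v) z" for z
  have sm: "smooth_on (ball x e) (\<lambda>z. D z v)"
    unfolding D_def by (rule smooth_on_frechet[OF assms(1)])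
  have "\<exists>s\<in>{0<..<t}. D (x + r *\<^sub>R v + t *\<^sub>R u) v - D (x + r *\<^sub>R v + 0 *\<^sub>R u) v =
      E (x + r *\<^sub>R v + s *\<^sub>R u) ((t - 0) *\<^sub>R u)"
  proof (rule mvt_simple[OF assms(2)])
    fix s assume "0 \<le> s" "s \<le> t"
    then have "x + r *\<^sub>R v + s *\<^sub>R u \<in> ball x e"
      using inb[of s r] r by (simp add: algebra_simps)
    from has_derivative_along_line[OF smooth_on_has_derivative[OF sm this]]
    show "((\<lambda>s. D (x + r *\<^sub>R v + s *\<^sub>R u) v) has_derivative (\<lambda>q. E (x + r *\<^sub>R v + s *\<^sub>R u) (q *\<^sub>R u)))
        (at s within {0..t})"
      unfolding E_def by (rule has_derivative_at_withinI)
  qed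
  then obtain s where s: "0 < s" "s < t"
    and Es: "D (x + r *\<^sub>R v + t *\<^sub>R u) v - D (x + r *\<^sub>R v) v = E (x + r *\<^sub>R v + s *\<^sub>R u) (t *\<^sub>R u)"
    by auto
  define y where "y = x + r *\<^sub>R v + s *\<^sub>R u"
  have y: "y \<in> ball x e" "dist y x \<le> t * norm u + t * norm v"
    using inb[of s r] r s by (simp_all add: y_def algebra_simps)
  have "linear (E y)"
    unfolding E_def by (rule linear_frechet_derivative[OF smooth_on_differentiable[OF sm y(1)]])
  from linear_cmul[OF this, of t u] have "E y (t *\<^sub>R u) = t * E y u" by simp
  then have "g t - g 0 = t * t * E y u"
    using gr Es by (simp add: y_def algebra_simps)
  then show ?thesis
    by (intro that[OF y(2)]) (simp add: g_def E_def D_def algebra_simps)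
qed

text \<open>The second difference quotient \<open>Q\<close> is symmetric in u and v. By
  \<open>second_difference\<close> it is a value of either mixed derivative at a point that tends to
  x, so by continuity both mixed derivatives at x are the limit of \<open>Q\<close> at 0 from the
  right.\<close>

lemma symmetric_second_derivative_real:
  fixes f :: "'e::real_normed_vector \<Rightarrow> real"
  assumes "open S" "x \<in> S" "smooth_on S f"
  shows "\<D> (\<lambda>z. \<D> f z v) x u =
    \<D> (\<lambda>z. \<D> f z u) x v"
proof -
  obtain e where e: "e > 0" "ball x e \<subseteq> S"
    using assms open_contains_ball by blast
  have sm: "smooth_on (ball x e) f" using smooth_on_subset assms e by blast
  \<comment> \<open>The summand 1 keeps N positive even if u and v both vanish.\<close>
  define N where "N = norm u + norm v + 1"
  have N: "N > 0" "t * norm u + t * norm v \<le> t * N" if "t \<ge> 0" for t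
    using that by (auto simp: N_def algebra_simps add_pos_nonneg intro: add_nonneg_pos)
  define Q where "Q t = (f (x + t *\<^sub>R u + t *\<^sub>R v) - f (x + t *\<^sub>R u) - f (x + t *\<^sub>R v) + f x) / (t * t)" for t
  have lim: "(Q \<longlongrightarrow> F x) (at_right 0)"
    if F: "continuous_on (ball x e) F" "\<And>t. 0 < t \<Longrightarrow> t * N < e \<Longrightarrow> \<exists>y. dist y x \<le> t * N \<and> Q t = F y" for F
  proof (rule tendstoI)
    fix \<epsilon> :: real assume "\<epsilon> > 0"
    moreover have "isCont F x" using F(1) e by (simp add: continuous_on_eq_continuous_at)
    ultimately obtain d where d: "d > 0" "\<And>y. dist y x < d \<Longrightarrow> dist (F y) (F x) < \<epsilon>"
      unfolding continuous_at_eps_delta by (metis dist_commute)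
    have "\<forall>\<^sub>F t in at_right 0. t < min d e / N"
      using d e N(1)[of 0] by (intro eventually_at_rightI[of 0 "min d e / N"]) auto
    then have "\<forall>\<^sub>F t in at_right 0. 0 < t \<and> t * N < d \<and> t * N < e"
      using eventually_at_right_less[of 0] by eventually_elim (use N(1)[of 0] d e in \<open>auto simp: field_simps\<close>)
    then show "\<forall>\<^sub>F t in at_right 0. dist (Q t) (F x) < \<epsilon>"
      by eventually_elim (use F(2) d in force)
  qed
  have "(Q \<longlongrightarrow> \<D> (\<lambda>z. \<D> f z v) x u) (at_right 0)"
  proof (rule lim)
    show "continuous_on (ball x e) (\<lambda>x. \<D> (\<lambda>z. \<D> f z v) x u)"
      by (intro smooth_on_continuous smooth_on_frechet sm)
    fix t :: real assume t: "0 < t" "t * N < e"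
    with N(2)[of t] have "t * norm u + t * norm v < e" by linarith
    then obtain y where "dist y x \<le> t * norm u + t * norm v"
      "f (x + t *\<^sub>R u + t *\<^sub>R v) - f (x + t *\<^sub>R u) - f (x + t *\<^sub>R v) + f x =
        t * t * \<D> (\<lambda>z. \<D> f z v) y u"
      using second_difference[OF sm t(1)] by blast
    moreover from this(2) have "Q t = \<D> (\<lambda>z. \<D> f z v) y u"
      using t(1) by (simp add: Q_def)
    moreover have "t * norm u + t * norm v \<le> t * N" using N(2)[of t] t(1) by simp
    ultimately show "\<exists>y. dist y x \<le> t * N \<and> Q t = \<D> (\<lambda>z. \<D> f z v) y u"
      by (blast intro: order_trans)
  qed
  moreover have "(Q \<longlongrightarrow> \<D> (\<lambda>z. \<D> f z u) x v) (at_right 0)"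
  proof (rule lim)
    show "continuous_on (ball x e) (\<lambda>x. \<D> (\<lambda>z. \<D> f z u) x v)"
      by (intro smooth_on_continuous smooth_on_frechet sm)
    fix t :: real assume t: "0 < t" "t * N < e"
    with N(2)[of t] have t': "t * norm v + t * norm u < e" "t * norm v + t * norm u \<le> t * N" by linarith+
    obtain y where "dist y x \<le> t * norm v + t * norm u"
      "f (x + t *\<^sub>R v + t *\<^sub>R u) - f (x + t *\<^sub>R v) - f (x + t *\<^sub>R u) + f x =
        t * t * \<D> (\<lambda>z. \<D> f z u) y v"
      using second_difference[OF sm t(1) t'(1)] by blast
    moreover from this(2) have "Q t = \<D> (\<lambda>z. \<D> f z u) y v"
      using t(1) by (simp add: Q_def field_simps)
    ultimately show "\<exists>y. dist y x \<le> t * N \<and> Q t = \<D> (\<lambda>z. \<D> f z u) y v"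
      using t'(2) by (blast intro: order_trans)
  qed
  ultimately show ?thesis
    using tendsto_unique trivial_limit_at_right_real by blast
qed

lemma frechet_derivative_linear_compose:
  assumes "bounded_linear L" "f differentiable at x"
  shows "\<D> (\<lambda>z. L (f z)) x v = L (\<D> f x v)"
  using frechet_derivative_at[OF bounded_linear.has_derivative[OF assms(1)]]
    assms(2)[unfolded frechet_derivative_works] by metis

lemma frechet_derivative_cong:
  assumes "open S" "x \<in> S" "\<And>y. y \<in> S \<Longrightarrow> f y = g y"
  shows "\<D> f x = \<D> g x"
proof -
  have "(f has_derivative D) (at x) \<longleftrightarrow> (g has_derivative D) (at x)" for D
    using has_derivative_transform_within_open[OF _ assms(1,2)] assms(3) by metis
  then show ?thesis unfolding frechet_derivative_def by simp
qed

text \<open>The mean value argument concerns real functions, so it is applied to each component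
  \<open>f z \<bullet> b\<close>.\<close>

lemma symmetric_second_derivative:
  fixes f :: "'e::real_normed_vector \<Rightarrow> 'f::euclidean_space"
  assumes "open S" "x \<in> S" "smooth_on S f"
  shows "\<D> (\<lambda>z. \<D> f z v) x u =
    \<D> (\<lambda>z. \<D> f z u) x v"
proof (rule euclidean_eqI)
  fix b :: 'f
  note L = bounded_linear_inner_left[of b]
  have *: "\<D> (\<lambda>z. \<D> f z v) x u \<bullet> b =
    \<D> (\<lambda>z. \<D> (\<lambda>z. f z \<bullet> b) z v) x u" for u v
  proof -
    have "\<D> (\<lambda>z. \<D> f z v) x u \<bullet> b =
      \<D> (\<lambda>z. \<D> f z v \<bullet> b) x u"
      using frechet_derivative_linear_compose[OF L smooth_on_differentiable[OF smooth_on_frechet[OF assms(3)] assms(2)]]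
      by simp
    also have "\<dots> = \<D> (\<lambda>z. \<D> (\<lambda>z. f z \<bullet> b) z v) x u"
      using frechet_derivative_cong[OF assms(1,2)]
        frechet_derivative_linear_compose[OF L smooth_on_differentiable[OF assms(3)]]
      by (metis (no_types, lifting))
    finally show ?thesis .
  qed
  show "\<D> (\<lambda>z. \<D> f z v) x u \<bullet> b =
    \<D> (\<lambda>z. \<D> f z u) x v \<bullet> b"
    unfolding * using symmetric_second_derivative_real[OF assms(1,2)
        smooth_on_linear_compose[OF L assms(1,3)]] by simp
qed

subsection \<open>Forms in a chart\<close>

definition regular_chart :: "('a::topological_space, 'e::euclidean_space) chart \<Rightarrow> bool" where
  "regular_chart c \<longleftrightarrow> open (chart_dom c) \<and> open (chart_map c ` chart_dom c) \<and>
     homeomorphism (chart_dom c) (chart_map c ` chart_dom c) (chart_map c) (chart_inv c)"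

text \<open>The set W is kept separate from the chart domain: a local equivalence \<phi> can be
  studied only where it is defined and maps into one chart of the target.\<close>

definition chart_smooth ::
  "('a, 'e::euclidean_space) chart \<Rightarrow> 'a set \<Rightarrow> ('a \<Rightarrow> 'v::real_normed_vector) \<Rightarrow> bool" where
  "chart_smooth c W g \<longleftrightarrow> smooth_on (chart_map c ` W) (\<lambda>y. g (chart_inv c y))"

definition chart_form :: "('a, 'e::euclidean_space) chart \<Rightarrow> 'a set \<Rightarrow> ('a, 'e) form1 \<Rightarrow> bool" where
  "chart_form c W \<alpha> \<longleftrightarrow> (\<forall>x\<in>W. linear (\<alpha> c x)) \<and> (\<forall>v. chart_smooth c W (\<lambda>x. \<alpha> c x v))"

definition chart_nbhd :: "('a::topological_space, 'e::euclidean_space) chart \<Rightarrow> 'a set \<Rightarrow> bool" where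
  "chart_nbhd c W \<longleftrightarrow> regular_chart c \<and> open W \<and> W \<subseteq> chart_dom c"

lemma smooth_atlas_regular: "smooth_atlas A \<Longrightarrow> c \<in> A \<Longrightarrow> regular_chart c"
  unfolding smooth_atlas_def regular_chart_def by blast

lemma chart_nbhd_dom: "regular_chart c \<Longrightarrow> chart_nbhd c (chart_dom c)"
  unfolding chart_nbhd_def regular_chart_def by blast

lemma chart_inv_map: "regular_chart c \<Longrightarrow> x \<in> chart_dom c \<Longrightarrow> chart_inv c (chart_map c x) = x"
  unfolding regular_chart_def homeomorphism_def by blast

lemma chart_nbhd_inv:
  assumes "chart_nbhd c W" "y \<in> chart_map c ` W"
  shows "chart_inv c y \<in> W" "chart_map c (chart_inv c y) = y"
  using assms chart_inv_map unfolding chart_nbhd_def by fastforce+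

lemma chart_nbhd_inv_map: "chart_nbhd c W \<Longrightarrow> x \<in> W \<Longrightarrow> chart_inv c (chart_map c x) = x"
  using chart_inv_map unfolding chart_nbhd_def by blast

lemma chart_nbhd_open_image:
  assumes "chart_nbhd c W" shows "open (chart_map c ` W)"
proof -
  have hom: "homeomorphism (chart_dom c) (chart_map c ` chart_dom c) (chart_map c) (chart_inv c)"
    and im: "open (chart_map c ` chart_dom c)" and W: "open W" "W \<subseteq> chart_dom c"
    using assms unfolding chart_nbhd_def regular_chart_def by simp_all
  have "openin (top_of_set (chart_dom c)) W" by (rule open_subset[OF W(2,1)])
  then have "openin (top_of_set (chart_map c ` chart_dom c)) (chart_map c ` W)"
    by (rule homeomorphism_imp_open_map[OF hom])
  then show ?thesis by (rule openin_open_trans[OF _ im])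
qed

lemma chart_smooth_subset: "chart_smooth c W g \<Longrightarrow> V \<subseteq> W \<Longrightarrow> chart_smooth c V g"
  unfolding chart_smooth_def by (blast intro: smooth_on_subset)

lemma chart_form_subset: "chart_form c W \<alpha> \<Longrightarrow> V \<subseteq> W \<Longrightarrow> chart_form c V \<alpha>"
  unfolding chart_form_def by (blast intro: chart_smooth_subset)

lemma chart_smooth_cong:
  assumes "chart_nbhd c W" "chart_smooth c W g" "\<And>x. x \<in> W \<Longrightarrow> g x = g' x"
  shows "chart_smooth c W g'"
  unfolding chart_smooth_def
  by (rule smooth_on_cong[OF chart_nbhd_open_image[OF assms(1)] assms(2)[unfolded chart_smooth_def]])
    (simp add: assms(3) chart_nbhd_inv(1)[OF assms(1)])

lemma chart_form_cong:
  assumes "chart_nbhd c W" "chart_form c W \<alpha>" "\<And>x v. x \<in> W \<Longrightarrow> \<alpha> c x v = \<beta> c x v"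
  shows "chart_form c W \<beta>"
proof -
  have "chart_smooth c W (\<lambda>x. \<beta> c x v)" for v
    by (rule chart_smooth_cong[OF assms(1), of "\<lambda>x. \<alpha> c x v"])
      (use assms(2,3) in \<open>simp_all add: chart_form_def\<close>)
  moreover have "\<alpha> c x = \<beta> c x" if "x \<in> W" for x
    by (rule ext) (rule assms(3)[OF that])
  ultimately show ?thesis
    using assms(2) unfolding chart_form_def by simp
qed

section \<open>Exterior calculus on an open part of one chart\<close>

context
  fixes c :: "('a::topological_space, 'e::euclidean_space) chart" and W
  assumes W: "chart_nbhd c W"
begin

lemmas open_chart_image = chart_nbhd_open_image[OF W]

lemma chart_smooth_const: "chart_smooth c W (\<lambda>x. k)"
  unfolding chart_smooth_def by (rule smooth_on_const)

lemma chart_smooth_add: "chart_smooth c W f \<Longrightarrow> chart_smooth c W g \<Longrightarrow> chart_smooth c W (\<lambda>x. f x + g x)"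
  unfolding chart_smooth_def by (rule smooth_on_add[OF open_chart_image])

lemma chart_smooth_diff: "chart_smooth c W f \<Longrightarrow> chart_smooth c W g \<Longrightarrow> chart_smooth c W (\<lambda>x. f x - g x)"
  unfolding chart_smooth_def by (rule smooth_on_diff[OF open_chart_image])

lemma chart_smooth_minus: "chart_smooth c W f \<Longrightarrow> chart_smooth c W (\<lambda>x. - f x)"
  unfolding chart_smooth_def by (rule smooth_on_minus[OF open_chart_image])

lemma chart_smooth_mult:
  fixes f g :: "'a \<Rightarrow> 'v::real_normed_algebra"
  shows "chart_smooth c W f \<Longrightarrow> chart_smooth c W g \<Longrightarrow> chart_smooth c W (\<lambda>x. f x * g x)"
  unfolding chart_smooth_def by (rule smooth_on_mult[OF open_chart_image])

lemma chart_smooth_divide: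
  fixes f g :: "'a \<Rightarrow> 'v::real_normed_field"
  shows "chart_smooth c W f \<Longrightarrow> chart_smooth c W g \<Longrightarrow> (\<And>x. x \<in> W \<Longrightarrow> g x \<noteq> 0) \<Longrightarrow>
    chart_smooth c W (\<lambda>x. f x / g x)"
  unfolding chart_smooth_def using chart_nbhd_inv(1)[OF W] by (intro smooth_on_divide[OF open_chart_image]) auto

lemma chart_smooth_powr:
  fixes f :: "'a \<Rightarrow> real"
  shows "chart_smooth c W f \<Longrightarrow> (\<And>x. x \<in> W \<Longrightarrow> f x > 0) \<Longrightarrow> chart_smooth c W (\<lambda>x. f x powr r)"
  unfolding chart_smooth_def using chart_nbhd_inv(1)[OF W] by (intro smooth_on_powr[OF open_chart_image]) auto

lemma chart_smooth_cnj: "chart_smooth c W f \<Longrightarrow> chart_smooth c W (\<lambda>x. cnj (f x))"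
  unfolding chart_smooth_def by (rule smooth_on_cnj[OF open_chart_image])

lemma chart_smooth_of_real: "chart_smooth c W f \<Longrightarrow> chart_smooth c W (\<lambda>x. complex_of_real (f x))"
  unfolding chart_smooth_def by (rule smooth_on_of_real[OF open_chart_image])

lemma chart_smooth_Re: "chart_smooth c W f \<Longrightarrow> chart_smooth c W (\<lambda>x. Re (f x))"
  unfolding chart_smooth_def by (rule smooth_on_Re[OF open_chart_image])

lemma fun_diff_has_derivative:
  assumes "chart_smooth c W g" "x \<in> W"
  shows "((\<lambda>y. g (chart_inv c y)) has_derivative fun_diff g c x) (at (chart_map c x))"
proof -
  have "fun_diff g c x = \<D> (\<lambda>y. g (chart_inv c y)) (chart_map c x)"
    by (simp add: fun_eq_iff fun_diff_def o_def)
  then show ?thesis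
    using smooth_on_has_derivative[OF assms(1)[unfolded chart_smooth_def], of "chart_map c x"] assms(2) by simp
qed

lemma fun_diff_eqI:
  "((\<lambda>y. g (chart_inv c y)) has_derivative D) (at (chart_map c x)) \<Longrightarrow> fun_diff g c x v = D v"
  unfolding fun_diff_def o_def by (drule frechet_derivative_at) simp

lemma fun_diff_cong:
  assumes "\<And>x. x \<in> W \<Longrightarrow> f x = g x" "x \<in> W"
  shows "fun_diff f c x v = fun_diff g c x v"
proof -
  have "\<D> (f \<circ> chart_inv c) (chart_map c x) =
    \<D> (g \<circ> chart_inv c) (chart_map c x)"
    by (rule frechet_derivative_cong[OF open_chart_image]) (use assms chart_nbhd_inv(1)[OF W] in auto)
  then show ?thesis unfolding fun_diff_def by simp
qed

lemma fun_diff_const: "fun_diff (\<lambda>x. k) c x v = 0"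
  by (rule fun_diff_eqI) simp

lemma fun_diff_mult:
  assumes "chart_smooth c W f" "chart_smooth c W g" "x \<in> W"
  shows "fun_diff (\<lambda>x. f x * g x) c x v = f x * fun_diff g c x v + fun_diff f c x v * g x"
  using has_derivative_mult[OF assms(1,2)[THEN fun_diff_has_derivative[OF _ assms(3)]]]
  by (intro fun_diff_eqI) (simp add: chart_nbhd_inv_map[OF W assms(3)])

lemma fun_diff_add:
  assumes "chart_smooth c W f" "chart_smooth c W g" "x \<in> W"
  shows "fun_diff (\<lambda>x. f x + g x) c x v = fun_diff f c x v + fun_diff g c x v"
  by (rule fun_diff_eqI[OF has_derivative_add[OF assms(1,2)[THEN fun_diff_has_derivative[OF _ assms(3)]]]])

lemma fun_diff_cnj:
  assumes "chart_smooth c W f" "x \<in> W"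
  shows "fun_diff (\<lambda>x. cnj (f x)) c x v = cnj (fun_diff f c x v)"
  by (rule fun_diff_eqI[OF bounded_linear.has_derivative[OF bounded_linear_cnj fun_diff_has_derivative[OF assms]]])

lemma fun_diff_inverse:
  assumes "chart_smooth c W f" "x \<in> W" "f x \<noteq> 0"
  shows "fun_diff (\<lambda>x. inverse (f x)) c x v = - fun_diff f c x v / (f x * f x)"
proof -
  have "((\<lambda>y. inverse (f (chart_inv c y))) has_derivative
      (\<lambda>v. - (inverse (f x) * fun_diff f c x v * inverse (f x)))) (at (chart_map c x))"
    using Deriv.has_derivative_inverse[OF _ fun_diff_has_derivative[OF assms(1,2)]] assms(3)
    by (simp add: chart_nbhd_inv_map[OF W assms(2)])
  from fun_diff_eqI[OF this] show ?thesis
    by (simp add: divide_inverse)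
qed

lemma chart_form_smooth: "chart_form c W \<alpha> \<Longrightarrow> chart_smooth c W (\<lambda>x. \<alpha> c x v)"
  unfolding chart_form_def by blast

lemma chart_form_linear: "chart_form c W \<alpha> \<Longrightarrow> x \<in> W \<Longrightarrow> linear (\<alpha> c x)"
  unfolding chart_form_def by blast

lemma chart_form_conj:
  assumes "chart_form c W \<alpha>" shows "chart_form c W (conj_form \<alpha>)"
proof -
  have "linear (\<lambda>v. cnj (\<alpha> c x v))" if "x \<in> W" for x
    using linear_compose[OF chart_form_linear[OF assms that] bounded_linear.linear[OF bounded_linear_cnj]]
    by (simp add: o_def)
  then have "linear (conj_form \<alpha> c x)" if "x \<in> W" for x
    using that by (simp add: conj_form_def[abs_def])
  then show ?thesis
    using chart_smooth_cnj[OF chart_form_smooth[OF assms]] unfolding chart_form_def conj_form_def by simp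
qed

lemma chart_form_mult:
  assumes "chart_smooth c W g" "chart_form c W \<alpha>"
  shows "chart_form c W (\<lambda>c x v. g x * \<alpha> c x v)"
proof -
  have "linear (\<lambda>v. g x * \<alpha> c x v)" if "x \<in> W" for x
    using linear_compose[OF chart_form_linear[OF assms(2) that] bounded_linear.linear[OF bounded_linear_mult_right]]
    by (simp add: o_def)
  then show ?thesis
    using chart_smooth_mult[OF assms(1) chart_form_smooth[OF assms(2)]] unfolding chart_form_def by simp
qed

lemma chart_form_add:
  "chart_form c W \<alpha> \<Longrightarrow> chart_form c W \<beta> \<Longrightarrow> chart_form c W (\<lambda>c x v. \<alpha> c x v + \<beta> c x v)"
  unfolding chart_form_def using chart_smooth_add linear_compose_add by blast

lemma chart_form_fun_diff:
  assumes "chart_smooth c W g" shows "chart_form c W (fun_diff g)"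
proof -
  have "chart_smooth c W (\<lambda>x. fun_diff g c x v)" for v
    unfolding chart_smooth_def
    by (rule smooth_on_cong[OF open_chart_image smooth_on_frechet[OF assms[unfolded chart_smooth_def], of v]])
      (simp add: fun_diff_def o_def chart_nbhd_inv(2)[OF W])
  moreover have "linear (fun_diff g c x)" if "x \<in> W" for x
    by (rule has_derivative_linear[OF fun_diff_has_derivative[OF assms that]])
  ultimately show ?thesis unfolding chart_form_def by blast
qed

text \<open>On constant coordinate vectors the components of a form are functions, so the sum,
  product and conjugation rules for \<open>fun_diff\<close> carry over to d.\<close>

lemma ext_diff_fun_diff_eq:
  "ext_diff \<alpha> c x u v = fun_diff (\<lambda>x. \<alpha> c x v) c x u - fun_diff (\<lambda>x. \<alpha> c x u) c x v"
  unfolding ext_diff_def fun_diff_def o_def ..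

lemma ext_diff_cong:
  assumes "\<And>x v. x \<in> W \<Longrightarrow> \<alpha> c x v = \<beta> c x v" "x \<in> W"
  shows "ext_diff \<alpha> c x u v = ext_diff \<beta> c x u v"
proof -
  have "fun_diff (\<lambda>x. \<alpha> c x v) c x u = fun_diff (\<lambda>x. \<beta> c x v) c x u" for u v
    by (rule fun_diff_cong[OF assms(1) assms(2)])
  then show ?thesis unfolding ext_diff_fun_diff_eq by simp
qed

lemma ext_diff_mult:
  assumes "chart_smooth c W g" "chart_form c W \<alpha>" "x \<in> W"
  shows "ext_diff (\<lambda>c x v. g x * \<alpha> c x v) c x u v =
    (fun_diff g \<and>\<^sub>1 \<alpha>) c x u v + g x * ext_diff \<alpha> c x u v"
  unfolding ext_diff_fun_diff_eq wedge_def
  using fun_diff_mult[OF assms(1) chart_form_smooth[OF assms(2)] assms(3)]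
  by (simp add: algebra_simps)

lemma ext_diff_add:
  assumes "chart_form c W \<alpha>" "chart_form c W \<beta>" "x \<in> W"
  shows "ext_diff (\<lambda>c x v. \<alpha> c x v + \<beta> c x v) c x u v = ext_diff \<alpha> c x u v + ext_diff \<beta> c x u v"
  unfolding ext_diff_fun_diff_eq
  using fun_diff_add[OF assms(1,2)[THEN chart_form_smooth] assms(3)] by simp

lemma ext_diff_conj:
  assumes "chart_form c W \<alpha>" "x \<in> W"
  shows "ext_diff (conj_form \<alpha>) c x u v = cnj (ext_diff \<alpha> c x u v)"
  unfolding ext_diff_fun_diff_eq conj_form_def
  using fun_diff_cnj[OF chart_form_smooth[OF assms(1)] assms(2)] by simp

lemma ext_diff_fun_diff:
  assumes "chart_smooth c W g" "x \<in> W"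
  shows "ext_diff (fun_diff g) c x u v = 0"
proof -
  have eq: "\<D> (\<lambda>y. fun_diff g c (chart_inv c y) v) (chart_map c x) =
    \<D> (\<lambda>y. \<D> (\<lambda>y. g (chart_inv c y)) y v) (chart_map c x)" for v
    by (rule frechet_derivative_cong[OF open_chart_image])
      (use assms(2) in \<open>auto simp: fun_diff_def o_def chart_nbhd_inv_map[OF W]\<close>)
  show ?thesis
    unfolding ext_diff_def eq
    using symmetric_second_derivative[OF open_chart_image _ assms(1)[unfolded chart_smooth_def]] assms(2) by auto
qed

lemma chart_form_log_diff:
  assumes "chart_smooth c W h" "\<And>x. x \<in> W \<Longrightarrow> h x \<noteq> 0"
  shows "chart_form c W (\<lambda>c x v. fun_diff h c x v / h x)"
  using chart_form_mult[OF chart_smooth_divide[OF chart_smooth_const assms] chart_form_fun_diff[OF assms(1)], of 1]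
  by simp

text \<open>With dh/h written as \<open>inverse (h x)\<close> times dh, the derivative of the factor
  is a multiple of dh, dh wedged with itself is 0, and d d h = 0. No branch of the logarithm is
  involved.\<close>

lemma ext_diff_log_diff:
  assumes "chart_smooth c W h" "\<And>x. x \<in> W \<Longrightarrow> h x \<noteq> 0" "x \<in> W"
  shows "ext_diff (\<lambda>c x v. fun_diff h c x v / h x) c x u v = 0"
proof -
  have "chart_smooth c W (\<lambda>x. inverse (h x))"
    using chart_smooth_divide[OF chart_smooth_const assms(1,2), of 1] by (simp add: divide_inverse)
  from ext_diff_mult[OF this chart_form_fun_diff[OF assms(1)] assms(3)]
  show ?thesis
    using fun_diff_inverse[OF assms(1,3)] assms(2,3) ext_diff_fun_diff[OF assms(1,3)]
    by (simp add: wedge_def divide_inverse mult.commute)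
qed

end

lemma linear_eq_sum_Basis_complex:
  fixes D :: "'f::euclidean_space \<Rightarrow> complex"
  assumes "linear D" shows "D w = (\<Sum>b\<in>Basis. of_real (w \<bullet> b) * D b)"
  using linear_eq_sum_Basis[OF assms, of w] by (simp add: scaleR_conv_of_real)

text \<open>The second derivatives of \<open>\<phi>\<close> cancel because they are symmetric.\<close>
lemma ext_diff_pullback:
  fixes c :: "('a::topological_space, 'e::euclidean_space) chart"
    and d :: "('b::topological_space, 'f::euclidean_space) chart"
  assumes W: "chart_nbhd c W" and V: "chart_nbhd d V" and im: "\<phi> ` W \<subseteq> V"
    and \<psi>: "smooth_on (chart_map c ` W) (chart_map d \<circ> \<phi> \<circ> chart_inv c)"
    and \<beta>: "chart_form d V \<beta>"
    and \<theta>: "\<And>x v. x \<in> W \<Longrightarrow> \<theta> c x v =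
       \<beta> d (\<phi> x) (\<D> (chart_map d \<circ> \<phi> \<circ> chart_inv c) (chart_map c x) v)"
    and x: "x \<in> W"
  defines "D \<equiv> \<D> (chart_map d \<circ> \<phi> \<circ> chart_inv c) (chart_map c x)"
  shows "ext_diff \<theta> c x u v = ext_diff \<beta> d (\<phi> x) (D u) (D v)"
proof -
  define \<psi>' where "\<psi>' = chart_map d \<circ> \<phi> \<circ> chart_inv c"
  define B where "B b y = \<beta> d (chart_inv d y) b" for b y
  define y where "y = chart_map c x"
  have y: "y \<in> chart_map c ` W" using x by (simp add: y_def)
  have \<psi>W: "\<psi>' ` (chart_map c ` W) \<subseteq> chart_map d ` V"
    using im chart_nbhd_inv_map[OF W] by (auto simp: \<psi>'_def)
  have \<psi>y: "\<psi>' y = chart_map d (\<phi> x)"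
    using chart_nbhd_inv_map[OF W x] by (simp add: \<psi>'_def y_def)
  have \<phi>x: "\<phi> x \<in> V" using im x by blast
  define D' where "D' z = \<D> \<psi>' z" for z
  define DB where "DB b = \<D> (B b) (\<psi>' y)" for b
  define D2 where "D2 v = \<D> (\<lambda>z. D' z v) y" for v
  have sB: "smooth_on (chart_map d ` V) (B b)" for b
    using \<beta> unfolding chart_form_def chart_smooth_def B_def by blast
  have s\<psi>: "smooth_on (chart_map c ` W) \<psi>'" using \<psi> by (simp add: \<psi>'_def)
  have DB: "(B b has_derivative DB b) (at (\<psi>' y))" for b
    unfolding DB_def using smooth_on_has_derivative[OF sB] \<psi>W y by blast
  have hD: "(\<psi>' has_derivative D' z) (at z)" if "z \<in> chart_map c ` W" for z
    unfolding D'_def by (rule smooth_on_has_derivative[OF s\<psi> that])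
  have hD2: "((\<lambda>z. D' z v) has_derivative D2 v) (at y)" for v
    unfolding D2_def D'_def by (rule smooth_on_has_derivative[OF smooth_on_frechet[OF s\<psi>] y])
  have lin: "linear (\<lambda>b. B b z)" if "z \<in> chart_map d ` V" for z
    using \<beta> chart_nbhd_inv(1)[OF V that] unfolding chart_form_def B_def by simp
  have part: "\<D> (\<lambda>z. \<theta> c (chart_inv c z) v) y u =
     B (D2 v u) (\<psi>' y) + (\<Sum>b\<in>Basis. of_real (D' y v \<bullet> b) * DB b (D' y u))" for u v
  proof -
    \<comment> \<open>The vector inserted into \<beta> moves with z. Expanded in the basis it leaves
      fixed vectors b, and each \<open>B b\<close> is a smooth function that can be
      differentiated.\<close>
    have eq: "\<theta> c (chart_inv c z) v = (\<Sum>b\<in>Basis. of_real (D' z v \<bullet> b) * B b (\<psi>' z))"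
      if z: "z \<in> chart_map c ` W" for z
    proof -
      note i = chart_nbhd_inv[OF W z]
      have "chart_inv d (\<psi>' z) = \<phi> (chart_inv c z)"
        using chart_nbhd_inv_map[OF V] im i(1) by (auto simp: \<psi>'_def)
      then have "\<theta> c (chart_inv c z) v = B (D' z v) (\<psi>' z)"
        using \<theta>[OF i(1)] i(2) by (simp add: B_def D'_def \<psi>'_def)
      also have "\<dots> = (\<Sum>b\<in>Basis. of_real (D' z v \<bullet> b) * B b (\<psi>' z))"
        using linear_eq_sum_Basis_complex[OF lin] \<psi>W z by blast
      finally show ?thesis .
    qed
    have "((\<lambda>z. \<Sum>b\<in>Basis. of_real (D' z v \<bullet> b) * B b (\<psi>' z)) has_derivative
      (\<lambda>u. \<Sum>b\<in>Basis. of_real (D' y v \<bullet> b) * DB b (D' y u) + of_real (D2 v u \<bullet> b) * B b (\<psi>' y))) (at y)"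
      by (intro has_derivative_sum has_derivative_mult
          bounded_linear.has_derivative[OF bounded_linear_of_real]
          bounded_linear.has_derivative[OF bounded_linear_inner_left] hD2
          has_derivative_compose[OF hD[OF y] DB])
    from frechet_derivative_at[OF this]
    have "\<D> (\<lambda>z. \<theta> c (chart_inv c z) v) y =
      (\<lambda>u. \<Sum>b\<in>Basis. of_real (D' y v \<bullet> b) * DB b (D' y u) + of_real (D2 v u \<bullet> b) * B b (\<psi>' y))"
      using frechet_derivative_cong[OF chart_nbhd_open_image[OF W] y eq] by simp
    moreover have "B (D2 v u) (\<psi>' y) = (\<Sum>b\<in>Basis. of_real (D2 v u \<bullet> b) * B b (\<psi>' y))"
      using linear_eq_sum_Basis_complex[OF lin] \<psi>W y by blast
    ultimately show ?thesis by (simp add: sum.distrib)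
  qed
  have partB: "\<D> (B w) (\<psi>' y) u = (\<Sum>b\<in>Basis. of_real (w \<bullet> b) * DB b u)" for w u
  proof -
    have "((\<lambda>z. \<Sum>b\<in>Basis. of_real (w \<bullet> b) * B b z) has_derivative
      (\<lambda>u. \<Sum>b\<in>Basis. of_real (w \<bullet> b) * DB b u)) (at (\<psi>' y))"
      by (intro has_derivative_sum bounded_linear.has_derivative[OF bounded_linear_mult_right] DB)
    from frechet_derivative_at[OF this] show ?thesis
      using frechet_derivative_cong[OF chart_nbhd_open_image[OF V], of "\<psi>' y" "B w"]
        linear_eq_sum_Basis_complex[OF lin] \<psi>W y by (metis (no_types, lifting) image_subset_iff)
  qed
  have D: "D = D' y" by (simp add: D_def D'_def y_def \<psi>'_def)
  have sym: "D2 v u = D2 u v"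
    unfolding D2_def D'_def
    by (rule symmetric_second_derivative[OF chart_nbhd_open_image[OF W] y s\<psi>])
  have "ext_diff \<theta> c x u v = (\<Sum>b\<in>Basis. of_real (D' y v \<bullet> b) * DB b (D' y u)) -
      (\<Sum>b\<in>Basis. of_real (D' y u \<bullet> b) * DB b (D' y v))"
    unfolding ext_diff_def y_def[symmetric] part sym by simp
  also have "\<dots> = ext_diff \<beta> d (\<phi> x) (D u) (D v)"
    unfolding ext_diff_def \<psi>y[symmetric] D using partB by (simp add: B_def[abs_def])
  finally show ?thesis .
qed

subsection \<open>Pointwise algebra of a coframe\<close>

text \<open>Complex linear independence of \<kappa>, \<mu> and the conjugate of \<mu> at one point.
  The type of vectors is arbitrary because these covectors are also regarded as covectors of the
  bundle, where they ignore the fibre part.\<close>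

definition independent_pair :: "('v \<Rightarrow> complex) \<Rightarrow> ('v \<Rightarrow> complex) \<Rightarrow> bool" where
  "independent_pair \<kappa> \<mu> \<longleftrightarrow> (\<forall>k0 k1 k2.
     (\<forall>v. k0 * \<kappa> v + k1 * \<mu> v + k2 * cnj (\<mu> v) = 0) \<longrightarrow> k0 = 0 \<and> k1 = 0 \<and> k2 = 0)"

lemma independent_pairD:
  assumes "independent_pair \<kappa> \<mu>" "\<And>v. k0 * \<kappa> v + k1 * \<mu> v + k2 * cnj (\<mu> v) = 0"
  shows "k0 = 0" "k1 = 0" "k2 = 0"
  using assms unfolding independent_pair_def by blast+

text \<open>Links the nonvanishing 3-form of \<open>congruence_pair\<close> to the independence on
  which every later comparison of coefficients rests. Both directions use 2 by 2 minors of the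
  values of the covectors.\<close>

lemma independent_pair_iff_volume:
  "independent_pair (\<kappa> c x) (\<mu> c x) \<longleftrightarrow> (\<exists>u v w. (\<kappa> \<and>\<^sub>1 \<mu> \<and>\<^sub>2 conj_form \<mu>) c x u v w \<noteq> 0)"
proof
  assume ind: "independent_pair (\<kappa> c x) (\<mu> c x)"
  let ?k = "\<kappa> c x" and ?m = "\<mu> c x" and ?n = "\<lambda>v. cnj (\<mu> c x v)"
  show "\<exists>u v w. (\<kappa> \<and>\<^sub>1 \<mu> \<and>\<^sub>2 conj_form \<mu>) c x u v w \<noteq> 0"
  proof (rule ccontr)
    assume "\<not> ?thesis"
    then have 0: "(\<kappa> \<and>\<^sub>1 \<mu> \<and>\<^sub>2 conj_form \<mu>) c x u v w = 0" for u v w by blast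
    \<comment> \<open>For fixed v and w the vanishing of the 3-form in u is a linear relation
      between the three covectors; this minor is its coefficient at \<kappa>.\<close>
    have minor: "?m v * ?n w - ?m w * ?n v = 0" for v w
    proof (rule independent_pairD(1)[OF ind])
      fix u
      show "(?m v * ?n w - ?m w * ?n v) * ?k u + (?n v * ?k w - ?n w * ?k v) * ?m u +
          (?k v * ?m w - ?k w * ?m v) * cnj (?m u) = 0"
        using 0[of u v w] unfolding wedge21_def wedge_def conj_form_def by (simp add: algebra_simps)
    qed
    \<comment> \<open>A vanishing minor is a relation between \<mu> and its conjugate with
      coefficients \<open>cnj (\<mu> w)\<close> and \<open>- \<mu> w\<close>. These must vanish, so
      \<mu> = 0, and then 1 times \<mu> is a forbidden relation.\<close>
    have "?m w = 0" for w
    proof -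
      have "- ?m w = 0"
      proof (rule independent_pairD(3)[OF ind])
        fix v
        show "0 * ?k v + ?n w * ?m v + (- ?m w) * cnj (?m v) = 0"
          using minor[of v w] by (simp add: algebra_simps)
      qed
      then show ?thesis by simp
    qed
    then have "(1::complex) = 0"
      by (intro independent_pairD(2)[OF ind, of 0 1 0]) simp
    then show False by simp
  qed
next
  assume "\<exists>u v w. (\<kappa> \<and>\<^sub>1 \<mu> \<and>\<^sub>2 conj_form \<mu>) c x u v w \<noteq> 0"
  then obtain u v w where vol: "(\<kappa> \<and>\<^sub>1 \<mu> \<and>\<^sub>2 conj_form \<mu>) c x u v w \<noteq> 0" by blast
  let ?k = "\<kappa> c x" and ?m = "\<mu> c x" and ?n = "\<lambda>v. cnj (\<mu> c x v)"
  show "independent_pair (\<kappa> c x) (\<mu> c x)"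
    unfolding independent_pair_def
  proof (intro allI impI)
    fix k0 k1 k2 assume *: "\<forall>v. k0 * ?k v + k1 * ?m v + k2 * cnj (?m v) = 0"
    let ?V = "(\<kappa> \<and>\<^sub>1 \<mu> \<and>\<^sub>2 conj_form \<mu>) c x u v w"
    have R: "k0 * ?k v + k1 * ?m v + k2 * ?n v = 0" for v using * by blast
    \<comment> \<open>Cramer's rule: each coefficient times the volume is a combination, with minors
      as coefficients, of the values of the relation at u, v and w.\<close>
    have "k0 * ?V = (k0 * ?k u + k1 * ?m u + k2 * ?n u) * (?m v * ?n w - ?m w * ?n v) +
        (k0 * ?k v + k1 * ?m v + k2 * ?n v) * (?m w * ?n u - ?m u * ?n w) +
        (k0 * ?k w + k1 * ?m w + k2 * ?n w) * (?m u * ?n v - ?m v * ?n u)"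
      unfolding wedge21_def wedge_def conj_form_def by (simp add: algebra_simps)
    moreover have "k1 * ?V = (k0 * ?k u + k1 * ?m u + k2 * ?n u) * (?n v * ?k w - ?n w * ?k v) +
        (k0 * ?k v + k1 * ?m v + k2 * ?n v) * (?n w * ?k u - ?n u * ?k w) +
        (k0 * ?k w + k1 * ?m w + k2 * ?n w) * (?n u * ?k v - ?n v * ?k u)"
      unfolding wedge21_def wedge_def conj_form_def by (simp add: algebra_simps)
    moreover have "k2 * ?V = (k0 * ?k u + k1 * ?m u + k2 * ?n u) * (?k v * ?m w - ?k w * ?m v) +
        (k0 * ?k v + k1 * ?m v + k2 * ?n v) * (?k w * ?m u - ?k u * ?m w) +
        (k0 * ?k w + k1 * ?m w + k2 * ?n w) * (?k u * ?m v - ?k v * ?m u)"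
      unfolding wedge21_def wedge_def conj_form_def by (simp add: algebra_simps)
    ultimately show "k0 = 0 \<and> k1 = 0 \<and> k2 = 0" using vol unfolding R by simp
  qed
qed

text \<open>The structure equations for \<open>d\<omega>\<close> and \<open>d\<omega>1\<close> determine \<open>\<Omega>\<close>: the difference of two
  solutions is a multiple \<open>t \<mu>\<close> of \<open>\<mu>\<close>, and \<open>t \<mu> + conj (t \<mu>)\<close> is a multiple of \<open>\<kappa>\<close>.\<close>
lemma connection_unique:
  assumes ind: "independent_pair \<kappa> \<mu>"
    and 1: "\<And>u v. \<gamma> u * \<mu> v - \<gamma> v * \<mu> u = 0"
    and 2: "\<And>u v. (\<gamma> u + cnj (\<gamma> u)) * \<kappa> v - (\<gamma> v + cnj (\<gamma> v)) * \<kappa> u = 0"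
  shows "\<gamma> v = 0"
proof -
  obtain v0 where v0: "\<mu> v0 \<noteq> 0"
    using independent_pairD(2)[OF ind, of 0 1 0] by auto
  obtain v1 where v1: "\<kappa> v1 \<noteq> 0"
    using independent_pairD(1)[OF ind, of 1 0 0] by auto
  define t where "t = \<gamma> v0 / \<mu> v0"
  define r where "r = (\<gamma> v1 + cnj (\<gamma> v1)) / \<kappa> v1"
  have t: "\<gamma> v = t * \<mu> v" for v
    using 1[of v0 v] v0 by (simp add: t_def field_simps)
  have r: "\<gamma> v + cnj (\<gamma> v) = r * \<kappa> v" for v
    using 2[of v1 v] v1 by (simp add: r_def field_simps)
  have "(- r) * \<kappa> v + t * \<mu> v + cnj t * cnj (\<mu> v) = 0" for v
    using r[of v] unfolding t[of v] by (simp add: algebra_simps)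
  then have "t = 0" by (rule independent_pairD(2)[OF ind])
  then show ?thesis using t by simp
qed

text \<open>Wedging with \<kappa> kills the second term whatever \<xi> is and leaves A times the
  volume. The unknown connection form can thus be hidden in \<xi>.\<close>

lemma two_form_coeff_zero:
  assumes vol: "independent_pair (\<kappa> c x) (\<mu> c x)"
    and eq: "\<And>u v. A * (\<mu> \<and>\<^sub>1 conj_form \<mu>) c x u v + (\<xi> u * \<kappa> c x v - \<xi> v * \<kappa> c x u) = 0"
  shows "A = 0"
proof -
  obtain u v w where V: "(\<kappa> \<and>\<^sub>1 \<mu> \<and>\<^sub>2 conj_form \<mu>) c x u v w \<noteq> 0"
    using vol independent_pair_iff_volume[of \<kappa> c x \<mu>] by auto
  have "A * (\<kappa> \<and>\<^sub>1 \<mu> \<and>\<^sub>2 conj_form \<mu>) c x u v w =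
    (A * (\<mu> \<and>\<^sub>1 conj_form \<mu>) c x u v + (\<xi> u * \<kappa> c x v - \<xi> v * \<kappa> c x u)) * \<kappa> c x w +
    (A * (\<mu> \<and>\<^sub>1 conj_form \<mu>) c x v w + (\<xi> v * \<kappa> c x w - \<xi> w * \<kappa> c x v)) * \<kappa> c x u +
    (A * (\<mu> \<and>\<^sub>1 conj_form \<mu>) c x w u + (\<xi> w * \<kappa> c x u - \<xi> u * \<kappa> c x w)) * \<kappa> c x v"
    unfolding wedge21_def wedge_def conj_form_def by (simp add: algebra_simps)
  then show ?thesis using V unfolding eq by simp
qed

text \<open>Wedging with \<kappa>, with the conjugate of \<mu> and with \<mu> isolates A, B and C in
  turn, each multiplied by the volume up to sign.\<close>

lemma two_form_coeffs_zero:
  assumes vol: "independent_pair (\<kappa> c x) (\<mu> c x)"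
    and eq: "\<And>u v. A * (\<mu> \<and>\<^sub>1 conj_form \<mu>) c x u v + B * (\<mu> \<and>\<^sub>1 \<kappa>) c x u v +
      C * (conj_form \<mu> \<and>\<^sub>1 \<kappa>) c x u v = 0"
  shows "A = 0" "B = 0" "C = 0"
proof -
  obtain u v w where V: "(\<kappa> \<and>\<^sub>1 \<mu> \<and>\<^sub>2 conj_form \<mu>) c x u v w \<noteq> 0"
    using vol independent_pair_iff_volume[of \<kappa> c x \<mu>] by auto
  let ?V = "(\<kappa> \<and>\<^sub>1 \<mu> \<and>\<^sub>2 conj_form \<mu>) c x u v w"
  let ?E = "\<lambda>u v. A * (\<mu> \<and>\<^sub>1 conj_form \<mu>) c x u v + B * (\<mu> \<and>\<^sub>1 \<kappa>) c x u v +
      C * (conj_form \<mu> \<and>\<^sub>1 \<kappa>) c x u v"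
  have "A * ?V = ?E u v * \<kappa> c x w + ?E v w * \<kappa> c x u + ?E w u * \<kappa> c x v"
    unfolding wedge21_def wedge_def conj_form_def by (simp add: algebra_simps)
  then show "A = 0" using V unfolding eq by simp
  have "B * ?V = - (?E u v * conj_form \<mu> c x w + ?E v w * conj_form \<mu> c x u + ?E w u * conj_form \<mu> c x v)"
    unfolding wedge21_def wedge_def conj_form_def by (simp add: algebra_simps)
  then show "B = 0" using V unfolding eq by simp
  have "C * ?V = ?E u v * \<mu> c x w + ?E v w * \<mu> c x u + ?E w u * \<mu> c x v"
    unfolding wedge21_def wedge_def conj_form_def by (simp add: algebra_simps)
  then show "C = 0" using V unfolding eq by simp
qed

subsection \<open>Structure equations on the base manifold\<close>

text \<open>On the bundle one has \<open>\<Omega> = dz/z + \<pi>\<^sup>* \<alpha>\<close>, and the following are the equations for the form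
  \<open>\<alpha>\<close> on the base into which the structure equations of the bundle translate.\<close>
definition base_system ::
  "('a, 'e::euclidean_space) chart \<Rightarrow> 'a set \<Rightarrow> ('a, 'e) form1 \<Rightarrow> ('a, 'e) form1 \<Rightarrow> ('a \<Rightarrow> real) \<Rightarrow>
   ('a, 'e) form1 \<Rightarrow> ('a \<Rightarrow> real) \<Rightarrow> ('a \<Rightarrow> complex) \<Rightarrow> bool" where
  "base_system c W \<kappa> \<mu> a \<alpha> k1 k2 \<longleftrightarrow> (\<forall>x\<in>W. \<forall>u v.
     of_real (a x) * ext_diff \<kappa> c x u v =
       \<i> * of_real (a x) * of_real (a x) * (\<mu> \<and>\<^sub>1 conj_form \<mu>) c x u v +
       (fun_diff (\<lambda>x. of_real (a x)) \<and>\<^sub>1 \<kappa>) c x u v +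
       of_real (a x) * ((\<alpha> \<and>\<^sub>1 \<kappa>) c x u v + (conj_form \<alpha> \<and>\<^sub>1 \<kappa>) c x u v) \<and>
     ext_diff \<mu> c x u v = (\<alpha> \<and>\<^sub>1 \<mu>) c x u v \<and>
     of_real (a x) * ext_diff \<alpha> c x u v = of_real (a x) * of_real (k1 x) * (\<mu> \<and>\<^sub>1 conj_form \<mu>) c x u v +
       k2 x * (\<mu> \<and>\<^sub>1 \<kappa>) c x u v)"

text \<open>The structure equations of the bundle, pulled back along the section on which K2 = 1;
  \<alpha> stands for the pullback of \<Omega>.\<close>

definition normal_system ::
  "('a, 'e::euclidean_space) chart \<Rightarrow> 'a set \<Rightarrow> ('a, 'e) form1 \<Rightarrow> ('a, 'e) form1 \<Rightarrow>
   ('a, 'e) form1 \<Rightarrow> ('a \<Rightarrow> real) \<Rightarrow> bool" where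
  "normal_system c W \<omega> \<omega>1 \<alpha> K1 \<longleftrightarrow> (\<forall>x\<in>W. \<forall>u v.
     ext_diff \<omega> c x u v = \<i> * (\<omega>1 \<and>\<^sub>1 conj_form \<omega>1) c x u v +
       ((\<alpha> \<and>\<^sub>1 \<omega>) c x u v + (conj_form \<alpha> \<and>\<^sub>1 \<omega>) c x u v) \<and>
     ext_diff \<omega>1 c x u v = (\<alpha> \<and>\<^sub>1 \<omega>1) c x u v \<and>
     ext_diff \<alpha> c x u v = of_real (K1 x) * (\<omega>1 \<and>\<^sub>1 conj_form \<omega>1) c x u v + (\<omega>1 \<and>\<^sub>1 \<omega>) c x u v)"

lemma normal_systemD:
  assumes "normal_system c W \<omega> \<omega>1 \<alpha> K1" "x \<in> W"
  shows "ext_diff \<omega> c x u v = \<i> * (\<omega>1 \<and>\<^sub>1 conj_form \<omega>1) c x u v +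
       ((\<alpha> \<and>\<^sub>1 \<omega>) c x u v + (conj_form \<alpha> \<and>\<^sub>1 \<omega>) c x u v)"
    and "ext_diff \<omega>1 c x u v = (\<alpha> \<and>\<^sub>1 \<omega>1) c x u v"
    and "ext_diff \<alpha> c x u v = of_real (K1 x) * (\<omega>1 \<and>\<^sub>1 conj_form \<omega>1) c x u v + (\<omega>1 \<and>\<^sub>1 \<omega>) c x u v"
  using assms unfolding normal_system_def by blast+

lemma base_systemD:
  assumes "base_system c W \<kappa> \<mu> a \<alpha> k1 k2" "x \<in> W"
  shows "of_real (a x) * ext_diff \<kappa> c x u v =
       \<i> * of_real (a x) * of_real (a x) * (\<mu> \<and>\<^sub>1 conj_form \<mu>) c x u v +
       (fun_diff (\<lambda>x. of_real (a x)) \<and>\<^sub>1 \<kappa>) c x u v +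
       of_real (a x) * ((\<alpha> \<and>\<^sub>1 \<kappa>) c x u v + (conj_form \<alpha> \<and>\<^sub>1 \<kappa>) c x u v)"
    and "ext_diff \<mu> c x u v = (\<alpha> \<and>\<^sub>1 \<mu>) c x u v"
    and "of_real (a x) * ext_diff \<alpha> c x u v =
       of_real (a x) * of_real (k1 x) * (\<mu> \<and>\<^sub>1 conj_form \<mu>) c x u v + k2 x * (\<mu> \<and>\<^sub>1 \<kappa>) c x u v"
  using assms unfolding base_system_def by blast+

lemma of_real_cmod_power2: "(complex_of_real (cmod z))\<^sup>2 = z * cnj z"
  using complex_norm_square[of z] by simp

text \<open>Scaling \<kappa> by |h|^2/a contributes the logarithmic derivative of |h|^2 minus that
  of a. The latter cancels the term da in \<open>base_system\<close>, and the former is dh/h plus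
  its conjugate, which is what \<alpha> + dh/h contributes together with its conjugate. As dh/h is
  closed, d\<alpha> is unchanged, and k2/a times \<mu> \<and> \<kappa> becomes the wedge of the two
  scaled forms because k2 = h |h|^2.\<close>

lemma normal_system_normalization:
  fixes a k1 :: "'a::topological_space \<Rightarrow> real"
  assumes W: "chart_nbhd c W" and \<kappa>: "chart_form c W \<kappa>" and \<mu>: "chart_form c W \<mu>" and \<alpha>: "chart_form c W \<alpha>"
    and a: "chart_smooth c W a" "\<And>x. x \<in> W \<Longrightarrow> a x \<noteq> 0"
    and h: "chart_smooth c W h" "\<And>x. x \<in> W \<Longrightarrow> h x \<noteq> 0"
    and k2: "\<And>x. x \<in> W \<Longrightarrow> k2 x = h x * (h x * cnj (h x))"
    and sys: "base_system c W \<kappa> \<mu> a \<alpha> k1 k2"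
  shows "normal_system c W (\<lambda>c x v. of_real ((cmod (h x))\<^sup>2 / a x) * \<kappa> c x v) (\<lambda>c x v. h x * \<mu> c x v)
    (\<lambda>c x v. \<alpha> c x v + fun_diff h c x v / h x) (\<lambda>x. k1 x / (cmod (h x))\<^sup>2)"
proof -
  define G where "G x = complex_of_real ((cmod (h x))\<^sup>2 / a x)" for x
  let ?a = "\<lambda>x. complex_of_real (a x)"
  have sa: "chart_smooth c W ?a" by (rule chart_smooth_of_real[OF W a(1)])
  have Geq: "G x = h x * cnj (h x) / ?a x" for x
    by (simp add: G_def of_real_cmod_power2)
  have sG: "chart_smooth c W G"
    unfolding Geq[abs_def] by (intro chart_smooth_divide[OF W] chart_smooth_mult[OF W] chart_smooth_cnj[OF W] h sa) (use a in simp)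
  \<comment> \<open>G is a quotient; differentiating the product \<open>a G = h * cnj h\<close>
    instead gives its derivative without a division.\<close>
  have dG: "?a x * fun_diff G c x v + fun_diff ?a c x v * G x = h x * cnj (fun_diff h c x v) + fun_diff h c x v * cnj (h x)"
    if x: "x \<in> W" for x v
  proof -
    have "fun_diff (\<lambda>x. ?a x * G x) c x v = fun_diff (\<lambda>x. h x * cnj (h x)) c x v"
      by (rule fun_diff_cong[OF W _ x]) (simp add: Geq a(2))
    then show ?thesis
      unfolding fun_diff_mult[OF W sa sG x] fun_diff_mult[OF W h(1) chart_smooth_cnj[OF W h(1)] x]
        fun_diff_cnj[OF W h(1) x] .
  qed
  show ?thesis
    unfolding normal_system_def G_def[symmetric]
  proof (intro ballI allI conjI)
    fix x u v assume x: "x \<in> W"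
    note S = base_systemD[OF sys x, of u v]
    have ax: "?a x \<noteq> 0" "h x \<noteq> 0" "cnj (h x) \<noteq> 0" using a(2) h(2) x by simp_all
    \<comment> \<open>The inner factor a turns dG and d\<kappa> into the expressions known from
      \<open>dG\<close> and \<open>base_system\<close>; the outer one clears the denominator that
      remains in G.\<close>
    have "?a x * (?a x * ((fun_diff G \<and>\<^sub>1 \<kappa>) c x u v + G x * ext_diff \<kappa> c x u v)) =
      ?a x * ((?a x * fun_diff G c x u) * \<kappa> c x v - (?a x * fun_diff G c x v) * \<kappa> c x u +
        G x * (?a x * ext_diff \<kappa> c x u v))"
      by (simp add: wedge_def algebra_simps)
    also have "\<dots> = ?a x * ((h x * cnj (fun_diff h c x u) + fun_diff h c x u * cnj (h x)) * \<kappa> c x v -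
        (h x * cnj (fun_diff h c x v) + fun_diff h c x v * cnj (h x)) * \<kappa> c x u +
        G x * (?a x * ext_diff \<kappa> c x u v - (fun_diff ?a \<and>\<^sub>1 \<kappa>) c x u v))"
      unfolding dG[OF x, symmetric] by (simp add: wedge_def algebra_simps)
    also have "\<dots> = ?a x * (?a x * (\<i> * ((\<lambda>c x v. h x * \<mu> c x v) \<and>\<^sub>1 conj_form (\<lambda>c x v. h x * \<mu> c x v)) c x u v +
       (((\<lambda>c x v. \<alpha> c x v + fun_diff h c x v / h x) \<and>\<^sub>1 (\<lambda>c x v. G x * \<kappa> c x v)) c x u v +
       (conj_form (\<lambda>c x v. \<alpha> c x v + fun_diff h c x v / h x) \<and>\<^sub>1 (\<lambda>c x v. G x * \<kappa> c x v)) c x u v)))"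
      unfolding S(1) using ax by (simp add: wedge_def conj_form_def Geq field_simps)
    finally show "ext_diff (\<lambda>c x v. G x * \<kappa> c x v) c x u v =
       \<i> * ((\<lambda>c x v. h x * \<mu> c x v) \<and>\<^sub>1 conj_form (\<lambda>c x v. h x * \<mu> c x v)) c x u v +
       (((\<lambda>c x v. \<alpha> c x v + fun_diff h c x v / h x) \<and>\<^sub>1 (\<lambda>c x v. G x * \<kappa> c x v)) c x u v +
       (conj_form (\<lambda>c x v. \<alpha> c x v + fun_diff h c x v / h x) \<and>\<^sub>1 (\<lambda>c x v. G x * \<kappa> c x v)) c x u v)"
      unfolding ext_diff_mult[OF W sG \<kappa> x] using ax by simp
    show "ext_diff (\<lambda>c x v. h x * \<mu> c x v) c x u v =
      ((\<lambda>c x v. \<alpha> c x v + fun_diff h c x v / h x) \<and>\<^sub>1 (\<lambda>c x v. h x * \<mu> c x v)) c x u v"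
      unfolding ext_diff_mult[OF W h(1) \<mu> x] S(2) using ax by (simp add: wedge_def field_simps)
    have ed: "ext_diff (\<lambda>c x v. \<alpha> c x v + fun_diff h c x v / h x) c x u v = ext_diff \<alpha> c x u v"
      using ext_diff_add[OF W \<alpha> chart_form_log_diff[OF W h] x] ext_diff_log_diff[OF W h x] by simp
    have "?a x * ext_diff \<alpha> c x u v = ?a x * (of_real (k1 x / (cmod (h x))\<^sup>2) *
        ((\<lambda>c x v. h x * \<mu> c x v) \<and>\<^sub>1 conj_form (\<lambda>c x v. h x * \<mu> c x v)) c x u v +
        ((\<lambda>c x v. h x * \<mu> c x v) \<and>\<^sub>1 (\<lambda>c x v. G x * \<kappa> c x v)) c x u v)"
      unfolding S(3) k2[OF x] using ax
      by (simp add: wedge_def conj_form_def Geq of_real_cmod_power2 field_simps)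
    then show "ext_diff (\<lambda>c x v. \<alpha> c x v + fun_diff h c x v / h x) c x u v =
      of_real (k1 x / (cmod (h x))\<^sup>2) *
        ((\<lambda>c x v. h x * \<mu> c x v) \<and>\<^sub>1 conj_form (\<lambda>c x v. h x * \<mu> c x v)) c x u v +
        ((\<lambda>c x v. h x * \<mu> c x v) \<and>\<^sub>1 (\<lambda>c x v. G x * \<kappa> c x v)) c x u v"
      unfolding ed using ax by simp
  qed
qed

text \<open>Rigidity of the normalization. It is applied to two representatives of one structure and
  to a coframe pulled back along an equivalence; in the second case \<theta>, \<theta>1 and \<beta>
  are bare pullbacks, and d\<beta> is computed from the formula found for \<beta>. The coefficient
  at \<omega>1 \<and> cnj \<omega>1 gives the invariance of K1.\<close>

lemma normal_system_unique:
  fixes f :: "'a::topological_space \<Rightarrow> real"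
  assumes W: "chart_nbhd c W" and \<omega>: "chart_form c W \<omega>" and \<omega>1: "chart_form c W \<omega>1" and \<alpha>: "chart_form c W \<alpha>"
    and ind: "\<And>x. x \<in> W \<Longrightarrow> independent_pair (\<omega> c x) (\<omega>1 c x)"
    and sys: "normal_system c W \<omega> \<omega>1 \<alpha> K" and sys': "normal_system c W \<theta> \<theta>1 \<beta> L"
    and f: "chart_smooth c W f" and h: "chart_smooth c W h" "\<And>x. x \<in> W \<Longrightarrow> h x \<noteq> 0"
    and \<theta>: "\<And>x v. x \<in> W \<Longrightarrow> \<theta> c x v = of_real (f x) * \<omega> c x v"
    and \<theta>1: "\<And>x v. x \<in> W \<Longrightarrow> \<theta>1 c x v = h x * \<omega>1 c x v"
    and x: "x \<in> W"
  shows "f x = 1" "h x = 1" "\<beta> c x v = \<alpha> c x v" "L x = K x"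
proof -
  let ?F = "\<lambda>x. complex_of_real (f x)"
  have sF: "chart_smooth c W ?F" by (rule chart_smooth_of_real[OF W f])
  have d\<theta>: "(fun_diff ?F \<and>\<^sub>1 \<omega>) c x u v + ?F x * ext_diff \<omega> c x u v =
      \<i> * (\<theta>1 \<and>\<^sub>1 conj_form \<theta>1) c x u v + ((\<beta> \<and>\<^sub>1 \<theta>) c x u v + (conj_form \<beta> \<and>\<^sub>1 \<theta>) c x u v)" if x: "x \<in> W" for x u v
    using ext_diff_cong[where \<alpha> = \<theta> and \<beta> = "\<lambda>c x v. ?F x * \<omega> c x v", OF W \<theta> x, of u v] ext_diff_mult[OF W sF \<omega> x, of u v] normal_systemD(1)[OF sys' x, of u v]
    by simp
  have d\<theta>1: "(fun_diff h \<and>\<^sub>1 \<omega>1) c x u v + h x * ext_diff \<omega>1 c x u v = (\<beta> \<and>\<^sub>1 \<theta>1) c x u v" if x: "x \<in> W" for x u v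
    using ext_diff_cong[where \<alpha> = \<theta>1 and \<beta> = "\<lambda>c x v. h x * \<omega>1 c x v", OF W \<theta>1 x, of u v] ext_diff_mult[OF W h(1) \<omega>1 x, of u v] normal_systemD(2)[OF sys' x, of u v]
    by simp
  \<comment> \<open>\<xi> collects all that multiplies \<omega> when the two equations are compared,
    the still unknown \<beta> included. The relation \<open>E\<close> then has the shape required by
    \<open>two_form_coeff_zero\<close>, which gives F = |h|^2 before \<beta> is known.\<close>
  define \<xi> where "\<xi> x u = fun_diff ?F c x u + ?F x * (\<alpha> c x u + cnj (\<alpha> c x u)) - ?F x * (\<beta> c x u + cnj (\<beta> c x u))" for x u
  have E: "(\<i> * (?F x - h x * cnj (h x))) * (\<omega>1 \<and>\<^sub>1 conj_form \<omega>1) c x u v + (\<xi> x u * \<omega> c x v - \<xi> x v * \<omega> c x u) = 0"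
    if x: "x \<in> W" for x u v
    using d\<theta>[OF x, of u v] unfolding normal_systemD(1)[OF sys x]
    by (simp add: wedge_def conj_form_def \<theta>[OF x] \<theta>1[OF x] \<xi>_def algebra_simps)
  have F: "?F x = h x * cnj (h x)" if x: "x \<in> W" for x
    using two_form_coeff_zero[where \<kappa> = \<omega> and \<mu> = \<omega>1 and c = c and \<xi> = "\<xi> x", OF ind[OF x] E[OF x]] by simp
  have dF: "fun_diff ?F c x v = h x * cnj (fun_diff h c x v) + fun_diff h c x v * cnj (h x)" if x: "x \<in> W" for x v
    using fun_diff_cong[where f = ?F and g = "\<lambda>x. h x * cnj (h x)", OF W F x, of v] fun_diff_mult[OF W h(1) chart_smooth_cnj[OF W h(1)] x, of v]
      fun_diff_cnj[OF W h(1) x, of v] by simp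
  have \<beta>: "\<beta> c x v = \<alpha> c x v + fun_diff h c x v / h x" if x: "x \<in> W" for x v
  proof -
    define q where "q v = fun_diff h c x v / h x" for v
    define \<gamma> where "\<gamma> v = \<beta> c x v - (\<alpha> c x v + q v)" for v
    have hx: "h x \<noteq> 0" "cnj (h x) \<noteq> 0" using h(2)[OF x] by simp_all
    have dh: "fun_diff h c x v = h x * q v" for v using hx by (simp add: q_def)
    have "\<gamma> v = 0"
    proof (rule connection_unique[OF ind[OF x]])
      fix u v
      have "h x * (\<gamma> u * \<omega>1 c x v - \<gamma> v * \<omega>1 c x u) = 0"
        using d\<theta>1[OF x, of u v] hx unfolding normal_systemD(2)[OF sys x]
        by (simp add: wedge_def \<theta>1[OF x] \<gamma>_def dh algebra_simps)
      then show "\<gamma> u * \<omega>1 c x v - \<gamma> v * \<omega>1 c x u = 0" using hx by simp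
      \<comment> \<open>With F = |h|^2 the derivative of F is F times the sum of dh/h and its
        conjugate, so only the deviation \<gamma> of \<beta> from \<alpha> + dh/h is left.\<close>
      have \<xi>: "\<xi> x u = - (h x * cnj (h x)) * (\<gamma> u + cnj (\<gamma> u))" for u
        unfolding \<xi>_def dF[OF x] F[OF x] \<gamma>_def dh by (simp add: algebra_simps)
      have "\<xi> x u * \<omega> c x v - \<xi> x v * \<omega> c x u = 0"
        using E[OF x, of u v] F[OF x] by simp
      then have "- (h x * cnj (h x)) * ((\<gamma> u + cnj (\<gamma> u)) * \<omega> c x v - (\<gamma> v + cnj (\<gamma> v)) * \<omega> c x u) = 0"
        unfolding \<xi> by (simp add: algebra_simps)
      then show "(\<gamma> u + cnj (\<gamma> u)) * \<omega> c x v - (\<gamma> v + cnj (\<gamma> v)) * \<omega> c x u = 0" using hx by simp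
    qed
    then show ?thesis by (simp add: \<gamma>_def q_def)
  qed
  have d\<beta>: "ext_diff \<beta> c x u v = ext_diff \<alpha> c x u v" if x: "x \<in> W" for x u v
    using ext_diff_cong[where \<alpha> = \<beta> and \<beta> = "\<lambda>c x v. \<alpha> c x v + fun_diff h c x v / h x", OF W \<beta> x, of u v] ext_diff_add[OF W \<alpha> chart_form_log_diff[OF W h] x, of u v]
      ext_diff_log_diff[OF W h x, of u v] by simp
  \<comment> \<open>Both normal systems express the same form d\<alpha> = d\<beta>. The explicit
    zero coefficient matches the shape of \<open>two_form_coeffs_zero\<close>.\<close>
  have eq: "(of_real (L x) * (h x * cnj (h x)) - of_real (K x)) * (\<omega>1 \<and>\<^sub>1 conj_form \<omega>1) c x u v +
      (h x * ?F x - 1) * (\<omega>1 \<and>\<^sub>1 \<omega>) c x u v + 0 * (conj_form \<omega>1 \<and>\<^sub>1 \<omega>) c x u v = 0"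
    if x: "x \<in> W" for x u v
    using d\<beta>[OF x, of u v] unfolding normal_systemD(3)[OF sys x] normal_systemD(3)[OF sys' x]
    by (simp add: wedge_def conj_form_def \<theta>[OF x] \<theta>1[OF x] algebra_simps)
  have h1: "h x = 1" if x: "x \<in> W" for x
  proof -
    have 1: "h x * (h x * cnj (h x)) = 1"
      using two_form_coeffs_zero(2)[where \<kappa> = \<omega> and \<mu> = \<omega>1 and c = c, OF ind[OF x] eq[OF x]] F[OF x] by simp
    \<comment> \<open>Moduli first: |h|^3 = 1 gives |h| = 1, hence h * cnj h = 1, and the equation
      itself then reads h = 1.\<close>
    then have "cmod (h x * (h x * cnj (h x))) = 1" by simp
    then have "cmod (h x) ^ 3 = 1 ^ 3" by (simp add: norm_mult power3_eq_cube)
    then have "cmod (h x) = 1"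
      by (rule power_eq_imp_eq_base) auto
    then have "h x * cnj (h x) = 1" by (simp add: complex_norm_square[symmetric])
    with 1 show ?thesis by simp
  qed
  show "h x = 1" by (rule h1[OF x])
  show "f x = 1" using F[OF x] h1[OF x] by simp
  show "L x = K x" using two_form_coeffs_zero(1)[where \<kappa> = \<omega> and \<mu> = \<omega>1 and c = c, OF ind[OF x] eq[OF x]] h1[OF x] by simp
  have "fun_diff h c x v = 0"
    using fun_diff_cong[where f = h and g = "\<lambda>x. 1", OF W h1 x, of v] fun_diff_const[OF W, of 1] by simp
  then show "\<beta> c x v = \<alpha> c x v" using \<beta>[OF x] by simp
qed

subsection \<open>Pullbacks and the bundle\<close>

definition form_compatible :: "('a, 'e::euclidean_space) atlas \<Rightarrow> ('a, 'e) form1 \<Rightarrow> bool" where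
  "form_compatible A \<alpha> \<longleftrightarrow> (\<forall>c\<in>A. \<forall>d\<in>A. \<forall>x\<in>chart_dom c \<inter> chart_dom d. \<forall>v.
     \<alpha> c x v = \<alpha> d x (\<D> (chart_map d \<circ> chart_inv c) (chart_map c x) v))"

lemma form_compatibleD:
  "form_compatible A \<alpha> \<Longrightarrow> c \<in> A \<Longrightarrow> d \<in> A \<Longrightarrow> x \<in> chart_dom c \<Longrightarrow> x \<in> chart_dom d \<Longrightarrow>
    \<alpha> c x v = \<alpha> d x (\<D> (chart_map d \<circ> chart_inv c) (chart_map c x) v)"
  unfolding form_compatible_def by (erule ballE, erule ballE, erule ballE, erule spec) simp_all

lemma one_form_iff:
  "one_form A \<alpha> \<longleftrightarrow> (\<forall>c\<in>A. chart_form c (chart_dom c) \<alpha>) \<and> form_compatible A \<alpha>"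
  unfolding one_form_def form_compatible_def chart_form_def chart_smooth_def by (rule refl)

lemma one_formI:
  assumes "\<And>c. c \<in> A \<Longrightarrow> chart_form c (chart_dom c) \<alpha>"
    and "\<And>c d x v. c \<in> A \<Longrightarrow> d \<in> A \<Longrightarrow> x \<in> chart_dom c \<Longrightarrow> x \<in> chart_dom d \<Longrightarrow>
      \<alpha> c x v = \<alpha> d x (\<D> (chart_map d \<circ> chart_inv c) (chart_map c x) v)"
  shows "one_form A \<alpha>"
  unfolding one_form_iff form_compatible_def
  by (intro conjI ballI allI; (elim IntE)?; rule assms)

lemma one_formD:
  assumes "one_form A \<alpha>"
  shows "c \<in> A \<Longrightarrow> chart_form c (chart_dom c) \<alpha>" "form_compatible A \<alpha>"
  using assms unfolding one_form_iff by simp_all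

lemma smooth_fun_iff:
  "smooth_fun A g \<longleftrightarrow> (\<forall>c\<in>A. chart_smooth c (chart_dom c) g)"
proof -
  have "chart_dom c \<inter> points A = chart_dom c" if "c \<in> A" for c
    using that unfolding points_def by blast
  then show ?thesis unfolding smooth_fun_on_def chart_smooth_def o_def by simp
qed

lemma smooth_atlas_transition:
  assumes "smooth_atlas A" "c \<in> A" "d \<in> A"
  shows "smooth_on (chart_map c ` (chart_dom c \<inter> chart_dom d)) (chart_map d \<circ> chart_inv c)"
    and "chart_nbhd c (chart_dom c \<inter> chart_dom d)"
proof -
  show "smooth_on (chart_map c ` (chart_dom c \<inter> chart_dom d)) (chart_map d \<circ> chart_inv c)"
    using assms unfolding smooth_atlas_def by simp
  have "open (chart_dom c)" "open (chart_dom d)"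
    using smooth_atlas_regular[OF assms(1)] assms(2,3) unfolding regular_chart_def by simp_all
  then show "chart_nbhd c (chart_dom c \<inter> chart_dom d)"
    using smooth_atlas_regular[OF assms(1,2)] unfolding chart_nbhd_def by (simp add: open_Int)
qed

text \<open>\<open>pullback\<close> evaluates in a chart picked by choice. The chain rule for the
  transition map and the compatibility of \<beta> allow any chart d of the target that contains the
  image of W.\<close>

lemma pullback_eq:
  fixes c :: "('a::topological_space, 'e::euclidean_space) chart"
    and B :: "('b::{t2_space,second_countable_topology}, 'f::euclidean_space) atlas"
  assumes B: "smooth_atlas B" and \<beta>: "form_compatible B \<beta>" and W: "chart_nbhd c W"
    and d: "d \<in> B" and im: "\<phi> ` W \<subseteq> chart_dom d"
    and \<psi>: "smooth_on (chart_map c ` W) (chart_map d \<circ> \<phi> \<circ> chart_inv c)" and x: "x \<in> W"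
  shows "pullback B \<phi> \<beta> c x v =
    \<beta> d (\<phi> x) (\<D> (chart_map d \<circ> \<phi> \<circ> chart_inv c) (chart_map c x) v)"
proof -
  define d' where "d' = (SOME d. d \<in> B \<and> \<phi> x \<in> chart_dom d)"
  have \<phi>x: "\<phi> x \<in> chart_dom d" using im x by blast
  have d': "d' \<in> B" "\<phi> x \<in> chart_dom d'"
    using someI[of "\<lambda>d. d \<in> B \<and> \<phi> x \<in> chart_dom d" d] d \<phi>x unfolding d'_def by simp_all
  define \<psi>' where "\<psi>' = chart_map d \<circ> \<phi> \<circ> chart_inv c"
  define T where "T = chart_map d' \<circ> chart_inv d"
  let ?I = "chart_map d ` (chart_dom d \<inter> chart_dom d')"
  note tr = smooth_atlas_transition[OF B d d'(1)]
  have oI: "open ?I" by (rule chart_nbhd_open_image[OF tr(2)])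
  have oW: "open (chart_map c ` W)" by (rule chart_nbhd_open_image[OF W])
  have s\<psi>: "smooth_on (chart_map c ` W) \<psi>'" using \<psi> by (simp add: \<psi>'_def)
  \<comment> \<open>The coordinate expressions through the two target charts agree only where both
    charts apply; S is an open set of such coordinates around the point.\<close>
  define S where "S = {y \<in> chart_map c ` W. \<psi>' y \<in> ?I}"
  have "S = \<psi>' -` ?I \<inter> chart_map c ` W" unfolding S_def by blast
  then have oS: "open S"
    using continuous_on_open_vimage[OF oW, of \<psi>'] smooth_on_continuous[OF s\<psi>] oI by simp
  have cx: "chart_inv c (chart_map c x) = x" by (rule chart_nbhd_inv_map[OF W x])
  have \<psi>x: "\<psi>' (chart_map c x) = chart_map d (\<phi> x)" by (simp add: \<psi>'_def cx)
  have yS: "chart_map c x \<in> S"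
    using x \<phi>x d'(2) unfolding S_def by (simp add: \<psi>x)
  have rd: "regular_chart d" by (rule smooth_atlas_regular[OF B d])
  have "\<D> (chart_map d' \<circ> \<phi> \<circ> chart_inv c) (chart_map c x) =
    \<D> (T \<circ> \<psi>') (chart_map c x)"
  proof (rule frechet_derivative_cong[OF oS yS])
    fix y assume "y \<in> S"
    then have "\<phi> (chart_inv c y) \<in> chart_dom d"
      using chart_nbhd_inv(1)[OF W, of y] im unfolding S_def by auto
    then show "(chart_map d' \<circ> \<phi> \<circ> chart_inv c) y = (T \<circ> \<psi>') y"
      by (simp add: T_def \<psi>'_def chart_inv_map[OF rd])
  qed
  also have "\<dots> = \<D> T (chart_map d (\<phi> x)) \<circ> \<D> \<psi>' (chart_map c x)"
    unfolding \<psi>x[symmetric]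
  proof (rule frechet_derivative_compose)
    show "\<psi>' differentiable at (chart_map c x)"
      using smooth_on_differentiable[OF s\<psi>] x by simp
    show "T differentiable at (\<psi>' (chart_map c x))"
      using smooth_on_differentiable[OF tr(1)] yS unfolding S_def T_def by simp
  qed
  finally have D: "\<D> (chart_map d' \<circ> \<phi> \<circ> chart_inv c) (chart_map c x) v =
    \<D> T (chart_map d (\<phi> x)) (\<D> \<psi>' (chart_map c x) v)"
    by simp
  have "pullback B \<phi> \<beta> c x v = \<beta> d' (\<phi> x) (\<D> (chart_map d' \<circ> \<phi> \<circ> chart_inv c) (chart_map c x) v)"
    unfolding pullback_def d'_def[symmetric] Let_def ..
  also have "\<dots> = \<beta> d (\<phi> x) (\<D> \<psi>' (chart_map c x) v)"
    unfolding D T_def by (rule form_compatibleD[OF \<beta> d d'(1) \<phi>x d'(2), symmetric])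
  finally show ?thesis by (simp add: \<psi>'_def)
qed

section \<open>Product charts of the bundle\<close>

abbreviation bundle_dom :: "('a, 'e) chart \<Rightarrow> ('a \<times> complex) set" where
  "bundle_dom c \<equiv> chart_dom c \<times> (- {0})"

definition bundle_chart :: "('a, 'e) chart \<Rightarrow> ('a \<times> complex, 'e \<times> complex) chart" where
  "bundle_chart c = (bundle_dom c, \<lambda>(x, z). (chart_map c x, z))"

lemma bundle_atlas_eq: "bundle_atlas A = bundle_chart ` A"
  unfolding bundle_atlas_def bundle_chart_def ..

lemma bundle_chart_simps:
  "chart_dom (bundle_chart c) = bundle_dom c"
  "chart_map (bundle_chart c) (x, z) = (chart_map c x, z)"
  by (simp_all add: bundle_chart_def)

lemma bundle_chart_image: "chart_map (bundle_chart c) ` (V \<times> Z) = (chart_map c ` V) \<times> Z"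
proof -
  have "chart_map (bundle_chart c) = map_prod (chart_map c) id"
    by (simp add: bundle_chart_def fun_eq_iff)
  then show ?thesis by (simp only: map_prod_image image_id id_apply)
qed

lemma bundle_chart_imageE:
  assumes "p \<in> chart_map (bundle_chart c) ` (V \<times> (- {0}))"
  obtains x z where "x \<in> V" "z \<noteq> 0" "p = (chart_map c x, z)"
  using assms unfolding bundle_chart_image by blast

lemma points_bundle_atlas: "points (bundle_atlas A) = points A \<times> (- {0})"
  unfolding points_def bundle_atlas_eq by (auto simp: bundle_chart_simps)

lemma bundle_chart_inv:
  assumes "regular_chart c" "e \<in> chart_map c ` chart_dom c" "z \<noteq> 0"
  shows "chart_inv (bundle_chart c) (e, z) = (chart_inv c e, z)"
proof -
  obtain x where x: "x \<in> chart_dom c" "e = chart_map c x" using assms(2) by blast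
  have inj: "inj_on (chart_map c) (chart_dom c)"
    using chart_inv_map[OF assms(1)] by (rule inj_on_inverseI)
  have "inj_on (chart_map (bundle_chart c)) (chart_dom (bundle_chart c))"
    using inj by (auto simp: inj_on_def bundle_chart_simps)
  then have "chart_inv (bundle_chart c) (chart_map (bundle_chart c) (x, z)) = (x, z)"
    by (rule inv_into_f_f) (use x assms(3) in \<open>simp add: bundle_chart_simps\<close>)
  then show ?thesis using x chart_inv_map[OF assms(1) x(1)] by (simp add: bundle_chart_simps)
qed

lemma bundle_chart_inv_map:
  assumes "regular_chart c" "x \<in> chart_dom c" "z \<noteq> 0"
  shows "chart_inv (bundle_chart c) (chart_map c x, z) = (x, z)"
  using bundle_chart_inv[OF assms(1) _ assms(3), of "chart_map c x"] chart_inv_map[OF assms(1,2)] assms(2)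
  by simp

lemma regular_bundle_chart:
  fixes c :: "('a::topological_space, 'e::euclidean_space) chart"
  assumes c: "regular_chart c"
  shows "regular_chart (bundle_chart c)"
proof -
  let ?D = "chart_dom c" and ?E = "chart_map c ` chart_dom c"
  have o: "open ?D" "open ?E" and hom: "homeomorphism ?D ?E (chart_map c) (chart_inv c)"
    using c unfolding regular_chart_def by simp_all
  have cont: "continuous_on ?D (chart_map c)" "continuous_on ?E (chart_inv c)"
    using hom unfolding homeomorphism_def by simp_all
  have 1: "continuous_on (?D \<times> (- {0})) (chart_map (bundle_chart c))"
    unfolding bundle_chart_def snd_conv case_prod_beta
    by (intro continuous_intros continuous_on_compose2[OF cont(1)]) auto
  have "continuous_on (?E \<times> (- {0})) (\<lambda>p. (chart_inv c (fst p), snd p :: complex))"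
    by (intro continuous_intros continuous_on_compose2[OF cont(2)]) auto
  then have 2: "continuous_on (?E \<times> (- {0})) (chart_inv (bundle_chart c))"
  proof (rule continuous_on_eq)
    fix p assume "p \<in> ?E \<times> (- {0::complex})"
    then show "(chart_inv c (fst p), snd p) = chart_inv (bundle_chart c) p"
      using bundle_chart_inv[OF c, of "fst p" "snd p"] by (simp add: mem_Times_iff)
  qed
  show ?thesis
    unfolding regular_chart_def
  proof (intro conjI)
    show "open (chart_dom (bundle_chart c))" "open (chart_map (bundle_chart c) ` chart_dom (bundle_chart c))"
      using o unfolding bundle_chart_simps bundle_chart_image by (auto intro!: open_Times)
    have inv: "chart_inv (bundle_chart c) (chart_map (bundle_chart c) p) = p" if "p \<in> chart_dom (bundle_chart c)" for p
      using that bundle_chart_inv_map[OF c] by (cases p) (simp add: bundle_chart_simps)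
    show "homeomorphism (chart_dom (bundle_chart c)) (chart_map (bundle_chart c) ` chart_dom (bundle_chart c))
      (chart_map (bundle_chart c)) (chart_inv (bundle_chart c))"
    proof (rule homeomorphismI)
      show "continuous_on (chart_dom (bundle_chart c)) (chart_map (bundle_chart c))"
        unfolding bundle_chart_simps by (rule 1)
      show "continuous_on (chart_map (bundle_chart c) ` chart_dom (bundle_chart c)) (chart_inv (bundle_chart c))"
        using 2 by (simp only: bundle_chart_simps(1) bundle_chart_image)
    qed (use inv in auto)
  qed
qed

lemma smooth_on_fst: "smooth_on S fst" and smooth_on_snd: "smooth_on S snd"
  by (intro smooth_on_bounded_linear bounded_linear_fst bounded_linear_snd)+

lemma smooth_on_Pair:
  assumes "open S" "smooth_on S f" "smooth_on S g"
  shows "smooth_on S (\<lambda>x. (f x, g x))"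
proof -
  have "smooth_on S (\<lambda>x. (f x, 0) + (0, g x))"
    by (intro smooth_on_add assms smooth_on_linear_compose[OF _ assms(1,2)]
        smooth_on_linear_compose[OF _ assms(1,3)] bounded_linear_Pair bounded_linear_ident bounded_linear_zero)
  then show ?thesis by simp
qed

context
  fixes A :: "('a::{t2_space,second_countable_topology}, 'e::euclidean_space) atlas"
  assumes A: "smooth_atlas A"
begin

lemma bundle_transition_eq:
  assumes "c \<in> A" "p \<in> chart_map c ` (chart_dom c \<inter> chart_dom d) \<times> (- {0})"
  shows "(chart_map (bundle_chart d) \<circ> chart_inv (bundle_chart c)) p = ((chart_map d \<circ> chart_inv c) (fst p), snd p)"
proof -
  obtain x z where "x \<in> chart_dom c" "z \<noteq> 0" "p = (chart_map c x, z)" using assms(2) by blast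
  then show ?thesis
    using bundle_chart_inv_map[OF smooth_atlas_regular[OF A assms(1)], of x z]
      chart_inv_map[OF smooth_atlas_regular[OF A assms(1)], of x] by (simp add: bundle_chart_simps)
qed

lemma smooth_atlas_bundle: "smooth_atlas (bundle_atlas A)"
  unfolding smooth_atlas_def bundle_atlas_eq ball_simps
proof (intro conjI ballI)
  fix c assume c: "c \<in> A"
  show "open (chart_dom (bundle_chart c))"
    "open (chart_map (bundle_chart c) ` chart_dom (bundle_chart c))"
    "homeomorphism (chart_dom (bundle_chart c)) (chart_map (bundle_chart c) ` chart_dom (bundle_chart c))
      (chart_map (bundle_chart c)) (chart_inv (bundle_chart c))"
    using regular_bundle_chart[OF smooth_atlas_regular[OF A c]] unfolding regular_chart_def by simp_all
  fix d assume d: "d \<in> A"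
  let ?I = "chart_map c ` (chart_dom c \<inter> chart_dom d)"
  note tr = smooth_atlas_transition[OF A c d]
  have oI: "open ?I" by (rule chart_nbhd_open_image[OF tr(2)])
  then have o: "open (?I \<times> (- {0::complex}))" by (auto intro: open_Times)
  have "smooth_on (?I \<times> (- {0::complex})) (\<lambda>p. ((chart_map d \<circ> chart_inv c) (fst p), snd p))"
    by (rule smooth_on_Pair[OF o smooth_on_compose[OF o oI _ smooth_on_fst tr(1)] smooth_on_snd]) auto
  then have "smooth_on (?I \<times> (- {0})) (chart_map (bundle_chart d) \<circ> chart_inv (bundle_chart c))"
    by (rule smooth_on_cong[OF o]) (rule bundle_transition_eq[OF c, symmetric])
  then show "smooth_on (chart_map (bundle_chart c) ` (chart_dom (bundle_chart c) \<inter> chart_dom (bundle_chart d)))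
      (chart_map (bundle_chart d) \<circ> chart_inv (bundle_chart c))"
    unfolding bundle_chart_simps Times_Int_Times Int_absorb bundle_chart_image .
qed

text \<open>One representative trivializes the whole bundle, so all product charts share the fibre
  coordinate and a change of chart acts on the base part of a vector alone.\<close>

lemma bundle_transition_derivative:
  assumes c: "c \<in> A" and d: "d \<in> A" and x: "x \<in> chart_dom c \<inter> chart_dom d" and z: "z \<noteq> 0"
  shows "frechet_derivative (chart_map (bundle_chart d) \<circ> chart_inv (bundle_chart c))
      (at (chart_map (bundle_chart c) (x, z))) v =
    (\<D> (chart_map d \<circ> chart_inv c) (chart_map c x) (fst v), snd v)"
proof -
  let ?I = "chart_map c ` (chart_dom c \<inter> chart_dom d)"
  let ?T = "chart_map d \<circ> chart_inv c"
  note tr = smooth_atlas_transition[OF A c d]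
  have oI: "open ?I" by (rule chart_nbhd_open_image[OF tr(2)])
  then have o: "open (?I \<times> (- {0::complex}))" by (auto intro: open_Times)
  have p: "(chart_map c x, z) \<in> ?I \<times> (- {0})" using x z by simp
  have T: "(?T has_derivative frechet_derivative ?T (at (chart_map c x))) (at (fst (chart_map c x, z)))"
    using smooth_on_has_derivative[OF tr(1)] x by simp
  have "((\<lambda>p. (?T (fst p), snd p)) has_derivative
     (\<lambda>v. (frechet_derivative ?T (at (chart_map c x)) (fst v), snd v))) (at (chart_map c x, z))"
    by (intro has_derivative_Pair has_derivative_compose[where f = fst and g = ?T, OF _ T]
        bounded_linear_imp_has_derivative bounded_linear_fst bounded_linear_snd)
  from frechet_derivative_at[OF this]
  have "\<D> (\<lambda>p. (?T (fst p), snd p)) (chart_map c x, z) v =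
     (frechet_derivative ?T (at (chart_map c x)) (fst v), snd v)" by metis
  moreover have "\<D> (chart_map (bundle_chart d) \<circ> chart_inv (bundle_chart c)) (chart_map c x, z) =
    \<D> (\<lambda>p. (?T (fst p), snd p)) (chart_map c x, z)"
    by (rule frechet_derivative_cong[OF o p]) (rule bundle_transition_eq[OF c])
  ultimately show ?thesis by (simp add: bundle_chart_simps)
qed

context
  fixes c assumes c: "c \<in> A"
begin

lemmas atlas_chart_regular = smooth_atlas_regular[OF A c]

lemma bundle_nbhd: "chart_nbhd (bundle_chart c) (bundle_dom c)"
  using chart_nbhd_dom[OF regular_bundle_chart[OF atlas_chart_regular]] unfolding bundle_chart_simps .

lemma fst_local:
  assumes "e \<in> chart_map (bundle_chart c) ` (bundle_dom c)"
  shows "(chart_map c \<circ> fst \<circ> chart_inv (bundle_chart c)) e = fst e"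
proof -
  obtain x z where "x \<in> chart_dom c" "z \<noteq> 0" "e = (chart_map c x, z)"
    using assms by (rule bundle_chart_imageE)
  then show ?thesis by (simp add: bundle_chart_inv_map[OF atlas_chart_regular])
qed

lemma fst_local_smooth:
  "smooth_on (chart_map (bundle_chart c) ` (bundle_dom c)) (chart_map c \<circ> fst \<circ> chart_inv (bundle_chart c))"
  by (rule smooth_on_cong[OF chart_nbhd_open_image[OF bundle_nbhd] smooth_on_fst]) (simp only: fst_local)

lemma fst_local_derivative:
  assumes "p \<in> bundle_dom c"
  shows "\<D> (chart_map c \<circ> fst \<circ> chart_inv (bundle_chart c)) (chart_map (bundle_chart c) p) = fst"
proof -
  have "\<D> (chart_map c \<circ> fst \<circ> chart_inv (bundle_chart c)) (chart_map (bundle_chart c) p) =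
    \<D> fst (chart_map (bundle_chart c) p)"
    by (rule frechet_derivative_cong[OF chart_nbhd_open_image[OF bundle_nbhd]])
      (use assms fst_local in simp_all)
  also have "\<dots> = fst"
    by (rule frechet_derivative_at[OF bounded_linear_imp_has_derivative[OF bounded_linear_fst], symmetric])
  finally show ?thesis .
qed

lemma pullback_fst:
  assumes "form_compatible A \<kappa>" "p \<in> bundle_dom c"
  shows "pullback A fst \<kappa> (bundle_chart c) p v = \<kappa> c (fst p) (fst v)"
  using pullback_eq[OF A assms(1) bundle_nbhd c _ fst_local_smooth assms(2)] fst_local_derivative[OF assms(2)]
  by auto

lemma chart_smooth_fst:
  assumes "chart_smooth c (chart_dom c) g"
  shows "chart_smooth (bundle_chart c) (bundle_dom c) (\<lambda>p. g (fst p))"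
proof -
  let ?S = "chart_map (bundle_chart c) ` (bundle_dom c)"
  have o: "open ?S" by (rule chart_nbhd_open_image[OF bundle_nbhd])
  have "smooth_on ?S (\<lambda>p. g (chart_inv c (fst p)))"
    by (rule smooth_on_compose[OF o _ _ smooth_on_fst assms[unfolded chart_smooth_def]])
      (use atlas_chart_regular in \<open>auto simp: bundle_chart_image regular_chart_def\<close>)
  then show ?thesis unfolding chart_smooth_def
    by (rule smooth_on_cong[OF o]) (erule bundle_chart_imageE, simp add: bundle_chart_inv_map[OF atlas_chart_regular] chart_inv_map[OF atlas_chart_regular])
qed

lemma fun_diff_fst:
  assumes "chart_smooth c (chart_dom c) g" "p \<in> bundle_dom c"
  shows "fun_diff (\<lambda>p. g (fst p)) (bundle_chart c) p v = fun_diff g c (fst p) (fst v)"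
proof -
  have *: "fst p \<in> chart_dom c" using assms(2) by auto
  have p: "chart_map (bundle_chart c) p \<in> chart_map (bundle_chart c) ` (bundle_dom c)" using assms(2) by blast
  have D: "((\<lambda>y. g (chart_inv c y)) has_derivative fun_diff g c (fst p)) (at (fst (chart_map (bundle_chart c) p)))"
    using fun_diff_has_derivative[OF chart_nbhd_dom[OF atlas_chart_regular] assms(1) *] by (cases p) (simp add: bundle_chart_simps)
  have "((\<lambda>y. g (chart_inv c (fst y))) has_derivative (\<lambda>v. fun_diff g c (fst p) (fst v))) (at (chart_map (bundle_chart c) p))"
    by (rule has_derivative_compose[OF bounded_linear_imp_has_derivative[OF bounded_linear_fst] D])
  then have "((\<lambda>y. g (fst (chart_inv (bundle_chart c) y))) has_derivative (\<lambda>v. fun_diff g c (fst p) (fst v))) (at (chart_map (bundle_chart c) p))"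
    by (rule has_derivative_transform_within_open[OF _ chart_nbhd_open_image[OF bundle_nbhd] p])
      (erule bundle_chart_imageE, simp add: bundle_chart_inv_map[OF atlas_chart_regular] chart_inv_map[OF atlas_chart_regular])
  then show ?thesis by (rule fun_diff_eqI[OF bundle_nbhd])
qed

lemma chart_smooth_snd: "chart_smooth (bundle_chart c) (bundle_dom c) snd"
  unfolding chart_smooth_def
  by (rule smooth_on_cong[OF chart_nbhd_open_image[OF bundle_nbhd] smooth_on_snd])
    (erule bundle_chart_imageE, simp add: bundle_chart_inv_map[OF atlas_chart_regular] chart_inv_map[OF atlas_chart_regular])

lemma fun_diff_snd:
  assumes "p \<in> bundle_dom c"
  shows "fun_diff snd (bundle_chart c) p v = snd v"
proof -
  have p: "chart_map (bundle_chart c) p \<in> chart_map (bundle_chart c) ` (bundle_dom c)" using assms by blast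
  have "((\<lambda>y. snd (chart_inv (bundle_chart c) y)) has_derivative snd) (at (chart_map (bundle_chart c) p))"
    by (rule has_derivative_transform_within_open[where f = snd, OF _ chart_nbhd_open_image[OF bundle_nbhd] p])
      (auto intro!: bounded_linear_imp_has_derivative bounded_linear_snd
        elim!: bundle_chart_imageE simp: bundle_chart_inv_map[OF atlas_chart_regular])
  then show ?thesis by (rule fun_diff_eqI[OF bundle_nbhd])
qed

lemma chart_form_pullback_fst:
  assumes "one_form A \<kappa>"
  shows "chart_form (bundle_chart c) (bundle_dom c) (pullback A fst \<kappa>)"
proof -
  note \<kappa> = one_formD(1)[OF assms c] one_formD(2)[OF assms]
  have "chart_form (bundle_chart c) (bundle_dom c) (\<lambda>C p v. \<kappa> c (fst p) (fst v))"
    unfolding chart_form_def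
  proof (intro conjI ballI allI)
    fix p assume "p \<in> bundle_dom c"
    then have "linear (\<kappa> c (fst p))" using \<kappa>(1) unfolding chart_form_def by auto
    from linear_compose[OF bounded_linear.linear[OF bounded_linear_fst] this]
    show "linear (\<lambda>v :: _ \<times> complex. \<kappa> c (fst p) (fst v))" by (simp add: o_def)
  next
    fix v
    show "chart_smooth (bundle_chart c) (bundle_dom c) (\<lambda>p. \<kappa> c (fst p) (fst v))"
      using chart_smooth_fst \<kappa>(1) unfolding chart_form_def by blast
  qed
  then show ?thesis
    by (rule chart_form_cong[OF bundle_nbhd]) (simp add: pullback_fst[OF \<kappa>(2)])
qed

lemma ext_diff_pullback_fst:
  assumes "one_form A \<kappa>" "p \<in> bundle_dom c"
  shows "ext_diff (pullback A fst \<kappa>) (bundle_chart c) p u v = ext_diff \<kappa> c (fst p) (fst u) (fst v)"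
  using ext_diff_pullback[OF bundle_nbhd chart_nbhd_dom[OF atlas_chart_regular] _ fst_local_smooth one_formD(1)[OF assms(1) c] _ assms(2),
      of "pullback A fst \<kappa>" u v] pullback_fst[OF one_formD(2)[OF assms(1)]]
  by (auto simp: fst_local_derivative fst_local_derivative[OF assms(2)])

end

end

section \<open>Structure equations of the bundle in terms of the base\<close>

lemma bundle_omega_eq:
  assumes "smooth_atlas A" "c \<in> A" "form_compatible A \<kappa>" "p \<in> bundle_dom c"
  shows "bundle_omega A \<kappa> a (bundle_chart c) p v =
    of_real ((cmod (snd p))\<^sup>2 / a (fst p)) * \<kappa> c (fst p) (fst v)"
  unfolding bundle_omega_def pullback_fst[OF assms] ..

lemma bundle_omega1_eq:
  assumes "smooth_atlas A" "c \<in> A" "form_compatible A \<mu>" "p \<in> bundle_dom c"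
  shows "bundle_omega1 A \<mu> (bundle_chart c) p v = snd p * \<mu> c (fst p) (fst v)"
  unfolding bundle_omega1_def pullback_fst[OF assms] ..

lemma ext_diff_bundle_omega1:
  assumes "smooth_atlas A" "c \<in> A" "one_form A \<mu>" "p \<in> bundle_dom c"
  shows "ext_diff (bundle_omega1 A \<mu>) (bundle_chart c) p u v =
    snd u * \<mu> c (fst p) (fst v) - snd v * \<mu> c (fst p) (fst u) + snd p * ext_diff \<mu> c (fst p) (fst u) (fst v)"
proof -
  note n = bundle_nbhd[OF assms(1,2)]
  have "ext_diff (bundle_omega1 A \<mu>) (bundle_chart c) p u v =
    ext_diff (\<lambda>C p v. snd p * pullback A fst \<mu> C p v) (bundle_chart c) p u v"
    by (rule ext_diff_cong[OF n _ assms(4)]) (simp add: bundle_omega1_def)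
  also have "\<dots> = (fun_diff snd \<and>\<^sub>1 pullback A fst \<mu>) (bundle_chart c) p u v +
     snd p * ext_diff (pullback A fst \<mu>) (bundle_chart c) p u v"
    by (rule ext_diff_mult[OF n chart_smooth_snd[OF assms(1,2)] chart_form_pullback_fst[OF assms(1-3)] assms(4)])
  finally show ?thesis
    unfolding wedge_def fun_diff_snd[OF assms(1,2,4)] ext_diff_pullback_fst[OF assms]
      pullback_fst[OF assms(1,2) one_formD(2)[OF assms(3)] assms(4)] .
qed

text \<open>Here \<omega> is the pullback of \<kappa> times \<open>z * cnj z / a\<close>, and \<tau>
  is a^2 times the differential of this factor: the quotient rule gives
  \<open>a d(z * cnj z) - z * cnj z da\<close>. Multiplying by a^2 keeps the formula free of
  divisions.\<close>

lemma ext_diff_bundle_omega: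
  assumes "smooth_atlas A" "c \<in> A" "one_form A \<kappa>" "p \<in> bundle_dom c"
    and a: "chart_smooth c (chart_dom c) a" "\<And>x. x \<in> chart_dom c \<Longrightarrow> a x \<noteq> 0"
  defines "\<kappa>' \<equiv> \<lambda>v. \<kappa> c (fst p) (fst v)" and "x \<equiv> fst p" and "z \<equiv> snd p"
  defines "\<tau> \<equiv> \<lambda>v. of_real (a x) * (z * cnj (snd v) + snd v * cnj z) -
     z * cnj z * fun_diff (\<lambda>x. of_real (a x)) c x (fst v)"
  shows "of_real (a x) * of_real (a x) * ext_diff (bundle_omega A \<kappa> a) (bundle_chart c) p u v =
    \<tau> u * \<kappa>' v - \<tau> v * \<kappa>' u + of_real (a x) * (z * cnj z) * ext_diff \<kappa> c x (fst u) (fst v)"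
proof -
  note n = bundle_nbhd[OF assms(1,2)]
  let ?W = "bundle_dom c" and ?B = "bundle_chart c"
  let ?a = "\<lambda>x. complex_of_real (a x)"
  define G where "G q = complex_of_real ((cmod (snd q))\<^sup>2 / a (fst q))" for q :: "'a \<times> complex"
  have sa: "chart_smooth c (chart_dom c) ?a"
    by (rule chart_smooth_of_real[OF chart_nbhd_dom[OF smooth_atlas_regular[OF assms(1,2)]] a(1)])
  have sa': "chart_smooth ?B ?W (\<lambda>p. ?a (fst p))" by (rule chart_smooth_fst[OF assms(1,2) sa])
  note sz = chart_smooth_snd[OF assms(1,2)]
  have Geq: "G q = snd q * cnj (snd q) / ?a (fst q)" for q
    by (simp add: G_def of_real_cmod_power2)
  have sG: "chart_smooth ?B ?W G"
    unfolding Geq[abs_def]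
    by (rule chart_smooth_divide[OF n chart_smooth_mult[OF n sz chart_smooth_cnj[OF n sz]] sa']) (use a(2) in auto)
  have ax: "?a x \<noteq> 0" using a(2) assms(4) by (auto simp: x_def)
  have dG: "?a x * fun_diff G ?B p v = z * cnj (snd v) + snd v * cnj z - G p * fun_diff ?a c x (fst v)" for v
  proof -
    have "fun_diff (\<lambda>q. ?a (fst q) * G q) ?B p v = fun_diff (\<lambda>q. snd q * cnj (snd q)) ?B p v"
      by (rule fun_diff_cong[OF n _ assms(4)]) (use a(2) in \<open>auto simp: Geq\<close>)
    then show ?thesis
      unfolding fun_diff_mult[OF n sa' sG assms(4)] fun_diff_mult[OF n sz chart_smooth_cnj[OF n sz] assms(4)]
        fun_diff_cnj[OF n sz assms(4)] fun_diff_snd[OF assms(1,2,4)] fun_diff_fst[OF assms(1,2) sa assms(4)]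
      by (simp add: x_def z_def algebra_simps)
  qed
  have "ext_diff (bundle_omega A \<kappa> a) ?B p u v = ext_diff (\<lambda>C p v. G p * pullback A fst \<kappa> C p v) ?B p u v"
    by (rule ext_diff_cong[OF n _ assms(4)]) (simp add: bundle_omega_def G_def)
  also have "\<dots> = (fun_diff G \<and>\<^sub>1 pullback A fst \<kappa>) ?B p u v + G p * ext_diff (pullback A fst \<kappa>) ?B p u v"
    by (rule ext_diff_mult[OF n sG chart_form_pullback_fst[OF assms(1-3)] assms(4)])
  also have "\<dots> = fun_diff G ?B p u * \<kappa>' v - fun_diff G ?B p v * \<kappa>' u + G p * ext_diff \<kappa> c x (fst u) (fst v)"
    unfolding wedge_def ext_diff_pullback_fst[OF assms(1-4)] \<kappa>'_def x_def
      pullback_fst[OF assms(1,2) one_formD(2)[OF assms(3)] assms(4)] ..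
  finally have E: "ext_diff (bundle_omega A \<kappa> a) ?B p u v =
    fun_diff G ?B p u * \<kappa>' v - fun_diff G ?B p v * \<kappa>' u + G p * ext_diff \<kappa> c x (fst u) (fst v)" .
  have "?a x * ?a x * ext_diff (bundle_omega A \<kappa> a) ?B p u v =
    ?a x * (?a x * fun_diff G ?B p u) * \<kappa>' v - ?a x * (?a x * fun_diff G ?B p v) * \<kappa>' u +
      ?a x * (?a x * G p) * ext_diff \<kappa> c x (fst u) (fst v)"
    unfolding E by (simp add: algebra_simps)
  moreover have "?a x * G p = z * cnj z" using ax by (simp add: Geq x_def z_def)
  moreover have "?a x * (?a x * fun_diff G ?B p v) = \<tau> v" for v
    unfolding dG using calculation(2) by (simp add: \<tau>_def algebra_simps)
  ultimately show ?thesis by simp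
qed

text \<open>d(z \<mu>) is the sum of dz \<and> \<mu> and z d\<mu>. The part dz/z of \<Omega>
  accounts for the first term, and the rest of the equation is divisible by z.\<close>

lemma bundle_omega1_equation_iff:
  fixes A :: "('a::{t2_space,second_countable_topology}, 'e::euclidean_space) atlas"
    and \<Omega> :: "('a \<times> complex, 'e \<times> complex) form1"
  assumes "smooth_atlas A" "c \<in> A" "one_form A \<mu>" "p \<in> bundle_dom c"
  defines "\<beta> \<equiv> \<lambda>v. \<Omega> (bundle_chart c) p v - snd v / snd p"
  shows "ext_diff (bundle_omega1 A \<mu>) (bundle_chart c) p u v = (\<Omega> \<and>\<^sub>1 bundle_omega1 A \<mu>) (bundle_chart c) p u v \<longleftrightarrow>
    ext_diff \<mu> c (fst p) (fst u) (fst v) = \<beta> u * \<mu> c (fst p) (fst v) - \<beta> v * \<mu> c (fst p) (fst u)"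
proof -
  have z: "snd p \<noteq> 0" using assms(4) by auto
  have "ext_diff (bundle_omega1 A \<mu>) (bundle_chart c) p u v - (\<Omega> \<and>\<^sub>1 bundle_omega1 A \<mu>) (bundle_chart c) p u v =
    snd p * (ext_diff \<mu> c (fst p) (fst u) (fst v) - (\<beta> u * \<mu> c (fst p) (fst v) - \<beta> v * \<mu> c (fst p) (fst u)))"
    unfolding ext_diff_bundle_omega1[OF assms(1-4)] wedge_def
      bundle_omega1_eq[OF assms(1,2) one_formD(2)[OF assms(3)] assms(4)] \<beta>_def
    using z by (simp add: field_simps)
  then show ?thesis using z by (metis eq_iff_diff_eq_0 mult_eq_0_iff)
qed

text \<open>The differential of |z|^2 is absorbed by dz/z and its conjugate, and the common factor
  |z|^2 cancels. Afterwards z enters through \<beta> only, which is why \<Omega> descends.\<close>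

lemma bundle_omega_equation_iff:
  fixes A :: "('a::{t2_space,second_countable_topology}, 'e::euclidean_space) atlas"
    and \<Omega> :: "('a \<times> complex, 'e \<times> complex) form1"
  assumes "smooth_atlas A" "c \<in> A" "one_form A \<kappa>" "p \<in> bundle_dom c" "one_form A \<mu>"
    and a: "chart_smooth c (chart_dom c) a" "\<And>x. x \<in> chart_dom c \<Longrightarrow> a x \<noteq> 0"
  defines "\<beta> \<equiv> \<lambda>v. \<Omega> (bundle_chart c) p v - snd v / snd p" and "x \<equiv> fst p"
  shows "ext_diff (bundle_omega A \<kappa> a) (bundle_chart c) p u v =
      \<i> * (bundle_omega1 A \<mu> \<and>\<^sub>1 conj_form (bundle_omega1 A \<mu>)) (bundle_chart c) p u v +
      ((\<Omega> \<and>\<^sub>1 bundle_omega A \<kappa> a) (bundle_chart c) p u v + (conj_form \<Omega> \<and>\<^sub>1 bundle_omega A \<kappa> a) (bundle_chart c) p u v) \<longleftrightarrow>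
    of_real (a x) * ext_diff \<kappa> c x (fst u) (fst v) =
      \<i> * of_real (a x) * of_real (a x) * (\<mu> \<and>\<^sub>1 conj_form \<mu>) c x (fst u) (fst v) +
      (fun_diff (\<lambda>x. of_real (a x)) \<and>\<^sub>1 \<kappa>) c x (fst u) (fst v) +
      of_real (a x) * ((\<beta> u + cnj (\<beta> u)) * \<kappa> c x (fst v) - (\<beta> v + cnj (\<beta> v)) * \<kappa> c x (fst u))"
    (is "?L = ?R \<longleftrightarrow> ?L' = ?R'")
proof -
  have z: "snd p \<noteq> 0" "cnj (snd p) \<noteq> 0" using assms(4) by auto
  have ax: "complex_of_real (a x) \<noteq> 0" using a(2) assms(4) by (auto simp: x_def)
  have \<Omega>: "\<Omega> (bundle_chart c) p v = \<beta> v + snd v / snd p" for v by (simp add: \<beta>_def)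
  let ?A = "complex_of_real (a x)" and ?k = "\<lambda>v. \<kappa> c x (fst v)" and ?z = "snd p"
  let ?dz = "\<lambda>v. ?z * cnj (snd v) + snd v * cnj ?z" and ?da = "\<lambda>v. fun_diff (\<lambda>x. of_real (a x)) c x (fst v)"
  have L: "?A * ?A * ?L = (?A * ?dz u - ?z * cnj ?z * ?da u) * ?k v - (?A * ?dz v - ?z * cnj ?z * ?da v) * ?k u +
      ?A * (?z * cnj ?z) * ext_diff \<kappa> c x (fst u) (fst v)"
    unfolding x_def by (rule ext_diff_bundle_omega[OF assms(1-4) a])
  have R: "?A * ?A * ?R = \<i> * ?A * ?A * (?z * cnj ?z) * (\<mu> \<and>\<^sub>1 conj_form \<mu>) c x (fst u) (fst v) +
      ?A * ((?z * cnj ?z * (\<beta> u + cnj (\<beta> u)) + ?dz u) * ?k v - (?z * cnj ?z * (\<beta> v + cnj (\<beta> v)) + ?dz v) * ?k u)"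
    unfolding wedge_def conj_form_def
      bundle_omega1_eq[OF assms(1,2) one_formD(2)[OF assms(5)] assms(4)]
      bundle_omega_eq[OF assms(1,2) one_formD(2)[OF assms(3)] assms(4)] \<Omega> x_def[symmetric]
    using z ax by (simp add: field_simps of_real_cmod_power2)
  have "?A * ?A * (?L - ?R) = ?A * ?A * ?L - ?A * ?A * ?R" by (rule right_diff_distrib)
  also have "\<dots> = ?z * cnj ?z * (?L' - ?R')"
    unfolding L R unfolding wedge_def by (simp add: algebra_simps)
  finally have "?A * ?A * (?L - ?R) = ?z * cnj ?z * (?L' - ?R')" .
  then show ?thesis using z ax by (metis eq_iff_diff_eq_0 mult_eq_0_iff)
qed

lemma cis_minus_Arg: "cis (- Arg z) * z = complex_of_real (cmod z)"
  by (metis cis_mult cis_zero add.left_inverse mult.assoc mult.commute mult_1 rcis_cmod_Arg rcis_def)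

text \<open>The factors of the fibre coordinate cancel in \<open>d\<Omega>\<close>.\<close>
lemma bundle_Omega_rhs:
  assumes "smooth_atlas A" "c \<in> A" "one_form A \<kappa>" "one_form A \<mu>" "p \<in> bundle_dom c" "a (fst p) \<noteq> 0"
  shows "of_real (a (fst p)) * (of_real (bundle_K1 k1 p) * (bundle_omega1 A \<mu> \<and>\<^sub>1 conj_form (bundle_omega1 A \<mu>)) (bundle_chart c) p u v +
         bundle_K2 k2 p * (bundle_omega1 A \<mu> \<and>\<^sub>1 bundle_omega A \<kappa> a) (bundle_chart c) p u v) =
    of_real (a (fst p)) * of_real (k1 (fst p)) * (\<mu> \<and>\<^sub>1 conj_form \<mu>) c (fst p) (fst u) (fst v) +
    k2 (fst p) * (\<mu> \<and>\<^sub>1 \<kappa>) c (fst p) (fst u) (fst v)"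
proof -
  obtain x z where p: "p = (x, z)" by (cases p)
  have z: "z \<noteq> 0" "cmod z \<noteq> 0" and ax: "a x \<noteq> 0" using assms(5,6) by (auto simp: p)
  have K1: "of_real (bundle_K1 k1 p) * (z * cnj z) = complex_of_real (k1 x)"
    using z by (simp add: p bundle_K1_def of_real_cmod_power2)
  have "bundle_K2 k2 p * z * of_real ((cmod z)\<^sup>2) = (cis (- Arg z) * z) * k2 x * of_real ((cmod z)\<^sup>2) / of_real ((cmod z) ^ 3)"
    by (simp add: p bundle_K2_def)
  also have "\<dots> = k2 x" unfolding cis_minus_Arg using z by (simp add: power2_eq_square power3_eq_cube)
  finally have K2: "of_real (a x) * (bundle_K2 k2 p * (z * of_real ((cmod z)\<^sup>2 / a x))) = k2 x"
    using ax by (simp add: mult.assoc)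
  have "of_real (a x) * (of_real (bundle_K1 k1 p) * (bundle_omega1 A \<mu> \<and>\<^sub>1 conj_form (bundle_omega1 A \<mu>)) (bundle_chart c) p u v +
         bundle_K2 k2 p * (bundle_omega1 A \<mu> \<and>\<^sub>1 bundle_omega A \<kappa> a) (bundle_chart c) p u v) =
     of_real (a x) * (of_real (bundle_K1 k1 p) * (z * cnj z)) * (\<mu> \<and>\<^sub>1 conj_form \<mu>) c x (fst u) (fst v) +
     of_real (a x) * (bundle_K2 k2 p * (z * of_real ((cmod z)\<^sup>2 / a x))) * (\<mu> \<and>\<^sub>1 \<kappa>) c x (fst u) (fst v)"
    unfolding wedge_def conj_form_def bundle_omega1_eq[OF assms(1,2) one_formD(2)[OF assms(4)] assms(5)]
      bundle_omega_eq[OF assms(1,2) one_formD(2)[OF assms(3)] assms(5)]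
    by (simp only: p fst_conv snd_conv complex_cnj_mult) (simp only: algebra_simps)
  then show ?thesis unfolding K1 K2 by (simp add: p)
qed

section \<open>Sections and forms on the bundle\<close>

lemma base_section_derivative:
  assumes "smooth_atlas A" "c \<in> A" "chart_smooth c (chart_dom c) h"
  defines "\<psi> \<equiv> chart_map (bundle_chart c) \<circ> (\<lambda>x. (x, h x)) \<circ> chart_inv c"
  shows "smooth_on (chart_map c ` chart_dom c) \<psi>"
    and "x \<in> chart_dom c \<Longrightarrow> \<D> \<psi> (chart_map c x) v = (v, fun_diff h c x v)"
proof -
  note rc = smooth_atlas_regular[OF assms(1,2)]
  note n = chart_nbhd_dom[OF rc]
  note o = chart_nbhd_open_image[OF n]
  have eq: "(y, h (chart_inv c y)) = \<psi> y" if "y \<in> chart_map c ` chart_dom c" for y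
    using chart_nbhd_inv[OF n that] by (simp add: \<psi>_def bundle_chart_simps)
  show "smooth_on (chart_map c ` chart_dom c) \<psi>"
    by (rule smooth_on_cong[OF o smooth_on_Pair[OF o smooth_on_bounded_linear[OF bounded_linear_ident] assms(3)[unfolded chart_smooth_def]] eq])
  show "\<D> \<psi> (chart_map c x) v = (v, fun_diff h c x v)" if x: "x \<in> chart_dom c"
  proof -
    have "((\<lambda>y. (y, h (chart_inv c y))) has_derivative (\<lambda>v. (v, fun_diff h c x v))) (at (chart_map c x))"
      by (rule has_derivative_Pair[OF has_derivative_ident fun_diff_has_derivative[OF n assms(3) x]])
    then have "(\<psi> has_derivative (\<lambda>v. (v, fun_diff h c x v))) (at (chart_map c x))"
      by (rule has_derivative_transform_within_open[OF _ o _ eq]) (use x in blast)+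
    from frechet_derivative_at[OF this] show ?thesis by metis
  qed
qed

text \<open>The section is the graph of h, and its derivative sends v to (v, dh v); in the product
  chart over c the pullback is an evaluation.\<close>

lemma pullback_section:
  assumes "smooth_atlas A" "c \<in> A" "chart_smooth c (chart_dom c) h" "\<And>x. x \<in> chart_dom c \<Longrightarrow> h x \<noteq> 0"
    and "form_compatible (bundle_atlas A) \<Omega>" "x \<in> chart_dom c"
  shows "pullback (bundle_atlas A) (\<lambda>x. (x, h x)) \<Omega> c x v = \<Omega> (bundle_chart c) (x, h x) (v, fun_diff h c x v)"
proof -
  have B: "bundle_chart c \<in> bundle_atlas A" using assms(2) by (simp add: bundle_atlas_eq)
  have im: "(\<lambda>x. (x, h x)) ` chart_dom c \<subseteq> chart_dom (bundle_chart c)"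
    using assms(4) by (auto simp: bundle_chart_simps)
  note d = base_section_derivative[OF assms(1-3)]
  show ?thesis
    unfolding pullback_eq[OF smooth_atlas_bundle[OF assms(1)] assms(5)
        chart_nbhd_dom[OF smooth_atlas_regular[OF assms(1,2)]] B im d(1) assms(6)] d(2)[OF assms(6)] ..
qed

lemma form_compatible_bundle:
  assumes "smooth_atlas A"
    and "\<And>c d x z v w. c \<in> A \<Longrightarrow> d \<in> A \<Longrightarrow> x \<in> chart_dom c \<Longrightarrow> x \<in> chart_dom d \<Longrightarrow> z \<noteq> 0 \<Longrightarrow>
      \<Omega> (bundle_chart c) (x, z) (v, w) = \<Omega> (bundle_chart d) (x, z)
        (\<D> (chart_map d \<circ> chart_inv c) (chart_map c x) v, w)"
  shows "form_compatible (bundle_atlas A) \<Omega>"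
  unfolding form_compatible_def bundle_atlas_eq ball_simps
proof (intro ballI allI)
  fix c d p v assume c: "c \<in> A" and d: "d \<in> A"
    and p: "p \<in> chart_dom (bundle_chart c) \<inter> chart_dom (bundle_chart d)"
  obtain x z where pxz: "p = (x, z)" by (cases p)
  have x: "x \<in> chart_dom c" "x \<in> chart_dom d" "z \<noteq> 0" using p by (auto simp: pxz bundle_chart_simps)
  show "\<Omega> (bundle_chart c) p v = \<Omega> (bundle_chart d) p
    (\<D> (chart_map (bundle_chart d) \<circ> chart_inv (bundle_chart c)) (chart_map (bundle_chart c) p) v)"
    unfolding pxz bundle_transition_derivative[OF assms(1) c d IntI[OF x(1,2)] x(3)]
    using assms(2)[OF c d x, of "fst v" "snd v"] by simp
qed

lemma form_compatible_bundle_omega: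
  assumes "smooth_atlas A" "form_compatible A \<kappa>"
  shows "form_compatible (bundle_atlas A) (bundle_omega A \<kappa> a)"
  by (rule form_compatible_bundle[OF assms(1)])
    (simp add: bundle_omega_eq[OF assms(1) _ assms(2)] form_compatibleD[OF assms(2), symmetric])

lemma form_compatible_bundle_omega1:
  assumes "smooth_atlas A" "form_compatible A \<mu>"
  shows "form_compatible (bundle_atlas A) (bundle_omega1 A \<mu>)"
  by (rule form_compatible_bundle[OF assms(1)])
    (simp add: bundle_omega1_eq[OF assms(1) _ assms(2)] form_compatibleD[OF assms(2), symmetric])

section \<open>Descent of the connection form to the base\<close>

lemma form2_eqD:
  "form2_eq A \<alpha> \<beta> \<Longrightarrow> c \<in> A \<Longrightarrow> x \<in> chart_dom c \<Longrightarrow> \<alpha> c x u v = \<beta> c x u v"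
  unfolding form2_eq_def by simp

lemma bundle_coframeD:
  assumes bc: "bundle_coframe A \<kappa> \<mu> a \<Omega> k1 k2"
  defines "\<omega> \<equiv> bundle_omega A \<kappa> a" and "\<omega>1 \<equiv> bundle_omega1 A \<mu>"
  shows "one_form (bundle_atlas A) \<Omega>" "smooth_fun A k1" "smooth_fun A k2"
    and "c \<in> A \<Longrightarrow> p \<in> bundle_dom c \<Longrightarrow> ext_diff \<omega> (bundle_chart c) p u v =
      \<i> * (\<omega>1 \<and>\<^sub>1 conj_form \<omega>1) (bundle_chart c) p u v +
      ((\<Omega> \<and>\<^sub>1 \<omega>) (bundle_chart c) p u v + (conj_form \<Omega> \<and>\<^sub>1 \<omega>) (bundle_chart c) p u v)"
    and "c \<in> A \<Longrightarrow> p \<in> bundle_dom c \<Longrightarrow>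
      ext_diff \<omega>1 (bundle_chart c) p u v = (\<Omega> \<and>\<^sub>1 \<omega>1) (bundle_chart c) p u v"
    and "c \<in> A \<Longrightarrow> p \<in> bundle_dom c \<Longrightarrow> ext_diff \<Omega> (bundle_chart c) p u v =
      of_real (bundle_K1 k1 p) * (\<omega>1 \<and>\<^sub>1 conj_form \<omega>1) (bundle_chart c) p u v +
      bundle_K2 k2 p * (\<omega>1 \<and>\<^sub>1 \<omega>) (bundle_chart c) p u v"
proof -
  have C: "bundle_chart c \<in> bundle_atlas A" "p \<in> chart_dom (bundle_chart c)"
    if "c \<in> A" "p \<in> bundle_dom c"
    using that by (simp_all only: bundle_atlas_eq bundle_chart_simps imageI)
  note bc' = bc[unfolded bundle_coframe_def Let_def, folded \<omega>_def \<omega>1_def]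
  show "one_form (bundle_atlas A) \<Omega>" "smooth_fun A k1" "smooth_fun A k2" using bc' by simp_all
  show "ext_diff \<omega> (bundle_chart c) p u v = \<i> * (\<omega>1 \<and>\<^sub>1 conj_form \<omega>1) (bundle_chart c) p u v +
      ((\<Omega> \<and>\<^sub>1 \<omega>) (bundle_chart c) p u v + (conj_form \<Omega> \<and>\<^sub>1 \<omega>) (bundle_chart c) p u v)"
    "ext_diff \<omega>1 (bundle_chart c) p u v = (\<Omega> \<and>\<^sub>1 \<omega>1) (bundle_chart c) p u v"
    "ext_diff \<Omega> (bundle_chart c) p u v =
      of_real (bundle_K1 k1 p) * (\<omega>1 \<and>\<^sub>1 conj_form \<omega>1) (bundle_chart c) p u v +
      bundle_K2 k2 p * (\<omega>1 \<and>\<^sub>1 \<omega>) (bundle_chart c) p u v"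
    if "c \<in> A" "p \<in> bundle_dom c"
    using bc' C[OF that] unfolding form2_eq_def by (simp_all del: split_paired_All)
qed

lemma points_memI: "c \<in> A \<Longrightarrow> x \<in> chart_dom c \<Longrightarrow> x \<in> points A"
  unfolding points_def by blast

text \<open>The pullback of \<Omega> along the constant section z = 1, written as an evaluation on
  horizontal vectors. There dz vanishes, so only the part that comes from the base is seen.\<close>

definition base_connection :: "('a \<times> complex, 'e \<times> complex) form1 \<Rightarrow> ('a, 'e::euclidean_space) form1" where
  "base_connection \<Omega> = (\<lambda>c x v. \<Omega> (bundle_chart c) (x, 1) (v, 0))"

lemma bundle_form_smooth:
  assumes "smooth_atlas A" "c \<in> A" "one_form (bundle_atlas A) \<Omega>"
  shows "chart_form (bundle_chart c) (bundle_dom c) \<Omega>"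
  using one_formD(1)[OF assms(3), of "bundle_chart c"] assms(2)
  by (simp add: bundle_atlas_eq bundle_chart_simps)

context
  fixes A :: "('a::{t2_space,second_countable_topology}, 'e::euclidean_space) atlas"
    and \<kappa> \<mu> a \<Omega> k1 k2
  assumes A: "smooth_atlas A" and \<kappa>: "one_form A \<kappa>" and \<mu>: "one_form A \<mu>"
    and ind: "\<And>c x. c \<in> A \<Longrightarrow> x \<in> chart_dom c \<Longrightarrow> independent_pair (\<kappa> c x) (\<mu> c x)"
    and a: "smooth_fun A a" "\<And>x. x \<in> points A \<Longrightarrow> a x \<noteq> 0"
    and bc: "bundle_coframe A \<kappa> \<mu> a \<Omega> k1 k2"
begin

lemma twist_in_chart:
  assumes "c \<in> A"
  shows "chart_smooth c (chart_dom c) a" "\<And>x. x \<in> chart_dom c \<Longrightarrow> a x \<noteq> 0"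
proof -
  show "chart_smooth c (chart_dom c) a" using a(1) assms unfolding smooth_fun_iff by blast
  show "a x \<noteq> 0" if "x \<in> chart_dom c" for x by (rule a(2)[OF points_memI[OF assms that]])
qed

text \<open>The equations for \<Omega> - dz/z at (x, z) and at (x, 1) have the same left-hand sides,
  which see base components of vectors only. The difference of the two solutions satisfies the
  homogeneous equations of \<open>connection_unique\<close>. Since the solution at (x, 1) is taken
  on horizontal parts, this also excludes any vertical part besides dz/z.\<close>

lemma bundle_Omega_eq:
  assumes c: "c \<in> A" and x: "x \<in> chart_dom c" and z: "z \<noteq> 0"
  shows "\<Omega> (bundle_chart c) (x, z) v = \<Omega> (bundle_chart c) (x, 1) (fst v, 0) + snd v / z"
proof -
  define \<beta> where "\<beta> z v = \<Omega> (bundle_chart c) (x, z) v - snd v / z" for z v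
  note t = twist_in_chart[OF c]
  have p: "(x, z) \<in> bundle_dom c" if "z \<noteq> 0" for z :: complex using x that by simp
  have 1: "ext_diff \<mu> c x (fst u) (fst v) = \<beta> z u * \<mu> c x (fst v) - \<beta> z v * \<mu> c x (fst u)"
    if "z \<noteq> 0" for z u v
    using bundle_omega1_equation_iff[where \<Omega> = \<Omega> and u = u and v = v, OF A c \<mu> p[OF that]] bundle_coframeD(5)[OF bc c p[OF that]]
    by (simp add: \<beta>_def)
  have 2: "of_real (a x) * ext_diff \<kappa> c x (fst u) (fst v) =
      \<i> * of_real (a x) * of_real (a x) * (\<mu> \<and>\<^sub>1 conj_form \<mu>) c x (fst u) (fst v) +
      (fun_diff (\<lambda>x. of_real (a x)) \<and>\<^sub>1 \<kappa>) c x (fst u) (fst v) +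
      of_real (a x) * ((\<beta> z u + cnj (\<beta> z u)) * \<kappa> c x (fst v) - (\<beta> z v + cnj (\<beta> z v)) * \<kappa> c x (fst u))"
    if "z \<noteq> 0" for z u v
    using bundle_omega_equation_iff[where \<Omega> = \<Omega> and u = u and v = v, OF A c \<kappa> p[OF that] \<mu> t] bundle_coframeD(4)[OF bc c p[OF that]]
    by (simp add: \<beta>_def)
  have "\<beta> z v - \<beta> 1 (fst v, 0) = 0"
  proof (rule connection_unique[where \<gamma> = "\<lambda>v. \<beta> z v - \<beta> 1 (fst v, 0)" and \<mu> = "\<lambda>v. \<mu> c x (fst v)" and \<kappa> = "\<lambda>v. \<kappa> c x (fst v)"])
    \<comment> \<open>Independence passes from the base to the bundle because the projection
      \<open>fst\<close> of tangent vectors is onto.\<close>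
    show "independent_pair (\<lambda>v :: 'e \<times> complex. \<kappa> c x (fst v)) (\<lambda>v. \<mu> c x (fst v))"
      unfolding independent_pair_def
    proof (intro allI impI)
      fix l0 l1 l2 assume "\<forall>v :: 'e \<times> complex. l0 * \<kappa> c x (fst v) + l1 * \<mu> c x (fst v) + l2 * cnj (\<mu> c x (fst v)) = 0"
      then have "l0 * \<kappa> c x v + l1 * \<mu> c x v + l2 * cnj (\<mu> c x v) = 0" for v
        by (metis fst_conv)
      from independent_pairD[OF ind[OF c x] this] show "l0 = 0 \<and> l1 = 0 \<and> l2 = 0" by simp
    qed
    fix u v
    have "\<beta> z u * \<mu> c x (fst v) - \<beta> z v * \<mu> c x (fst u) =
        \<beta> 1 (fst u, 0) * \<mu> c x (fst v) - \<beta> 1 (fst v, 0) * \<mu> c x (fst u)"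
      using 1[OF z, of u v] 1[of 1 "(fst u, 0)" "(fst v, 0)"] by simp
    then show "(\<beta> z u - \<beta> 1 (fst u, 0)) * \<mu> c x (fst v) - (\<beta> z v - \<beta> 1 (fst v, 0)) * \<mu> c x (fst u) = 0"
      by (simp add: algebra_simps)
    have "of_real (a x) * ((\<beta> z u + cnj (\<beta> z u)) * \<kappa> c x (fst v) - (\<beta> z v + cnj (\<beta> z v)) * \<kappa> c x (fst u)) =
      of_real (a x) * ((\<beta> 1 (fst u, 0) + cnj (\<beta> 1 (fst u, 0))) * \<kappa> c x (fst v) -
         (\<beta> 1 (fst v, 0) + cnj (\<beta> 1 (fst v, 0))) * \<kappa> c x (fst u))"
      using 2[OF z, of u v] 2[of 1 "(fst u, 0)" "(fst v, 0)"] by simp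
    then have "(\<beta> z u + cnj (\<beta> z u)) * \<kappa> c x (fst v) - (\<beta> z v + cnj (\<beta> z v)) * \<kappa> c x (fst u) =
      (\<beta> 1 (fst u, 0) + cnj (\<beta> 1 (fst u, 0))) * \<kappa> c x (fst v) -
         (\<beta> 1 (fst v, 0) + cnj (\<beta> 1 (fst v, 0))) * \<kappa> c x (fst u)"
      using t(2)[OF x] by simp
    then show "(\<beta> z u - \<beta> 1 (fst u, 0) + cnj (\<beta> z u - \<beta> 1 (fst u, 0))) * \<kappa> c x (fst v) -
      (\<beta> z v - \<beta> 1 (fst v, 0) + cnj (\<beta> z v - \<beta> 1 (fst v, 0))) * \<kappa> c x (fst u) = 0"
      by (simp add: algebra_simps)
  qed
  then show ?thesis by (simp add: \<beta>_def diff_eq_eq)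
qed

text \<open>d commutes with the pullback along the constant section z = 1, whose derivative sends v
  to (v, 0).\<close>

lemma ext_diff_base_connection:
  assumes c: "c \<in> A"
  shows "x \<in> chart_dom c \<Longrightarrow>
      ext_diff (base_connection \<Omega>) c x u v = ext_diff \<Omega> (bundle_chart c) (x, 1) (u, 0) (v, 0)"
    and "chart_form c (chart_dom c) (base_connection \<Omega>)"
proof -
  note rc = smooth_atlas_regular[OF A c]
  note n = chart_nbhd_dom[OF rc]
  note d = base_section_derivative[OF A c chart_smooth_const[OF n, of 1]]
  note \<Omega> = bundle_form_smooth[OF A c bundle_coframeD(1)[OF bc]]
  have im: "(\<lambda>x. (x, 1)) ` chart_dom c \<subseteq> bundle_dom c" by auto
  have D: "\<D> (chart_map (bundle_chart c) \<circ> (\<lambda>x. (x, 1)) \<circ> chart_inv c) (chart_map c x) v = (v, 0)"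
    if "x \<in> chart_dom c" for x v
    using d(2)[OF that] fun_diff_const[OF n] by simp
  show "ext_diff (base_connection \<Omega>) c x u v = ext_diff \<Omega> (bundle_chart c) (x, 1) (u, 0) (v, 0)"
    if x: "x \<in> chart_dom c"
    using ext_diff_pullback[OF n bundle_nbhd[OF A c] im d(1) \<Omega> _ x, of "base_connection \<Omega>" u v]
    by (simp add: D x base_connection_def)
  show "chart_form c (chart_dom c) (base_connection \<Omega>)"
    unfolding chart_form_def
  proof (intro conjI ballI allI)
    fix x assume "x \<in> chart_dom c"
    then have "linear (\<Omega> (bundle_chart c) (x, 1))" using \<Omega> unfolding chart_form_def by simp
    from linear_compose[OF bounded_linear.linear[OF bounded_linear_Pair[OF bounded_linear_ident bounded_linear_zero]] this]
    show "linear (base_connection \<Omega> c x)" by (simp add: o_def base_connection_def[abs_def])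
  next
    fix v
    have o: "open (chart_map c ` chart_dom c)" by (rule chart_nbhd_open_image[OF n])
    have "chart_smooth (bundle_chart c) (bundle_dom c) (\<lambda>x. \<Omega> (bundle_chart c) x (v, 0))"
      using \<Omega> unfolding chart_form_def by blast
    then have s: "smooth_on ((chart_map c ` chart_dom c) \<times> (- {0})) (\<lambda>y. \<Omega> (bundle_chart c) (chart_inv (bundle_chart c) y) (v, 0))"
      unfolding chart_smooth_def bundle_chart_image .
    have "smooth_on (chart_map c ` chart_dom c) (\<lambda>y. \<Omega> (bundle_chart c) (chart_inv (bundle_chart c) (y, 1)) (v, 0))"
      by (rule smooth_on_compose[where f = "\<lambda>y. (y, 1)" and g = "\<lambda>y. \<Omega> (bundle_chart c) (chart_inv (bundle_chart c) y) (v, 0)", OF o _ _ _ s])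
        (use o in \<open>auto intro!: open_Times smooth_on_Pair[OF o smooth_on_bounded_linear[OF bounded_linear_ident] smooth_on_const]\<close>)
    then show "chart_smooth c (chart_dom c) (\<lambda>x. (base_connection \<Omega>) c x v)"
      unfolding chart_smooth_def base_connection_def
      by (rule smooth_on_cong[OF o]) (simp add: bundle_chart_inv[OF rc])
  qed
qed

lemma base_connection_one_form: "one_form A (base_connection \<Omega>)"
proof (rule one_formI)
  show "chart_form c (chart_dom c) (base_connection \<Omega>)" if "c \<in> A" for c
    by (rule ext_diff_base_connection(2)[OF that])
next
  fix c d x v assume c: "c \<in> A" and d: "d \<in> A" and x: "x \<in> chart_dom c" "x \<in> chart_dom d"
  have "\<Omega> (bundle_chart c) (x, 1) (v, 0) = \<Omega> (bundle_chart d) (x, 1)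
      (\<D> (chart_map (bundle_chart d) \<circ> chart_inv (bundle_chart c)) (chart_map (bundle_chart c) (x, 1)) (v, 0))"
    by (rule form_compatibleD[OF one_formD(2)[OF bundle_coframeD(1)[OF bc]]])
      (use c d x in \<open>simp_all add: bundle_atlas_eq bundle_chart_simps\<close>)
  then show "base_connection \<Omega> c x v = (base_connection \<Omega>) d x (\<D> (chart_map d \<circ> chart_inv c) (chart_map c x) v)"
    unfolding base_connection_def bundle_transition_derivative[OF A c d IntI[OF x] one_neq_zero] by simp
qed

text \<open>These are the equations on the bundle read at (x, 1) on vectors (u, 0) and (v, 0), on
  which dz vanishes.\<close>

lemma base_connection_system:
  assumes c: "c \<in> A"
  shows "base_system c (chart_dom c) \<kappa> \<mu> a (base_connection \<Omega>) k1 k2"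
  unfolding base_system_def
proof (intro ballI allI conjI)
  fix x and u v :: 'e assume x: "x \<in> chart_dom c"
  let ?p = "(x, 1::complex)" and ?u = "(u, 0::complex)" and ?v = "(v, 0::complex)"
  have p: "?p \<in> bundle_dom c" using x by simp
  note t = twist_in_chart[OF c]
  show "ext_diff \<mu> c x u v = ((base_connection \<Omega>) \<and>\<^sub>1 \<mu>) c x u v"
    using bundle_omega1_equation_iff[where \<Omega> = \<Omega> and u = ?u and v = ?v, OF A c \<mu> p] bundle_coframeD(5)[OF bc c p]
    by (simp add: base_connection_def wedge_def)
  show "of_real (a x) * ext_diff \<kappa> c x u v =
       \<i> * of_real (a x) * of_real (a x) * (\<mu> \<and>\<^sub>1 conj_form \<mu>) c x u v +
       (fun_diff (\<lambda>x. of_real (a x)) \<and>\<^sub>1 \<kappa>) c x u v +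
       of_real (a x) * (((base_connection \<Omega>) \<and>\<^sub>1 \<kappa>) c x u v + (conj_form (base_connection \<Omega>) \<and>\<^sub>1 \<kappa>) c x u v)"
    using bundle_omega_equation_iff[where \<Omega> = \<Omega> and u = ?u and v = ?v, OF A c \<kappa> p \<mu> t] bundle_coframeD(4)[OF bc c p]
    by (simp add: base_connection_def wedge_def conj_form_def algebra_simps)
  show "of_real (a x) * ext_diff (base_connection \<Omega>) c x u v = of_real (a x) * of_real (k1 x) * (\<mu> \<and>\<^sub>1 conj_form \<mu>) c x u v +
       k2 x * (\<mu> \<and>\<^sub>1 \<kappa>) c x u v"
    using bundle_Omega_rhs[OF A c \<kappa> \<mu> p, of a k1 ?u ?v k2] t(2)[OF x]
    unfolding ext_diff_base_connection(1)[OF c x] bundle_coframeD(6)[OF bc c p] by simp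
qed

end

text \<open>Converse of the descent: with \<Omega> - dz/z pulled back from the base, the pointwise
  equivalences return the structure equations at every z. Dimension three of the base gives the
  bundle dimension five, the length of the coframe.\<close>

lemma bundle_coframe_of_base_system:
  fixes A :: "('a::{t2_space,second_countable_topology}, 'e::euclidean_space) atlas"
  assumes A: "smooth_atlas A" and \<kappa>: "one_form A \<kappa>" and \<mu>: "one_form A \<mu>" and \<alpha>: "one_form A \<alpha>"
    and dim: "DIM('e) = 3"
    and ind: "\<And>c x. c \<in> A \<Longrightarrow> x \<in> chart_dom c \<Longrightarrow> independent_pair (\<kappa> c x) (\<mu> c x)"
    and a: "smooth_fun A a" "\<And>x. x \<in> points A \<Longrightarrow> a x \<noteq> 0"
    and k: "smooth_fun A k1" "smooth_fun A k2"
    and sys: "\<And>c. c \<in> A \<Longrightarrow> base_system c (chart_dom c) \<kappa> \<mu> a \<alpha> k1 k2"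
  defines "\<Omega> \<equiv> \<lambda>C p v. pullback A fst \<alpha> C p v + snd v / snd p"
  shows "bundle_coframe A \<kappa> \<mu> a \<Omega> k1 k2"
proof -
  have t: "chart_smooth c (chart_dom c) a" "\<And>x. x \<in> chart_dom c \<Longrightarrow> a x \<noteq> 0" if "c \<in> A" for c
    using a(1) a(2)[OF points_memI[OF that]] that unfolding smooth_fun_iff by blast+
  have \<Omega>: "\<Omega> (bundle_chart c) p v = \<alpha> c (fst p) (fst v) + snd v / snd p"
    if "c \<in> A" "p \<in> bundle_dom c" for c p v
    unfolding \<Omega>_def pullback_fst[OF A that(1) one_formD(2)[OF \<alpha>] that(2)] ..
  have log: "fun_diff snd (bundle_chart c) p v / snd p = snd v / snd p"
    if "c \<in> A" "p \<in> bundle_dom c" for c p v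
    by (simp add: fun_diff_snd[OF A that])
  have lf: "chart_form (bundle_chart c) (bundle_dom c) (\<lambda>C p v. fun_diff snd C p v / snd p)" if c: "c \<in> A" for c
    by (rule chart_form_log_diff[OF bundle_nbhd[OF A c] chart_smooth_snd[OF A c]]) auto
  have \<Omega>f: "chart_form (bundle_chart c) (bundle_dom c) \<Omega>" if c: "c \<in> A" for c
    by (rule chart_form_cong[OF bundle_nbhd[OF A c] chart_form_add[OF bundle_nbhd[OF A c] chart_form_pullback_fst[OF A c \<alpha>] lf[OF c]]])
      (simp add: log[OF c] \<Omega>_def)
  have "one_form (bundle_atlas A) \<Omega>"
    unfolding one_form_iff
  proof
    show "\<forall>C\<in>bundle_atlas A. chart_form C (chart_dom C) \<Omega>"
      using \<Omega>f by (simp add: bundle_atlas_eq bundle_chart_simps)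
    show "form_compatible (bundle_atlas A) \<Omega>"
      by (rule form_compatible_bundle[OF A]) (simp add: \<Omega> form_compatibleD[OF one_formD(2)[OF \<alpha>], symmetric])
  qed
  moreover have "coframe (bundle_atlas A) [bundle_omega A \<kappa> a, bundle_omega1 A \<mu>, conj_form (bundle_omega1 A \<mu>), \<Omega>, conj_form \<Omega>]"
    unfolding coframe_def bundle_atlas_eq ball_simps
  proof (intro conjI ballI allI impI)
    fix c p and l :: "nat \<Rightarrow> complex" and i
    assume c: "c \<in> A" and p': "p \<in> chart_dom (bundle_chart c)"
      and 0: "\<forall>v. (\<Sum>i<length [bundle_omega A \<kappa> a, bundle_omega1 A \<mu>, conj_form (bundle_omega1 A \<mu>), \<Omega>, conj_form \<Omega>].
        l i * ([bundle_omega A \<kappa> a, bundle_omega1 A \<mu>, conj_form (bundle_omega1 A \<mu>), \<Omega>, conj_form \<Omega>] ! i) (bundle_chart c) p v) = 0"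
      and i: "i < length [bundle_omega A \<kappa> a, bundle_omega1 A \<mu>, conj_form (bundle_omega1 A \<mu>), \<Omega>, conj_form \<Omega>]"
    obtain x z where p: "p = (x, z)" by (cases p)
    have xz: "x \<in> chart_dom c" "z \<noteq> 0" and pW: "p \<in> bundle_dom c" using p' by (auto simp: p bundle_chart_simps)
    have ax: "a x \<noteq> 0" by (rule t(2)[OF c xz(1)])
    have E: "l 0 * (of_real ((cmod z)\<^sup>2 / a x) * \<kappa> c x v) + l 1 * (z * \<mu> c x v) + l 2 * cnj (z * \<mu> c x v) +
        l 3 * (\<alpha> c x v + w / z) + l 4 * cnj (\<alpha> c x v + w / z) = 0" for v w
      using spec[OF 0, of "(v, w)"]
      by (simp add: eval_nat_numeral conj_form_def p \<Omega>[OF c pW[unfolded p]]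
          bundle_omega_eq[OF A c one_formD(2)[OF \<kappa>] pW[unfolded p]]
          bundle_omega1_eq[OF A c one_formD(2)[OF \<mu>] pW[unfolded p]])
    have lin: "\<alpha> c x 0 = 0" "\<kappa> c x 0 = 0" "\<mu> c x 0 = 0"
      using \<alpha> \<kappa> \<mu> c xz(1) linear_0 unfolding one_form_iff chart_form_def by blast+
    \<comment> \<open>On vertical vectors all forms but \<Omega> and its conjugate vanish. The
      vectors with fibre part z and \<i> * z give dz/z the values 1 and \<i>, which separates the
      two coefficients.\<close>
    have "l 3 + l 4 = 0" "l 3 * \<i> - l 4 * \<i> = 0"
      using E[of 0 z] E[of 0 "\<i> * z"] lin xz(2) by simp_all
    then have l34: "l 3 = 0" "l 4 = 0" by (simp_all add: left_diff_distrib[symmetric])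
    have "(l 0 * of_real ((cmod z)\<^sup>2 / a x)) * \<kappa> c x v + (l 1 * z) * \<mu> c x v + (l 2 * cnj z) * cnj (\<mu> c x v) = 0" for v
      using E[of v 0] by (simp add: l34 mult.assoc)
    note l012 = independent_pairD[OF ind[OF c xz(1)] this]
    have "l 0 = 0" "l 1 = 0" "l 2 = 0" using l012 xz(2) ax by simp_all
    then show "l i = 0" using i l34 by (auto simp: eval_nat_numeral less_Suc_eq)
  qed (simp add: dim)
  moreover have "form2_eq (bundle_atlas A) (ext_diff (bundle_omega A \<kappa> a)) (\<lambda>c y u v.
         \<i> * (bundle_omega1 A \<mu> \<and>\<^sub>1 conj_form (bundle_omega1 A \<mu>)) c y u v +
         ((\<Omega> \<and>\<^sub>1 bundle_omega A \<kappa> a) c y u v + (conj_form \<Omega> \<and>\<^sub>1 bundle_omega A \<kappa> a) c y u v))"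
    unfolding form2_eq_def bundle_atlas_eq ball_simps bundle_chart_simps
  proof (intro ballI allI)
    fix c p u v assume c: "c \<in> A" and p: "p \<in> bundle_dom c"
    have x: "fst p \<in> chart_dom c" using p by auto
    show "ext_diff (bundle_omega A \<kappa> a) (bundle_chart c) p u v =
         \<i> * (bundle_omega1 A \<mu> \<and>\<^sub>1 conj_form (bundle_omega1 A \<mu>)) (bundle_chart c) p u v +
         ((\<Omega> \<and>\<^sub>1 bundle_omega A \<kappa> a) (bundle_chart c) p u v + (conj_form \<Omega> \<and>\<^sub>1 bundle_omega A \<kappa> a) (bundle_chart c) p u v)"
    proof (rule iffD2[OF bundle_omega_equation_iff[OF A c \<kappa> p \<mu> t(1)[OF c]]])
      show "a x \<noteq> 0" if "x \<in> chart_dom c" for x by (rule t(2)[OF c that])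
    qed (simp add: base_systemD(1)[OF sys[OF c] x] \<Omega>[OF c p] wedge_def conj_form_def algebra_simps)
  qed
  moreover have "form2_eq (bundle_atlas A) (ext_diff (bundle_omega1 A \<mu>)) (\<Omega> \<and>\<^sub>1 bundle_omega1 A \<mu>)"
    unfolding form2_eq_def bundle_atlas_eq ball_simps bundle_chart_simps
  proof (intro ballI allI)
    fix c p u v assume c: "c \<in> A" and p: "p \<in> bundle_dom c"
    have x: "fst p \<in> chart_dom c" using p by auto
    show "ext_diff (bundle_omega1 A \<mu>) (bundle_chart c) p u v = (\<Omega> \<and>\<^sub>1 bundle_omega1 A \<mu>) (bundle_chart c) p u v"
      unfolding bundle_omega1_equation_iff[OF A c \<mu> p] base_systemD(2)[OF sys[OF c] x] \<Omega>[OF c p]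
      by (simp add: wedge_def)
  qed
  moreover have "form2_eq (bundle_atlas A) (ext_diff \<Omega>) (\<lambda>c y u v.
         of_real (bundle_K1 k1 y) * (bundle_omega1 A \<mu> \<and>\<^sub>1 conj_form (bundle_omega1 A \<mu>)) c y u v +
         bundle_K2 k2 y * (bundle_omega1 A \<mu> \<and>\<^sub>1 bundle_omega A \<kappa> a) c y u v)"
    unfolding form2_eq_def bundle_atlas_eq ball_simps bundle_chart_simps
  proof (intro ballI allI)
    fix c p u v assume c: "c \<in> A" and p: "p \<in> bundle_dom c"
    have x: "fst p \<in> chart_dom c" using p by auto
    have ax: "a (fst p) \<noteq> 0" by (rule t(2)[OF c x])
    note n = bundle_nbhd[OF A c]
    \<comment> \<open>dz/z is written as the logarithmic differential of the function
      \<open>snd\<close>, so that its closedness applies.\<close>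
    have "ext_diff \<Omega> (bundle_chart c) p u v =
      ext_diff (\<lambda>C p v. pullback A fst \<alpha> C p v + fun_diff snd C p v / snd p) (bundle_chart c) p u v"
      by (rule ext_diff_cong[OF n _ p]) (simp add: log[OF c] \<Omega>_def)
    also have "\<dots> = ext_diff \<alpha> c (fst p) (fst u) (fst v)"
      unfolding ext_diff_add[OF n chart_form_pullback_fst[OF A c \<alpha>] lf[OF c] p] ext_diff_pullback_fst[OF A c \<alpha> p]
      using ext_diff_log_diff[OF n chart_smooth_snd[OF A c] _ p, of u v] by auto
    finally have "of_real (a (fst p)) * ext_diff \<Omega> (bundle_chart c) p u v = of_real (a (fst p)) * (
         of_real (bundle_K1 k1 p) * (bundle_omega1 A \<mu> \<and>\<^sub>1 conj_form (bundle_omega1 A \<mu>)) (bundle_chart c) p u v +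
         bundle_K2 k2 p * (bundle_omega1 A \<mu> \<and>\<^sub>1 bundle_omega A \<kappa> a) (bundle_chart c) p u v)"
      unfolding bundle_Omega_rhs[where a = a and ?k1.0 = k1 and ?k2.0 = k2, OF A c \<kappa> \<mu> p ax] using base_systemD(3)[OF sys[OF c] x] by simp
    then show "ext_diff \<Omega> (bundle_chart c) p u v =
         of_real (bundle_K1 k1 p) * (bundle_omega1 A \<mu> \<and>\<^sub>1 conj_form (bundle_omega1 A \<mu>)) (bundle_chart c) p u v +
         bundle_K2 k2 p * (bundle_omega1 A \<mu> \<and>\<^sub>1 bundle_omega A \<kappa> a) (bundle_chart c) p u v"
      using ax by simp
  qed
  ultimately show ?thesis unfolding bundle_coframe_def Let_def using k by simp
qed

section \<open>Smooth functions and 1-forms on the whole manifold\<close>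

lemma smooth_funD: "smooth_fun A g \<Longrightarrow> c \<in> A \<Longrightarrow> chart_smooth c (chart_dom c) g"
  unfolding smooth_fun_iff by simp

lemma form_eqD: "form_eq A \<alpha> \<beta> \<Longrightarrow> c \<in> A \<Longrightarrow> x \<in> chart_dom c \<Longrightarrow> \<alpha> c x v = \<beta> c x v"
  unfolding form_eq_on_def by (simp add: points_memI)

lemma form_eqI: "(\<And>c x v. c \<in> A \<Longrightarrow> x \<in> chart_dom c \<Longrightarrow> \<alpha> c x v = \<beta> c x v) \<Longrightarrow> form_eq A \<alpha> \<beta>"
  unfolding form_eq_on_def by simp

lemma one_form_cong:
  assumes "smooth_atlas A" "one_form A \<alpha>" "form_eq A \<alpha> \<beta>"
  shows "one_form A \<beta>"
proof (rule one_formI)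
  show "chart_form c (chart_dom c) \<beta>" if c: "c \<in> A" for c
    by (rule chart_form_cong[OF chart_nbhd_dom[OF smooth_atlas_regular[OF assms(1) c]] one_formD(1)[OF assms(2) c]])
      (rule form_eqD[OF assms(3) c])
qed (simp add: form_eqD[OF assms(3), symmetric], rule form_compatibleD[OF one_formD(2)[OF assms(2)]])

context
  fixes A :: "('a::{t2_space,second_countable_topology}, 'e::euclidean_space) atlas"
  assumes A: "smooth_atlas A"
begin

lemma dom_nbhd: "c \<in> A \<Longrightarrow> chart_nbhd c (chart_dom c)"
  by (rule chart_nbhd_dom[OF smooth_atlas_regular[OF A]])

lemma one_form_mult:
  assumes "smooth_fun A g" "one_form A \<alpha>" shows "one_form A (\<lambda>c x v. g x * \<alpha> c x v)"
  by (rule one_formI) (simp_all add: chart_form_mult[OF dom_nbhd smooth_funD[OF assms(1)] one_formD(1)[OF assms(2)]]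
      flip: form_compatibleD[OF one_formD(2)[OF assms(2)]])

lemma one_form_add:
  assumes "one_form A \<alpha>" "one_form A \<beta>" shows "one_form A (\<lambda>c x v. \<alpha> c x v + \<beta> c x v)"
  by (rule one_formI) (simp_all add: chart_form_add[OF dom_nbhd assms[THEN one_formD(1)]]
      flip: form_compatibleD[OF one_formD(2)[OF assms(1)]] form_compatibleD[OF one_formD(2)[OF assms(2)]])

lemma one_form_conj:
  assumes "one_form A \<alpha>" shows "one_form A (conj_form \<alpha>)"
  by (rule one_formI) (simp_all add: conj_form_def chart_form_conj[OF dom_nbhd one_formD(1)[OF assms]]
      flip: form_compatibleD[OF one_formD(2)[OF assms]])

lemma smooth_fun_const: "smooth_fun A (\<lambda>x. k)"
  by (simp add: smooth_fun_iff chart_smooth_const[OF dom_nbhd])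

lemma smooth_fun_of_real: "smooth_fun A f \<Longrightarrow> smooth_fun A (\<lambda>x. complex_of_real (f x))"
  by (simp add: smooth_fun_iff chart_smooth_of_real[OF dom_nbhd])

lemma smooth_fun_cnj: "smooth_fun A f \<Longrightarrow> smooth_fun A (\<lambda>x. cnj (f x))"
  by (simp add: smooth_fun_iff chart_smooth_cnj[OF dom_nbhd])

lemma smooth_fun_Re: "smooth_fun A f \<Longrightarrow> smooth_fun A (\<lambda>x. Re (f x))"
  by (simp add: smooth_fun_iff chart_smooth_Re[OF dom_nbhd])

lemma smooth_fun_minus: "smooth_fun A f \<Longrightarrow> smooth_fun A (\<lambda>x. - f x)"
  by (simp add: smooth_fun_iff chart_smooth_minus[OF dom_nbhd])

lemma smooth_fun_add: "smooth_fun A f \<Longrightarrow> smooth_fun A g \<Longrightarrow> smooth_fun A (\<lambda>x. f x + g x)"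
  by (simp add: smooth_fun_iff chart_smooth_add[OF dom_nbhd])

lemma smooth_fun_mult:
  fixes f g :: "'a \<Rightarrow> 'v::real_normed_algebra"
  shows "smooth_fun A f \<Longrightarrow> smooth_fun A g \<Longrightarrow> smooth_fun A (\<lambda>x. f x * g x)"
  by (simp add: smooth_fun_iff chart_smooth_mult[OF dom_nbhd])

lemma smooth_fun_divide:
  fixes f g :: "'a \<Rightarrow> 'v::real_normed_field"
  assumes "smooth_fun A f" "smooth_fun A g" "\<And>x. x \<in> points A \<Longrightarrow> g x \<noteq> 0"
  shows "smooth_fun A (\<lambda>x. f x / g x)"
  unfolding smooth_fun_iff
proof
  fix c assume c: "c \<in> A"
  show "chart_smooth c (chart_dom c) (\<lambda>x. f x / g x)"
    by (rule chart_smooth_divide[OF dom_nbhd[OF c] assms(1,2)[THEN smooth_funD, OF c] assms(3)])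
      (rule points_memI[OF c])
qed

lemma smooth_fun_powr:
  fixes f :: "'a \<Rightarrow> real"
  assumes "smooth_fun A f" "\<And>x. x \<in> points A \<Longrightarrow> f x > 0"
  shows "smooth_fun A (\<lambda>x. f x powr r)"
  unfolding smooth_fun_iff
proof
  fix c assume c: "c \<in> A"
  show "chart_smooth c (chart_dom c) (\<lambda>x. f x powr r)"
    by (rule chart_smooth_powr[OF dom_nbhd[OF c] assms(1)[THEN smooth_funD, OF c] assms(2)])
      (rule points_memI[OF c])
qed

lemma smooth_fun_cong:
  assumes "smooth_fun A f" "\<And>x. x \<in> points A \<Longrightarrow> f x = g x" shows "smooth_fun A g"
  unfolding smooth_fun_iff
proof
  fix c assume c: "c \<in> A"
  show "chart_smooth c (chart_dom c) g"
    by (rule chart_smooth_cong[OF dom_nbhd[OF c] assms(1)[THEN smooth_funD, OF c] assms(2)])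
      (rule points_memI[OF c])
qed

lemma one_form_fun_diff:
  assumes "smooth_fun A g" shows "one_form A (fun_diff g)"
proof (rule one_formI)
  show "chart_form c (chart_dom c) (fun_diff g)" if c: "c \<in> A" for c
    by (rule chart_form_fun_diff[OF dom_nbhd[OF c] smooth_funD[OF assms c]])
next
  fix c d x v assume c: "c \<in> A" and d: "d \<in> A" and xc: "x \<in> chart_dom c" and xd: "x \<in> chart_dom d"
  let ?T = "chart_map d \<circ> chart_inv c"
  note tr = smooth_atlas_transition[OF A c d]
  have cx: "chart_inv c (chart_map c x) = x" by (rule chart_nbhd_inv_map[OF dom_nbhd[OF c] xc])
  have xI: "chart_map c x \<in> chart_map c ` (chart_dom c \<inter> chart_dom d)" using xc xd by blast
  have T: "(?T has_derivative frechet_derivative ?T (at (chart_map c x))) (at (chart_map c x))"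
    by (rule smooth_on_has_derivative[OF tr(1) xI])
  have g: "((\<lambda>y. g (chart_inv d y)) has_derivative fun_diff g d x) (at (?T (chart_map c x)))"
    using fun_diff_has_derivative[OF dom_nbhd[OF d] smooth_funD[OF assms d] xd] by (simp add: cx)
  have "((\<lambda>y. g (chart_inv d (?T y))) has_derivative (\<lambda>v. fun_diff g d x (frechet_derivative ?T (at (chart_map c x)) v)))
      (at (chart_map c x))"
    by (rule has_derivative_compose[OF T g])
  then have "((\<lambda>y. g (chart_inv c y)) has_derivative (\<lambda>v. fun_diff g d x (frechet_derivative ?T (at (chart_map c x)) v)))
      (at (chart_map c x))"
  proof (rule has_derivative_transform_within_open[OF _ chart_nbhd_open_image[OF tr(2)] xI])
    fix y assume "y \<in> chart_map c ` (chart_dom c \<inter> chart_dom d)"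
    then have "chart_inv c y \<in> chart_dom d" using chart_nbhd_inv(1)[OF tr(2)] by blast
    then show "g (chart_inv d (?T y)) = g (chart_inv c y)"
      using chart_nbhd_inv_map[OF dom_nbhd[OF d]] by simp
  qed
  then show "fun_diff g c x v = fun_diff g d x (frechet_derivative ?T (at (chart_map c x)) v)"
    by (rule fun_diff_eqI[OF dom_nbhd[OF c]])
qed

end

subsection \<open>Coefficients with respect to a coframe in dimension three\<close>

lemma linear_expand_3:
  fixes f :: "real ^ 3 \<Rightarrow> complex"
  assumes "linear f"
  shows "f v = of_real (v $ 1) * f (axis 1 1) + of_real (v $ 2) * f (axis 2 1) + of_real (v $ 3) * f (axis 3 1)"
proof -
  have "v = (v $ 1) *\<^sub>R axis 1 1 + (v $ 2) *\<^sub>R axis 2 1 + (v $ 3) *\<^sub>R axis 3 1"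
    by (simp add: vec_eq_iff forall_3 axis_def)
  then have "f v = f ((v $ 1) *\<^sub>R axis 1 1 + (v $ 2) *\<^sub>R axis 2 1 + (v $ 3) *\<^sub>R axis 3 1)" by simp
  also have "\<dots> = of_real (v $ 1) * f (axis 1 1) + of_real (v $ 2) * f (axis 2 1) + of_real (v $ 3) * f (axis 3 1)"
    unfolding linear_add[OF assms] linear_cmul[OF assms] by (simp add: scaleR_conv_of_real)
  finally show ?thesis .
qed

text \<open>The determinant of three covectors, that is the value of their wedge product on the
  standard basis.\<close>

definition vol3 :: "(real ^ 3 \<Rightarrow> complex) \<Rightarrow> (real ^ 3 \<Rightarrow> complex) \<Rightarrow> (real ^ 3 \<Rightarrow> complex) \<Rightarrow> complex" where
  "vol3 f g h =
     f (axis 1 1) * (g (axis 2 1) * h (axis 3 1) - g (axis 3 1) * h (axis 2 1)) +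
     f (axis 2 1) * (g (axis 3 1) * h (axis 1 1) - g (axis 1 1) * h (axis 3 1)) +
     f (axis 3 1) * (g (axis 1 1) * h (axis 2 1) - g (axis 2 1) * h (axis 1 1))"

text \<open>The 3-form at u, v, w is the determinant of these vectors times its value on the
  standard basis; by independence it is nonzero somewhere.\<close>

lemma vol3_nonzero:
  assumes "linear f" "linear g" "independent_pair f g"
  shows "vol3 f g (\<lambda>v. cnj (g v)) \<noteq> 0"
proof
  assume 0: "vol3 f g (\<lambda>v. cnj (g v)) = 0"
  \<comment> \<open>Dummy charts and points over the type unit turn the two covectors into forms, to
    which the equivalence with nonzero volume applies.\<close>
  let ?\<kappa> = "\<lambda>(c :: (unit, real ^ 3) chart) (x::unit). f" and ?\<mu> = "\<lambda>(c :: (unit, real ^ 3) chart) (x::unit). g"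
  obtain u v w where uvw: "(?\<kappa> \<and>\<^sub>1 ?\<mu> \<and>\<^sub>2 conj_form ?\<mu>) undefined () u v w \<noteq> 0"
    using independent_pair_iff_volume[of ?\<kappa> undefined "()" ?\<mu>] assms(3) by auto
  define D where "D = u $ 1 * (v $ 2 * w $ 3 - v $ 3 * w $ 2) + u $ 2 * (v $ 3 * w $ 1 - v $ 1 * w $ 3) +
    u $ 3 * (v $ 1 * w $ 2 - v $ 2 * w $ 1)"
  have "(?\<kappa> \<and>\<^sub>1 ?\<mu> \<and>\<^sub>2 conj_form ?\<mu>) undefined () u v w = of_real D * vol3 f g (\<lambda>v. cnj (g v))"
    unfolding wedge21_def wedge_def conj_form_def vol3_def D_def
      linear_expand_3[OF assms(1), of u] linear_expand_3[OF assms(1), of v] linear_expand_3[OF assms(1), of w]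
      linear_expand_3[OF assms(2), of u] linear_expand_3[OF assms(2), of v] linear_expand_3[OF assms(2), of w]
      complex_cnj_add complex_cnj_mult complex_cnj_complex_of_real of_real_add of_real_mult of_real_diff
    by algebra
  then show False using 0 uvw by simp
qed

text \<open>By linearity it is enough to look at the standard basis, where the identity says that a
  4 by 4 determinant with a repeated column vanishes.\<close>

lemma cramer_3:
  assumes "linear f" "linear g" "linear a" "vol3 f g (\<lambda>v. cnj (g v)) \<noteq> 0"
  defines "V \<equiv> vol3 f g (\<lambda>v. cnj (g v))"
  shows "a v = vol3 f a (\<lambda>v. cnj (g v)) / V * g v + vol3 f g a / V * cnj (g v) + vol3 a g (\<lambda>v. cnj (g v)) / V * f v"
proof -
  define b where "b v = vol3 f a (\<lambda>v. cnj (g v)) * g v + vol3 f g a * cnj (g v) + vol3 a g (\<lambda>v. cnj (g v)) * f v" for v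
  have E: "V * a (axis 1 1) = b (axis 1 1)" "V * a (axis 2 1) = b (axis 2 1)" "V * a (axis 3 1) = b (axis 3 1)"
    unfolding V_def vol3_def b_def by (simp_all add: algebra_simps)
  have "V * a v = of_real (v $ 1) * (V * a (axis 1 1)) + of_real (v $ 2) * (V * a (axis 2 1)) + of_real (v $ 3) * (V * a (axis 3 1))"
    unfolding linear_expand_3[OF assms(3), of v] by (simp add: algebra_simps)
  also have "\<dots> = vol3 f a (\<lambda>v. cnj (g v)) * g v + vol3 f g a * cnj (g v) + vol3 a g (\<lambda>v. cnj (g v)) * f v"
    unfolding E linear_expand_3[OF assms(1), of v] linear_expand_3[OF assms(2), of v] b_def
    by (simp add: algebra_simps)
  finally show ?thesis using assms(4)[folded V_def] by (simp add: field_simps)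
qed

text \<open>Cramer's rule gives coefficients in each chart. Coefficients in a basis are unique and
  the forms are compatible, so the local ones agree on overlaps and define functions on the
  manifold, whose smoothness is read off in each chart separately.\<close>

lemma one_form_coefficients:
  fixes A :: "('a::{t2_space,second_countable_topology}, real ^ 3) atlas"
  assumes A: "smooth_atlas A" and \<omega>: "one_form A \<omega>" and \<omega>1: "one_form A \<omega>1" and \<alpha>: "one_form A \<alpha>"
    and ind: "\<And>c x. c \<in> A \<Longrightarrow> x \<in> chart_dom c \<Longrightarrow> independent_pair (\<omega> c x) (\<omega>1 c x)"
  obtains X Y Z :: "'a \<Rightarrow> complex" where "smooth_fun A X" "smooth_fun A Y" "smooth_fun A Z"
    "\<And>c x v. c \<in> A \<Longrightarrow> x \<in> chart_dom c \<Longrightarrow> \<alpha> c x v = X x * \<omega>1 c x v + Y x * cnj (\<omega>1 c x v) + Z x * \<omega> c x v"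
proof -
  define V where "V c x = vol3 (\<omega> c x) (\<omega>1 c x) (\<lambda>v. cnj (\<omega>1 c x v))" for c x
  define Xc where "Xc c x = vol3 (\<omega> c x) (\<alpha> c x) (\<lambda>v. cnj (\<omega>1 c x v)) / V c x" for c x
  define Yc where "Yc c x = vol3 (\<omega> c x) (\<omega>1 c x) (\<alpha> c x) / V c x" for c x
  define Zc where "Zc c x = vol3 (\<alpha> c x) (\<omega>1 c x) (\<lambda>v. cnj (\<omega>1 c x v)) / V c x" for c x
  have lin: "linear (\<omega> c x)" "linear (\<omega>1 c x)" "linear (\<alpha> c x)" if "c \<in> A" "x \<in> chart_dom c" for c x
    using one_formD(1)[OF \<omega> that(1)] one_formD(1)[OF \<omega>1 that(1)] one_formD(1)[OF \<alpha> that(1)] that(2)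
    unfolding chart_form_def by blast+
  have V: "V c x \<noteq> 0" if "c \<in> A" "x \<in> chart_dom c" for c x
    unfolding V_def by (rule vol3_nonzero[OF lin(1,2)[OF that] ind[OF that]])
  have dec: "\<alpha> c x v = Xc c x * \<omega>1 c x v + Yc c x * cnj (\<omega>1 c x v) + Zc c x * \<omega> c x v"
    if "c \<in> A" "x \<in> chart_dom c" for c x v
    unfolding Xc_def Yc_def Zc_def V_def by (rule cramer_3[OF lin[OF that] V[OF that, unfolded V_def]])
  \<comment> \<open>The chosen chart may jump with x, so the definitions of X, Y, Z show no
    smoothness; \<open>eq\<close> transfers it from the coefficients in a fixed chart.\<close>
  define C where "C x = (SOME c. c \<in> A \<and> x \<in> chart_dom c)" for x
  have C: "C x \<in> A" "x \<in> chart_dom (C x)" if "c \<in> A" "x \<in> chart_dom c" for c x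
    using someI[of "\<lambda>c. c \<in> A \<and> x \<in> chart_dom c" c] that unfolding C_def by simp_all
  define X where "X x = Xc (C x) x" for x
  define Y where "Y x = Yc (C x) x" for x
  define Z where "Z x = Zc (C x) x" for x
  have D: "\<alpha> c x v = X x * \<omega>1 c x v + Y x * cnj (\<omega>1 c x v) + Z x * \<omega> c x v"
    if c: "c \<in> A" and x: "x \<in> chart_dom c" for c x v
  proof -
    note cd = form_compatibleD[OF _ c C(1)[OF c x] x C(2)[OF c x], of _ v]
    show ?thesis
      unfolding cd[OF one_formD(2)[OF \<alpha>]] cd[OF one_formD(2)[OF \<omega>]] cd[OF one_formD(2)[OF \<omega>1]] X_def Y_def Z_def
      by (rule dec[OF C[OF c x]])
  qed
  have eq: "Xc c x = X x" "Yc c x = Y x" "Zc c x = Z x" if c: "c \<in> A" "x \<in> chart_dom c" for c x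
  proof -
    have "(Zc c x - Z x) * \<omega> c x v + (Xc c x - X x) * \<omega>1 c x v + (Yc c x - Y x) * cnj (\<omega>1 c x v) = 0" for v
      using dec[OF that, of v] D[OF that, of v] by (simp add: algebra_simps)
    note independent_pairD[OF ind[OF that] this]
    then show "Xc c x = X x" "Yc c x = Y x" "Zc c x = Z x" by simp_all
  qed
  have sm: "chart_smooth c (chart_dom c) (Xc c)" "chart_smooth c (chart_dom c) (Yc c)" "chart_smooth c (chart_dom c) (Zc c)"
    if c: "c \<in> A" for c
  proof -
    note n = dom_nbhd[OF A c]
    note s = chart_form_smooth[OF n one_formD(1)[OF \<omega> c]] chart_form_smooth[OF n one_formD(1)[OF \<omega>1 c]]
      chart_form_smooth[OF n one_formD(1)[OF \<alpha> c]]
    have sV: "chart_smooth c (chart_dom c) (V c)"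
      unfolding V_def[abs_def] vol3_def
      by (intro chart_smooth_add[OF n] chart_smooth_diff[OF n] chart_smooth_mult[OF n] chart_smooth_cnj[OF n] s)
    show "chart_smooth c (chart_dom c) (Xc c)" "chart_smooth c (chart_dom c) (Yc c)" "chart_smooth c (chart_dom c) (Zc c)"
      unfolding Xc_def[abs_def] Yc_def[abs_def] Zc_def[abs_def] vol3_def
      by (intro chart_smooth_divide[OF n _ sV] chart_smooth_add[OF n] chart_smooth_diff[OF n] chart_smooth_mult[OF n]
          chart_smooth_cnj[OF n] s V[OF c]; assumption)+
  qed
  show ?thesis
  proof (rule that[OF _ _ _ D])
    show "smooth_fun A X" "smooth_fun A Y" "smooth_fun A Z"
      unfolding smooth_fun_iff using chart_smooth_cong[OF dom_nbhd[OF A] sm(1) eq(1)]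
        chart_smooth_cong[OF dom_nbhd[OF A] sm(2) eq(2)] chart_smooth_cong[OF dom_nbhd[OF A] sm(3) eq(3)] by blast+
  qed
qed

subsection \<open>Normalized coframes\<close>

definition normal_coframe ::
  "('a::topological_space, 'e::euclidean_space) atlas \<Rightarrow> ('a, 'e) form1 \<Rightarrow> ('a, 'e) form1 \<Rightarrow> ('a, 'e) form1 \<Rightarrow>
   ('a \<Rightarrow> real) \<Rightarrow> bool" where
  "normal_coframe A \<omega> \<omega>1 \<alpha> K1 \<longleftrightarrow>
     one_form A \<omega> \<and> real_form A \<omega> \<and> one_form A \<omega>1 \<and> one_form A \<alpha> \<and> smooth_fun A K1 \<and>
     (\<forall>c\<in>A. \<forall>x\<in>chart_dom c. independent_pair (\<omega> c x) (\<omega>1 c x)) \<and>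
     (\<forall>c\<in>A. normal_system c (chart_dom c) \<omega> \<omega>1 \<alpha> K1)"

lemma normal_coframeD:
  assumes "normal_coframe A \<omega> \<omega>1 \<alpha> K1"
  shows "one_form A \<omega>" "real_form A \<omega>" "one_form A \<omega>1" "one_form A \<alpha>" "smooth_fun A K1"
    "c \<in> A \<Longrightarrow> x \<in> chart_dom c \<Longrightarrow> independent_pair (\<omega> c x) (\<omega>1 c x)"
    "c \<in> A \<Longrightarrow> normal_system c (chart_dom c) \<omega> \<omega>1 \<alpha> K1"
  using assms unfolding normal_coframe_def by simp_all

lemma congruence_pair_iff:
  "congruence_pair A \<kappa> \<mu> \<longleftrightarrow> one_form A \<kappa> \<and> real_form A \<kappa> \<and> one_form A \<mu> \<and>
     (\<forall>c\<in>A. \<forall>x\<in>chart_dom c. independent_pair (\<kappa> c x) (\<mu> c x))"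
  unfolding congruence_pair_def independent_pair_iff_volume by (rule refl)

lemma coframe_iff:
  fixes A :: "('a, 'e::euclidean_space) atlas"
  assumes "DIM('e) = 3"
  shows "coframe A [\<omega>, \<omega>1, conj_form \<omega>1] \<longleftrightarrow> (\<forall>c\<in>A. \<forall>x\<in>chart_dom c. independent_pair (\<omega> c x) (\<omega>1 c x))"
proof -
  have "(\<forall>k. (\<forall>v. (\<Sum>i<length [\<omega>, \<omega>1, conj_form \<omega>1]. k i * ([\<omega>, \<omega>1, conj_form \<omega>1] ! i) c x v) = 0) \<longrightarrow>
      (\<forall>i<length [\<omega>, \<omega>1, conj_form \<omega>1]. k i = (0::complex))) \<longleftrightarrow> independent_pair (\<omega> c x) (\<omega>1 c x)"
    (is "?L \<longleftrightarrow> _") for c x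
  proof
    assume L: ?L
    show "independent_pair (\<omega> c x) (\<omega>1 c x)"
      unfolding independent_pair_def
    proof (intro allI impI)
      fix l0 l1 l2 assume 0: "\<forall>v. l0 * \<omega> c x v + l1 * \<omega>1 c x v + l2 * cnj (\<omega>1 c x v) = 0"
      define k where "k i = (if i = 0 then l0 else if i = 1 then l1 else l2)" for i :: nat
      have "\<forall>v. (\<Sum>i<length [\<omega>, \<omega>1, conj_form \<omega>1]. k i * ([\<omega>, \<omega>1, conj_form \<omega>1] ! i) c x v) = 0"
        using 0 by (simp add: eval_nat_numeral k_def conj_form_def)
      from mp[OF spec[OF L] this] have "k 0 = 0" "k 1 = 0" "k 2 = 0" by simp_all
      then show "l0 = 0 \<and> l1 = 0 \<and> l2 = 0" by (simp add: k_def)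
    qed
  next
    assume ind: "independent_pair (\<omega> c x) (\<omega>1 c x)"
    show ?L
    proof (intro allI impI)
      fix k :: "nat \<Rightarrow> complex" and i
      assume 0: "\<forall>v. (\<Sum>i<length [\<omega>, \<omega>1, conj_form \<omega>1]. k i * ([\<omega>, \<omega>1, conj_form \<omega>1] ! i) c x v) = 0"
        and i: "i < length [\<omega>, \<omega>1, conj_form \<omega>1]"
      have "k 0 * \<omega> c x v + k 1 * \<omega>1 c x v + k 2 * cnj (\<omega>1 c x v) = 0" for v
        using spec[OF 0, of v] by (simp add: eval_nat_numeral conj_form_def)
      note independent_pairD[OF ind this]
      then show "k i = 0" using i by (auto simp: eval_nat_numeral less_Suc_eq)
    qed
  qed
  then show ?thesis unfolding coframe_def using assms by simp
qed

lemma normal_system_cong: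
  assumes W: "chart_nbhd c W" and sys: "normal_system c W \<omega> \<omega>1 \<alpha> K"
    and eq: "\<And>x v. x \<in> W \<Longrightarrow> \<omega> c x v = \<omega>' c x v" "\<And>x v. x \<in> W \<Longrightarrow> \<omega>1 c x v = \<omega>1' c x v"
      "\<And>x v. x \<in> W \<Longrightarrow> \<alpha> c x v = \<alpha>' c x v" "\<And>x. x \<in> W \<Longrightarrow> K x = K' x"
  shows "normal_system c W \<omega>' \<omega>1' \<alpha>' K'"
  unfolding normal_system_def
proof (intro ballI allI conjI)
  fix x u v assume x: "x \<in> W"
  have e: "ext_diff \<omega>' c x u v = ext_diff \<omega> c x u v" "ext_diff \<omega>1' c x u v = ext_diff \<omega>1 c x u v"
    "ext_diff \<alpha>' c x u v = ext_diff \<alpha> c x u v"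
    by (rule ext_diff_cong[OF W _ x], rule eq[symmetric], assumption)+
  show "ext_diff \<omega>' c x u v = \<i> * (\<omega>1' \<and>\<^sub>1 conj_form \<omega>1') c x u v +
       ((\<alpha>' \<and>\<^sub>1 \<omega>') c x u v + (conj_form \<alpha>' \<and>\<^sub>1 \<omega>') c x u v)"
    "ext_diff \<omega>1' c x u v = (\<alpha>' \<and>\<^sub>1 \<omega>1') c x u v"
    "ext_diff \<alpha>' c x u v = of_real (K' x) * (\<omega>1' \<and>\<^sub>1 conj_form \<omega>1') c x u v + (\<omega>1' \<and>\<^sub>1 \<omega>') c x u v"
    unfolding e normal_systemD[OF sys x] wedge_def conj_form_def
    by (simp_all add: eq[OF x])
qed

lemma real_form_mult:
  assumes "real_form A \<kappa>" "form_eq A \<omega> (\<lambda>c x v. of_real (f x) * \<kappa> c x v)"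
  shows "real_form A \<omega>"
  using assms(1) unfolding real_form_def by (simp add: form_eqD[OF assms(2)])

text \<open>\<open>Arg\<close> is discontinuous on the negative real axis, so smoothness of h cannot
  be seen from \<open>rcis\<close>. The quotient by |k|^(2/3), written as the power 1/3 of
  \<open>Re (k * cnj k)\<close>, is built from functions that are smooth for nonzero k.\<close>

lemma normal_section_eq:
  fixes k :: complex
  assumes "k \<noteq> 0"
  defines "h \<equiv> rcis (cmod k powr (1/3)) (Arg k)"
  shows "h = k / of_real ((Re (k * cnj k)) powr (1/3))" "h * (h * cnj h) = k" "h \<noteq> 0"
proof -
  define r where "r = cmod k powr (1/3)"
  have r: "r > 0" "r ^ 3 = cmod k"
    using assms(1) by (simp_all add: r_def powr_powr flip: powr_realpow)
  have h: "h = of_real r * cis (Arg k)" by (simp add: h_def r_def rcis_def)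
  have k: "k = of_real (r ^ 3) * cis (Arg k)"
    using rcis_cmod_Arg[of k] r by (simp add: rcis_def)
  have "Re (k * cnj k) = cmod k * cmod k" by (simp add: cmod_power2 flip: power2_eq_square)
  then have "(Re (k * cnj k)) powr (1/3) = r * r"
    using assms(1) by (simp add: powr_mult r_def)
  moreover have "k / of_real (r * r) = h"
    using r(1) by (subst k) (simp add: h power3_eq_cube)
  ultimately show "h = k / of_real ((Re (k * cnj k)) powr (1/3))" by simp
  have "cis (Arg k) * cnj (cis (Arg k)) = 1" by (simp add: cis_cnj cis_mult)
  then have "h * (h * cnj h) = of_real (r * r * r) * cis (Arg k)"
    unfolding h by (simp add: algebra_simps)
  then show "h * (h * cnj h) = k" using k by (simp add: power3_eq_cube)
  show "h \<noteq> 0" using h r(1) by simp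
qed

lemma independent_pair_smult:
  assumes "independent_pair \<kappa> \<mu>" "f \<noteq> 0" "h \<noteq> (0::complex)"
    "\<And>v. \<kappa>' v = f * \<kappa> v" "\<And>v. \<mu>' v = h * \<mu> v"
  shows "independent_pair \<kappa>' \<mu>'"
  unfolding independent_pair_def
proof (intro allI impI)
  fix l0 l1 l2 assume 0: "\<forall>v. l0 * \<kappa>' v + l1 * \<mu>' v + l2 * cnj (\<mu>' v) = 0"
  have "(l0 * f) * \<kappa> v + (l1 * h) * \<mu> v + (l2 * cnj h) * cnj (\<mu> v) = 0" for v
    using spec[OF 0, of v] by (simp add: assms(4,5) algebra_simps)
  note independent_pairD[OF assms(1) this]
  then show "l0 = 0 \<and> l1 = 0 \<and> l2 = 0" using assms(2,3) by simp
qed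

definition proportional ::
  "('a, 'e::euclidean_space) atlas \<Rightarrow> ('a, 'e) form1 \<Rightarrow> ('a, 'e) form1 \<Rightarrow> ('a, 'e) form1 \<Rightarrow> ('a, 'e) form1 \<Rightarrow>
   ('a \<Rightarrow> real) \<Rightarrow> ('a \<Rightarrow> complex) \<Rightarrow> bool" where
  "proportional A \<kappa> \<mu> \<kappa>' \<mu>' f h \<longleftrightarrow> smooth_fun A f \<and> smooth_fun A h \<and> (\<forall>x\<in>points A. f x \<noteq> 0 \<and> h x \<noteq> 0) \<and>
     form_eq A \<kappa>' (\<lambda>c x v. of_real (f x) * \<kappa> c x v) \<and> form_eq A \<mu>' (\<lambda>c x v. h x * \<mu> c x v)"

lemma congruence_class_iff:
  "(\<kappa>', \<mu>') \<in> congruence_class A \<kappa> \<mu> \<longleftrightarrow> congruence_pair A \<kappa>' \<mu>' \<and> (\<exists>f h. proportional A \<kappa> \<mu> \<kappa>' \<mu>' f h)"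
  unfolding congruence_class_def proportional_def by simp

lemma proportionalD:
  assumes "proportional A \<kappa> \<mu> \<kappa>' \<mu>' f h"
  shows "smooth_fun A f" "smooth_fun A h" "x \<in> points A \<Longrightarrow> f x \<noteq> 0" "x \<in> points A \<Longrightarrow> h x \<noteq> 0"
    "c \<in> A \<Longrightarrow> x \<in> chart_dom c \<Longrightarrow> \<kappa>' c x v = of_real (f x) * \<kappa> c x v"
    "c \<in> A \<Longrightarrow> x \<in> chart_dom c \<Longrightarrow> \<mu>' c x v = h x * \<mu> c x v"
  using assms unfolding proportional_def by (auto dest: form_eqD)

context
  fixes A :: "('a::{t2_space,second_countable_topology}, 'e::euclidean_space) atlas"
  assumes A: "smooth_atlas A"
begin

lemma proportional_trans:
  assumes "proportional A \<kappa> \<mu> \<kappa>' \<mu>' f h" "proportional A \<kappa>' \<mu>' \<kappa>'' \<mu>'' g k"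
  shows "proportional A \<kappa> \<mu> \<kappa>'' \<mu>'' (\<lambda>x. g x * f x) (\<lambda>x. k x * h x)"
  unfolding proportional_def
proof (intro conjI ballI form_eqI)
  show "smooth_fun A (\<lambda>x. g x * f x)" "smooth_fun A (\<lambda>x. k x * h x)"
    by (rule smooth_fun_mult[OF A] proportionalD(1,2)[OF assms(1)] proportionalD(1,2)[OF assms(2)])+
qed (simp_all add: proportionalD[OF assms(1)] proportionalD[OF assms(2)])

lemma proportional_ratio:
  assumes "proportional A \<kappa> \<mu> \<kappa>' \<mu>' f h" "proportional A \<kappa> \<mu> \<kappa>'' \<mu>'' g k"
  shows "proportional A \<kappa>' \<mu>' \<kappa>'' \<mu>'' (\<lambda>x. g x / f x) (\<lambda>x. k x / h x)"
  unfolding proportional_def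
proof (intro conjI ballI form_eqI)
  note D = proportionalD[OF assms(1)] and E = proportionalD[OF assms(2)]
  show "smooth_fun A (\<lambda>x. g x / f x)" by (rule smooth_fun_divide[OF A E(1) D(1,3)])
  show "smooth_fun A (\<lambda>x. k x / h x)" by (rule smooth_fun_divide[OF A E(2) D(2,4)])
  show "g x / f x \<noteq> 0" "k x / h x \<noteq> 0" if "x \<in> points A" for x
    using D(3,4)[OF that] E(3,4)[OF that] by simp_all
  show "\<kappa>'' c x v = of_real (g x / f x) * \<kappa>' c x v" "\<mu>'' c x v = k x / h x * \<mu>' c x v"
    if "c \<in> A" "x \<in> chart_dom c" for c x v
    using D(3,4)[OF points_memI[OF that]] by (simp_all add: D(5,6)[OF that] E(5,6)[OF that])
qed

text \<open>On the graph of h the three forms of the bundle pull back to |h|^2/a times \<kappa>, to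
  h \<mu> and to \<alpha> + dh/h, so \<open>normal_system_normalization\<close> applies. The forms
  \<omega> and \<omega>1 are tied to the pullbacks by \<open>form_eq\<close> alone, as in
  \<open>invariant_coframe\<close>.\<close>

lemma normal_coframe_of_admissible:
  fixes \<kappa> \<mu> \<omega> \<omega>1 :: "('a, 'e) form1"
  assumes pair: "congruence_pair A \<kappa> \<mu>" and adm: "admissible_pair A \<kappa> \<mu> a \<Omega> k1 k2"
  defines "P \<equiv> bundle_atlas A" and "\<sigma> \<equiv> normal_section k2"
  assumes \<omega>: "form_eq A \<omega> (pullback P \<sigma> (bundle_omega A \<kappa> a))"
    and \<omega>1: "form_eq A \<omega>1 (pullback P \<sigma> (bundle_omega1 A \<mu>))"
    and K: "\<And>x. x \<in> points A \<Longrightarrow> K1 x = bundle_K1 k1 (\<sigma> x)"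
  shows "normal_coframe A \<omega> \<omega>1 (pullback P \<sigma> \<Omega>) K1" "\<exists>f h. proportional A \<kappa> \<mu> \<omega> \<omega>1 f h"
proof -
  have \<kappa>: "one_form A \<kappa>" "real_form A \<kappa>" and \<mu>: "one_form A \<mu>"
    and ind: "\<And>c x. c \<in> A \<Longrightarrow> x \<in> chart_dom c \<Longrightarrow> independent_pair (\<kappa> c x) (\<mu> c x)"
    using pair unfolding congruence_pair_iff by simp_all
  have a: "smooth_fun A a" "\<And>x. x \<in> points A \<Longrightarrow> a x \<noteq> 0" and bc: "bundle_coframe A \<kappa> \<mu> a \<Omega> k1 k2"
    and K2: "\<And>y. y \<in> points (bundle_atlas A) \<Longrightarrow> bundle_K2 k2 y \<noteq> 0"
    using adm unfolding admissible_pair_def structure_functions_def by auto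
  define h where "h x = rcis (cmod (k2 x) powr (1/3)) (Arg (k2 x))" for x
  have \<sigma>: "\<sigma> = (\<lambda>x. (x, h x))" by (simp add: \<sigma>_def h_def normal_section_def fun_eq_iff)
  \<comment> \<open>The hypothesis concerns K2 on the bundle; at (x, 1) its value is k2 x, since
    \<open>Arg 1 = 0\<close>.\<close>
  have k2: "k2 x \<noteq> 0" if "x \<in> points A" for x
    using K2[of "(x, 1)"] that by (simp add: points_bundle_atlas bundle_K2_def)
  have h0: "h x \<noteq> 0" and hk: "k2 x = h x * (h x * cnj (h x))"
    and heq: "k2 x / of_real ((Re (k2 x * cnj (k2 x))) powr (1/3)) = h x" if "x \<in> points A" for x
    using normal_section_eq[OF k2[OF that]] unfolding h_def by simp_all
  have pos: "Re (k2 x * cnj (k2 x)) > 0" if "x \<in> points A" for x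
    using k2[OF that] by (simp add: complex_norm_square[symmetric] flip: of_real_power)
  note sk = bundle_coframeD(2,3)[OF bc]
  have sh: "smooth_fun A h"
    by (rule smooth_fun_cong[OF A _ heq], rule smooth_fun_divide[OF A sk(2)],
        rule smooth_fun_of_real[OF A], rule smooth_fun_powr[OF A],
        rule smooth_fun_Re[OF A], rule smooth_fun_mult[OF A sk(2)], rule smooth_fun_cnj[OF A sk(2)])
      (use pos in force)+
  have shc: "chart_smooth c (chart_dom c) h" "\<And>x. x \<in> chart_dom c \<Longrightarrow> h x \<noteq> 0" if "c \<in> A" for c
    using smooth_funD[OF sh that] h0[OF points_memI[OF that]] by simp_all
  have ps: "pullback P \<sigma> \<Psi> c x v = \<Psi> (bundle_chart c) (x, h x) (v, fun_diff h c x v)"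
    if c: "c \<in> A" and x: "x \<in> chart_dom c" and \<Psi>: "form_compatible (bundle_atlas A) \<Psi>" for \<Psi> c x v
    unfolding P_def \<sigma> by (rule pullback_section[OF A c shc(1)[OF c] shc(2)[OF c] \<Psi> x])
  have K': "K1 x = k1 x / (cmod (h x))\<^sup>2" if "x \<in> points A" for x
    by (simp add: K[OF that] \<sigma> bundle_K1_def)
  define \<alpha> where "\<alpha> = base_connection \<Omega>"
  have \<alpha>: "one_form A \<alpha>" unfolding \<alpha>_def by (rule base_connection_one_form[OF A \<kappa>(1) \<mu> ind a bc])
  have pw: "pullback P \<sigma> (bundle_omega A \<kappa> a) c x v = of_real ((cmod (h x))\<^sup>2 / a x) * \<kappa> c x v"
    "pullback P \<sigma> (bundle_omega1 A \<mu>) c x v = h x * \<mu> c x v"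
    "pullback P \<sigma> \<Omega> c x v = \<alpha> c x v + fun_diff h c x v / h x" if c: "c \<in> A" and x: "x \<in> chart_dom c" for c x v
  proof -
    have hx: "h x \<noteq> 0" by (rule h0[OF points_memI[OF c x]])
    have p: "(x, h x) \<in> bundle_dom c" using x hx by simp
    show "pullback P \<sigma> (bundle_omega A \<kappa> a) c x v = of_real ((cmod (h x))\<^sup>2 / a x) * \<kappa> c x v"
      using ps[OF c x form_compatible_bundle_omega[OF A one_formD(2)[OF \<kappa>(1)]]]
        bundle_omega_eq[OF A c one_formD(2)[OF \<kappa>(1)] p] by simp
    show "pullback P \<sigma> (bundle_omega1 A \<mu>) c x v = h x * \<mu> c x v"
      using ps[OF c x form_compatible_bundle_omega1[OF A one_formD(2)[OF \<mu>]]]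
        bundle_omega1_eq[OF A c one_formD(2)[OF \<mu>] p] by simp
    show "pullback P \<sigma> \<Omega> c x v = \<alpha> c x v + fun_diff h c x v / h x"
      using ps[OF c x one_formD(2)[OF bundle_coframeD(1)[OF bc]]]
        bundle_Omega_eq[OF A \<kappa>(1) \<mu> ind a bc c x hx, of "(v, fun_diff h c x v)"] 
      by (simp add: \<alpha>_def base_connection_def)
  qed
  define f where "f x = (cmod (h x))\<^sup>2 / a x" for x
  have sf: "smooth_fun A f"
  proof -
    \<comment> \<open>The squared modulus is rewritten as \<open>Re (h x * cnj (h x))\<close>, to
      which the closure rules for smooth functions apply.\<close>
    have "smooth_fun A (\<lambda>x. Re (h x * cnj (h x)) / a x)"
      by (intro smooth_fun_divide[OF A] smooth_fun_Re[OF A] smooth_fun_mult[OF A] smooth_fun_cnj[OF A] sh a)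
    moreover have "Re (z * cnj z) = (cmod z)\<^sup>2" for z by (simp flip: complex_norm_square of_real_power)
    ultimately show ?thesis unfolding f_def[abs_def] by simp
  qed
  have f0: "f x \<noteq> 0" if "x \<in> points A" for x using h0[OF that] a(2)[OF that] by (simp add: f_def)
  have pr: "proportional A \<kappa> \<mu> \<omega> \<omega>1 f h"
    unfolding proportional_def
    by (intro conjI ballI sf sh f0 h0 form_eqI)
      (simp_all add: form_eqD[OF \<omega>] form_eqD[OF \<omega>1] pw f_def)
  then show "\<exists>f h. proportional A \<kappa> \<mu> \<omega> \<omega>1 f h" by blast
  note D = proportionalD[OF pr]
  have o: "one_form A \<omega>" "one_form A \<omega>1" "one_form A (pullback P \<sigma> \<Omega>)"
  proof -
    show "one_form A \<omega>"
      by (rule one_form_cong[OF A one_form_mult[OF A smooth_fun_of_real[OF A sf] \<kappa>(1)]]) (simp add: form_eqI D(5))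
    show "one_form A \<omega>1"
      by (rule one_form_cong[OF A one_form_mult[OF A sh \<mu>]]) (simp add: form_eqI D(6))
    have "one_form A (\<lambda>c x v. \<alpha> c x v + 1 / h x * fun_diff h c x v)"
      by (intro one_form_add[OF A] one_form_mult[OF A] smooth_fun_divide[OF A] smooth_fun_const[OF A]
          one_form_fun_diff[OF A] \<alpha> sh h0)
    then show "one_form A (pullback P \<sigma> \<Omega>)"
      by (rule one_form_cong[OF A]) (simp add: form_eqI pw)
  qed
  have sK: "smooth_fun A K1"
  proof -
    have "smooth_fun A (\<lambda>x. k1 x / Re (h x * cnj (h x)))"
      by (intro smooth_fun_divide[OF A] smooth_fun_Re[OF A] smooth_fun_mult[OF A] smooth_fun_cnj[OF A] sh sk)
        (use h0 in \<open>simp flip: complex_norm_square of_real_power\<close>)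
    then show ?thesis
      by (rule smooth_fun_cong[OF A])
        (simp add: K' flip: complex_norm_square of_real_power)
  qed
  show "normal_coframe A \<omega> \<omega>1 (pullback P \<sigma> \<Omega>) K1"
    unfolding normal_coframe_def
  proof (intro conjI ballI o sK)
    show "real_form A \<omega>"
      by (rule real_form_mult[OF \<kappa>(2)]) (rule form_eqI, rule D(5))
    show "independent_pair (\<omega> c x) (\<omega>1 c x)" if c: "c \<in> A" and x: "x \<in> chart_dom c" for c x
      by (rule independent_pair_smult[OF ind[OF c x] _ D(4)[OF points_memI[OF c x]] D(5)[OF c x] D(6)[OF c x]])
        (simp add: f0[OF points_memI[OF c x]])
    fix c assume c: "c \<in> A"
    have "normal_system c (chart_dom c) (\<lambda>c x v. of_real ((cmod (h x))\<^sup>2 / a x) * \<kappa> c x v) (\<lambda>c x v. h x * \<mu> c x v)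
      (\<lambda>c x v. \<alpha> c x v + fun_diff h c x v / h x) (\<lambda>x. k1 x / (cmod (h x))\<^sup>2)"
      by (rule normal_system_normalization[OF dom_nbhd[OF A c] one_formD(1)[OF \<kappa>(1) c] one_formD(1)[OF \<mu> c]
            one_formD(1)[OF \<alpha> c] smooth_funD[OF a(1) c] a(2)[OF points_memI[OF c]] shc[OF c] hk[OF points_memI[OF c]]])
        (auto simp: \<alpha>_def intro: base_connection_system[OF A \<kappa>(1) \<mu> ind a bc c])
    then show "normal_system c (chart_dom c) \<omega> \<omega>1 (pullback P \<sigma> \<Omega>) K1"
      by (rule normal_system_cong[OF dom_nbhd[OF A c]])
        (simp_all add: D(5,6)[OF c] f_def pw[OF c] K'[OF points_memI[OF c]])
  qed
qed

lemma normal_coframe_unique: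
  assumes n: "normal_coframe A \<omega> \<omega>1 \<alpha> K" and m: "normal_coframe A \<theta> \<theta>1 \<beta> L"
    and pr: "proportional A \<omega> \<omega>1 \<theta> \<theta>1 f h" and c: "c \<in> A" and x: "x \<in> chart_dom c"
  shows "\<theta> c x v = \<omega> c x v" "\<theta>1 c x v = \<omega>1 c x v" "\<beta> c x v = \<alpha> c x v" "L x = K x"
proof -
  note N = normal_coframeD[OF n] and D = proportionalD[OF pr]
  note u = normal_system_unique[OF dom_nbhd[OF A c] N(1,3,4)[THEN one_formD(1), OF c] N(6)[OF c] N(7)[OF c]
      normal_coframeD(7)[OF m c] smooth_funD[OF D(1) c] smooth_funD[OF D(2) c] D(4)[OF points_memI[OF c]]
      D(5)[OF c] D(6)[OF c] x]
  have "f x = 1" "h x = 1" "\<beta> c x v = \<alpha> c x v" "L x = K x" using u by auto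
  then show "\<theta> c x v = \<omega> c x v" "\<theta>1 c x v = \<omega>1 c x v" "\<beta> c x v = \<alpha> c x v" "L x = K x"
    using D(5,6)[OF c x] by simp_all
qed

end

section \<open>Normalized coframes and the invariant system\<close>

lemma DIM_real_3: "DIM(real ^ 3) = 3"
  by simp

text \<open>Expanding \<alpha> in the coframe turns the normal system into the equations for
  d\<omega> and d\<omega>1. The differentials of Z0, Z1, Z2 have nine coefficients; the equation for
  d\<alpha> has three components, which solve for Z12, Z10 and Z20 and leave the other six as higher
  order invariants.\<close>

lemma invariant_system_of_normal_coframe:
  fixes A :: "('a::{t2_space,second_countable_topology}, real ^ 3) atlas"
  assumes A: "smooth_atlas A" and n: "normal_coframe A \<omega> \<omega>1 \<alpha> K1"
    and \<alpha>: "\<And>c x v. c \<in> A \<Longrightarrow> x \<in> chart_dom c \<Longrightarrow>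
      \<alpha> c x v = Z1 x * \<omega>1 c x v + Z2 x * cnj (\<omega>1 c x v) + Z0 x * \<omega> c x v"
  shows "invariant_system A \<omega> \<omega>1 K1 Z0 Z1 Z2"
proof -
  note N = normal_coframeD[OF n]
  have real: "cnj (\<omega> c x v) = \<omega> c x v" if "c \<in> A" "x \<in> chart_dom c" for c x v
    using N(2) that unfolding real_form_def by (simp add: Reals_cnj_iff)
  have coeff: thesis
    if \<beta>: "one_form A \<beta>"
      and that: "\<And>X Y Z. smooth_fun A X \<Longrightarrow> smooth_fun A Y \<Longrightarrow> smooth_fun A Z \<Longrightarrow>
        (\<And>c x v. c \<in> A \<Longrightarrow> x \<in> chart_dom c \<Longrightarrow> \<beta> c x v = X x * \<omega>1 c x v + Y x * cnj (\<omega>1 c x v) + Z x * \<omega> c x v) \<Longrightarrow> thesis"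
    for \<beta> thesis
    by (rule one_form_coefficients[OF A N(1,3) \<beta> N(6)]) (assumption | rule that)+
  have coeff_unique: "X = X' \<and> Y = Y' \<and> Z = Z'"
    if c: "c \<in> A" "x \<in> chart_dom c" and eq: "\<And>v. X * \<omega>1 c x v + Y * cnj (\<omega>1 c x v) + Z * \<omega> c x v =
      X' * \<omega>1 c x v + Y' * cnj (\<omega>1 c x v) + Z' * \<omega> c x v" for c x X Y Z X' Y' Z'
  proof -
    have "(Z - Z') * \<omega> c x v + (X - X') * \<omega>1 c x v + (Y - Y') * cnj (\<omega>1 c x v) = 0" for v
      using eq[of v] by (simp add: algebra_simps)
    from independent_pairD[OF N(6)[OF c] this] show ?thesis by simp
  qed
  \<comment> \<open>Z0, Z1, Z2 are given as bare functions. Expanding \<alpha> once more yields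
    smooth coefficients, and uniqueness of coefficients identifies them with the given ones.\<close>
  obtain X Y W where XYW: "smooth_fun A X" "smooth_fun A Y" "smooth_fun A W"
    "\<And>c x v. c \<in> A \<Longrightarrow> x \<in> chart_dom c \<Longrightarrow> \<alpha> c x v = X x * \<omega>1 c x v + Y x * cnj (\<omega>1 c x v) + W x * \<omega> c x v"
    by (rule coeff[OF N(4)]) blast
  have XYW_eq: "X x = Z1 x \<and> Y x = Z2 x \<and> W x = Z0 x" if x: "x \<in> points A" for x
  proof -
    obtain c where c: "c \<in> A" "x \<in> chart_dom c" using x unfolding points_def by blast
    show ?thesis by (rule coeff_unique[OF c]) (simp flip: XYW(4)[OF c] add: \<alpha>[OF c])
  qed
  have sZ: "smooth_fun A Z1" "smooth_fun A Z2" "smooth_fun A Z0"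
    using XYW_eq by (auto intro: smooth_fun_cong[OF A XYW(1)] smooth_fun_cong[OF A XYW(2)] smooth_fun_cong[OF A XYW(3)])
  obtain Z11 Z12 Z10 where Z1: "smooth_fun A Z11" "smooth_fun A Z12" "smooth_fun A Z10"
    "\<And>c x v. c \<in> A \<Longrightarrow> x \<in> chart_dom c \<Longrightarrow> fun_diff Z1 c x v = Z11 x * \<omega>1 c x v + Z12 x * cnj (\<omega>1 c x v) + Z10 x * \<omega> c x v"
    by (rule coeff[OF one_form_fun_diff[OF A sZ(1)]]) blast
  obtain Z21 Z22 Z20 where Z2: "smooth_fun A Z21" "smooth_fun A Z22" "smooth_fun A Z20"
    "\<And>c x v. c \<in> A \<Longrightarrow> x \<in> chart_dom c \<Longrightarrow> fun_diff Z2 c x v = Z21 x * \<omega>1 c x v + Z22 x * cnj (\<omega>1 c x v) + Z20 x * \<omega> c x v"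
    by (rule coeff[OF one_form_fun_diff[OF A sZ(2)]]) blast
  obtain Z01 Z02 Z00 where Z0: "smooth_fun A Z01" "smooth_fun A Z02" "smooth_fun A Z00"
    "\<And>c x v. c \<in> A \<Longrightarrow> x \<in> chart_dom c \<Longrightarrow> fun_diff Z0 c x v = Z01 x * \<omega>1 c x v + Z02 x * cnj (\<omega>1 c x v) + Z00 x * \<omega> c x v"
    by (rule coeff[OF one_form_fun_diff[OF A sZ(3)]]) blast
  have sK: "smooth_fun A (\<lambda>x. complex_of_real (K1 x))" by (rule smooth_fun_of_real[OF A N(5)])
  obtain K11 K12 K10 where K: "smooth_fun A K11" "smooth_fun A K12" "smooth_fun A K10"
    "\<And>c x v. c \<in> A \<Longrightarrow> x \<in> chart_dom c \<Longrightarrow> fun_diff (\<lambda>x. of_real (K1 x)) c x v = K11 x * \<omega>1 c x v + K12 x * cnj (\<omega>1 c x v) + K10 x * \<omega> c x v"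
    by (rule coeff[OF one_form_fun_diff[OF A sK]]) blast
  have fcnj: "fun_diff (cnj \<circ> Z) c x v = cnj (fun_diff Z c x v)"
    if "smooth_fun A Z" "c \<in> A" "x \<in> chart_dom c" for Z c x v
    using fun_diff_cnj[OF dom_nbhd[OF A that(2)] smooth_funD[OF that(1,2)] that(3)] by (simp add: o_def)
  \<comment> \<open>K1 is real, so its differential equals its own conjugate; conjugation swaps the
    coefficients at \<omega>1 and its conjugate and conjugates the one at \<omega>.\<close>
  have K_eq: "K12 x = cnj (K11 x)" "K10 x = of_real (Re (K10 x))" if c: "c \<in> A" "x \<in> chart_dom c" for c x
  proof -
    have "K11 x * \<omega>1 c x v + K12 x * cnj (\<omega>1 c x v) + K10 x * \<omega> c x v =
      cnj (K12 x) * \<omega>1 c x v + cnj (K11 x) * cnj (\<omega>1 c x v) + cnj (K10 x) * \<omega> c x v" for v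
    proof -
      have "fun_diff (\<lambda>x. of_real (K1 x)) c x v = cnj (fun_diff (\<lambda>x. of_real (K1 x)) c x v)"
        using fcnj[OF sK c, of v] by (simp add: o_def)
      then show ?thesis unfolding K(4)[OF c] by (simp add: real[OF c] algebra_simps)
    qed
    note u = coeff_unique[OF c this]
    show "K12 x = cnj (K11 x)" by (rule conjunct1[OF conjunct2[OF u]])
    from conjunct2[OF conjunct2[OF u]] have "Im (K10 x) = 0" by (simp add: complex_eq_iff)
    then show "K10 x = of_real (Re (K10 x))" by (simp add: complex_eq_iff)
  qed
  text \<open>The coefficients of \<open>d\<alpha>\<close>, computed from the expansion of \<open>\<alpha>\<close>, are \<open>K1\<close>, \<open>1\<close> and \<open>0\<close>.\<close>
  have int: "Z12 x = - of_real (K1 x) + \<i> * Z0 x - Z1 x * Z2 x + Z2 x * cnj (Z2 x) + Z21 x"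
    "Z10 x = Z0 x * cnj (Z2 x) + Z01 x - 1"
    "Z20 x = Z02 x + Z0 x * cnj (Z1 x) + Z0 x * Z2 x - cnj (Z0 x) * Z2 x" if c: "c \<in> A" and x: "x \<in> chart_dom c" for c x
  proof -
    note W = dom_nbhd[OF A c]
    note f = one_formD(1)[OF N(3) c] chart_form_conj[OF W one_formD(1)[OF N(3) c]] one_formD(1)[OF N(1) c]
    note s = sZ[THEN smooth_funD, OF c]
    note mf = chart_form_mult[OF W s(1) f(1)] chart_form_mult[OF W s(2) f(2)] chart_form_mult[OF W s(3) f(3)]
    have d\<alpha>: "ext_diff \<alpha> c x u v = (fun_diff Z1 \<and>\<^sub>1 \<omega>1) c x u v + Z1 x * ext_diff \<omega>1 c x u v +
      ((fun_diff Z2 \<and>\<^sub>1 conj_form \<omega>1) c x u v + Z2 x * cnj (ext_diff \<omega>1 c x u v)) +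
      ((fun_diff Z0 \<and>\<^sub>1 \<omega>) c x u v + Z0 x * ext_diff \<omega> c x u v)" for u v
    proof -
      have "ext_diff \<alpha> c x u v =
        ext_diff (\<lambda>c x v. (Z1 x * \<omega>1 c x v + Z2 x * conj_form \<omega>1 c x v) + Z0 x * \<omega> c x v) c x u v"
        by (rule ext_diff_cong[OF W _ x]) (simp add: \<alpha>[OF c] conj_form_def)
      then show ?thesis
        unfolding ext_diff_add[OF W chart_form_add[OF W mf(1,2)] mf(3) x] ext_diff_add[OF W mf(1,2) x]
          ext_diff_mult[OF W s(1) f(1) x] ext_diff_mult[OF W s(2) f(2) x] ext_diff_mult[OF W s(3) f(3) x]
          ext_diff_conj[OF W f(1) x] .
    qed
    let ?A = "Z21 x - Z12 x - Z1 x * Z2 x + Z2 x * cnj (Z2 x) + \<i> * Z0 x - of_real (K1 x)"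
    let ?B = "Z01 x - Z10 x + Z0 x * cnj (Z2 x) - 1"
    let ?C = "Z02 x - Z20 x - Z2 x * cnj (Z0 x) + Z0 x * Z2 x + Z0 x * cnj (Z1 x)"
    have "?A * (\<omega>1 \<and>\<^sub>1 conj_form \<omega>1) c x u v + ?B * (\<omega>1 \<and>\<^sub>1 \<omega>) c x u v + ?C * (conj_form \<omega>1 \<and>\<^sub>1 \<omega>) c x u v = 0" for u v
    proof -
      note e = normal_systemD[OF N(7)[OF c] x, of u v]
      have "(of_real (K1 x) * (\<omega>1 \<and>\<^sub>1 conj_form \<omega>1) c x u v + (\<omega>1 \<and>\<^sub>1 \<omega>) c x u v) =
        (fun_diff Z1 \<and>\<^sub>1 \<omega>1) c x u v + Z1 x * (\<alpha> \<and>\<^sub>1 \<omega>1) c x u v +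
        ((fun_diff Z2 \<and>\<^sub>1 conj_form \<omega>1) c x u v + Z2 x * cnj ((\<alpha> \<and>\<^sub>1 \<omega>1) c x u v)) +
        ((fun_diff Z0 \<and>\<^sub>1 \<omega>) c x u v + Z0 x * (\<i> * (\<omega>1 \<and>\<^sub>1 conj_form \<omega>1) c x u v +
       ((\<alpha> \<and>\<^sub>1 \<omega>) c x u v + (conj_form \<alpha> \<and>\<^sub>1 \<omega>) c x u v)))"
        using d\<alpha>[of u v] unfolding e .
      then show ?thesis
        unfolding wedge_def conj_form_def \<alpha>[OF c x] Z1(4)[OF c x] Z2(4)[OF c x] Z0(4)[OF c x]
        by (simp add: real[OF c x] algebra_simps)
    qed
    from two_form_coeffs_zero[where \<kappa> = \<omega> and \<mu> = \<omega>1 and c = c, OF N(6)[OF c x] this]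
    show "Z12 x = - of_real (K1 x) + \<i> * Z0 x - Z1 x * Z2 x + Z2 x * cnj (Z2 x) + Z21 x"
      "Z10 x = Z0 x * cnj (Z2 x) + Z01 x - 1"
      "Z20 x = Z02 x + Z0 x * cnj (Z1 x) + Z0 x * Z2 x - cnj (Z0 x) * Z2 x"
      by (simp_all add: algebra_simps)
  qed
  have diff_eq: "diff_eq_cc A Z \<beta>"
    if "smooth_fun A Z" "\<And>c x v. c \<in> A \<Longrightarrow> x \<in> chart_dom c \<Longrightarrow> fun_diff Z c x v = \<beta> c x v" for Z \<beta>
    unfolding diff_eq_cc_def by (intro conjI form_eqI) (simp_all add: fcnj[OF that(1)] that(2) conj_form_def)
  have "integrability_conditions A \<omega> \<omega>1 K1 Z0 Z1 Z2"
    unfolding integrability_conditions_def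
  proof (intro exI conjI)
    show "smooth_fun A Z00" "smooth_fun A Z01" "smooth_fun A Z02" "smooth_fun A Z11" "smooth_fun A Z21"
      "smooth_fun A Z22" "smooth_fun A K11" "smooth_fun A (\<lambda>x. Re (K10 x))"
      by (rule Z0 Z1 Z2 K smooth_fun_Re[OF A K(3)])+
    show "diff_eq_cc A Z1 (\<lambda>c x v. Z11 x * \<omega>1 c x v +
           (- of_real (K1 x) + \<i> * Z0 x - Z1 x * Z2 x + Z2 x * cnj (Z2 x) + Z21 x) * conj_form \<omega>1 c x v +
           (Z0 x * cnj (Z2 x) + Z01 x - 1) * \<omega> c x v)"
      by (rule diff_eq[OF sZ(1)]) (simp only: Z1(4) int(1,2) conj_form_def)
    show "diff_eq_cc A Z2 (\<lambda>c x v. Z21 x * \<omega>1 c x v + Z22 x * conj_form \<omega>1 c x v +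
           (Z02 x + Z0 x * cnj (Z1 x) + Z0 x * Z2 x - cnj (Z0 x) * Z2 x) * \<omega> c x v)"
      by (rule diff_eq[OF sZ(2)]) (simp only: Z2(4) int(3) conj_form_def)
    show "diff_eq_cc A Z0 (\<lambda>c x v. Z01 x * \<omega>1 c x v + Z02 x * conj_form \<omega>1 c x v + Z00 x * \<omega> c x v)"
      by (rule diff_eq[OF sZ(3)]) (simp only: Z0(4) conj_form_def)
    show "diff_eq_cc A (of_real \<circ> K1) (\<lambda>c x v. K11 x * \<omega>1 c x v + cnj (K11 x) * conj_form \<omega>1 c x v +
           of_real (Re (K10 x)) * \<omega> c x v)"
      unfolding o_def
      by (rule diff_eq[OF sK]) (simp only: K(4) K_eq(1) K_eq(2)[symmetric] conj_form_def)
  qed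
  moreover have "coframe A [\<omega>, \<omega>1, conj_form \<omega>1]"
    unfolding coframe_iff[OF DIM_real_3] using N(6) by blast
  moreover have "form2_eq A (ext_diff \<omega>) (\<lambda>c x u v.
        \<i> * (\<omega>1 \<and>\<^sub>1 conj_form \<omega>1) c x u v +
        (Z1 x + cnj (Z2 x)) * (\<omega>1 \<and>\<^sub>1 \<omega>) c x u v +
        (Z2 x + cnj (Z1 x)) * (conj_form \<omega>1 \<and>\<^sub>1 \<omega>) c x u v)"
    unfolding form2_eq_def
  proof (intro ballI allI)
    fix c x u v assume c: "c \<in> A" and x: "x \<in> chart_dom c"
    show "ext_diff \<omega> c x u v = \<i> * (\<omega>1 \<and>\<^sub>1 conj_form \<omega>1) c x u v +
        (Z1 x + cnj (Z2 x)) * (\<omega>1 \<and>\<^sub>1 \<omega>) c x u v + (Z2 x + cnj (Z1 x)) * (conj_form \<omega>1 \<and>\<^sub>1 \<omega>) c x u v"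
      unfolding normal_systemD[OF N(7)[OF c] x] wedge_def conj_form_def \<alpha>[OF c x]
      by (simp add: real[OF c x] algebra_simps)
  qed
  moreover have d\<omega>1: "ext_diff \<omega>1 c x u v = - Z2 x * (\<omega>1 \<and>\<^sub>1 conj_form \<omega>1) c x u v - Z0 x * (\<omega>1 \<and>\<^sub>1 \<omega>) c x u v"
    if c: "c \<in> A" and x: "x \<in> chart_dom c" for c x u v
    unfolding normal_systemD[OF N(7)[OF c] x] wedge_def conj_form_def \<alpha>[OF c x]
    by (simp add: algebra_simps)
  moreover have "ext_diff (conj_form \<omega>1) c x u v =
        cnj (Z2 x) * (\<omega>1 \<and>\<^sub>1 conj_form \<omega>1) c x u v - cnj (Z0 x) * (conj_form \<omega>1 \<and>\<^sub>1 \<omega>) c x u v"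
    if c: "c \<in> A" and x: "x \<in> chart_dom c" for c x u v
    unfolding ext_diff_conj[OF dom_nbhd[OF A c] one_formD(1)[OF N(3) c] x] d\<omega>1[OF c x] wedge_def conj_form_def
    by (simp add: real[OF c x] algebra_simps)
  ultimately show ?thesis
    unfolding invariant_system_def form2_eq_def by (intro conjI ballI allI N sZ) simp_all
qed

text \<open>The integrability conditions are the equation for d\<alpha> in disguise: in d\<alpha>
  the coefficients Z21, Z01, Z02 cancel in pairs, Z11, Z22, Z00 multiply a form wedged with itself,
  and K1 and 1 remain.\<close>

lemma normal_coframe_of_invariant_system:
  fixes A :: "('a::{t2_space,second_countable_topology}, real ^ 3) atlas"
  assumes A: "smooth_atlas A" and sys: "invariant_system A \<omega> \<omega>1 K1 Z0 Z1 Z2"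
  shows "normal_coframe A \<omega> \<omega>1 (\<lambda>c x v. Z1 x * \<omega>1 c x v + Z2 x * conj_form \<omega>1 c x v + Z0 x * \<omega> c x v) K1"
    (is "normal_coframe A \<omega> \<omega>1 ?\<alpha> K1")
proof -
  have f: "one_form A \<omega>" "real_form A \<omega>" "one_form A \<omega>1" and cof: "coframe A [\<omega>, \<omega>1, conj_form \<omega>1]"
    and s: "smooth_fun A K1" "smooth_fun A Z0" "smooth_fun A Z1" "smooth_fun A Z2"
    and d: "form2_eq A (ext_diff \<omega>) (\<lambda>c x u v.
        \<i> * (\<omega>1 \<and>\<^sub>1 conj_form \<omega>1) c x u v +
        (Z1 x + cnj (Z2 x)) * (\<omega>1 \<and>\<^sub>1 \<omega>) c x u v +
        (Z2 x + cnj (Z1 x)) * (conj_form \<omega>1 \<and>\<^sub>1 \<omega>) c x u v)"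
      "form2_eq A (ext_diff \<omega>1) (\<lambda>c x u v.
        - Z2 x * (\<omega>1 \<and>\<^sub>1 conj_form \<omega>1) c x u v - Z0 x * (\<omega>1 \<and>\<^sub>1 \<omega>) c x u v)"
    and int: "integrability_conditions A \<omega> \<omega>1 K1 Z0 Z1 Z2"
    using sys unfolding invariant_system_def by simp_all
  obtain Z00 Z01 Z02 Z11 Z21 Z22 :: "'a \<Rightarrow> complex"
    where dZ: "form_eq A (fun_diff Z1) (\<lambda>c x v. Z11 x * \<omega>1 c x v +
           (- of_real (K1 x) + \<i> * Z0 x - Z1 x * Z2 x + Z2 x * cnj (Z2 x) + Z21 x) * conj_form \<omega>1 c x v +
           (Z0 x * cnj (Z2 x) + Z01 x - 1) * \<omega> c x v)"
      "form_eq A (fun_diff Z2) (\<lambda>c x v. Z21 x * \<omega>1 c x v + Z22 x * conj_form \<omega>1 c x v +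
           (Z02 x + Z0 x * cnj (Z1 x) + Z0 x * Z2 x - cnj (Z0 x) * Z2 x) * \<omega> c x v)"
      "form_eq A (fun_diff Z0) (\<lambda>c x v. Z01 x * \<omega>1 c x v + Z02 x * conj_form \<omega>1 c x v + Z00 x * \<omega> c x v)"
    using int unfolding integrability_conditions_def diff_eq_cc_def by blast
  have real: "cnj (\<omega> c x v) = \<omega> c x v" if "c \<in> A" "x \<in> chart_dom c" for c x v
    using f(2) that unfolding real_form_def by (simp add: Reals_cnj_iff)
  show ?thesis
    unfolding normal_coframe_def
  proof (intro conjI ballI f s)
    show "one_form A ?\<alpha>"
      by (intro one_form_add[OF A] one_form_mult[OF A] one_form_conj[OF A] f s)
    show "independent_pair (\<omega> c x) (\<omega>1 c x)" if "c \<in> A" "x \<in> chart_dom c" for c x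
      using cof that unfolding coframe_iff[OF DIM_real_3] by blast
    fix c assume c: "c \<in> A"
    show "normal_system c (chart_dom c) \<omega> \<omega>1 ?\<alpha> K1"
      unfolding normal_system_def
    proof (intro ballI allI conjI)
      fix x u v assume x: "x \<in> chart_dom c"
      show "ext_diff \<omega> c x u v = \<i> * (\<omega>1 \<and>\<^sub>1 conj_form \<omega>1) c x u v +
         ((?\<alpha> \<and>\<^sub>1 \<omega>) c x u v + (conj_form ?\<alpha> \<and>\<^sub>1 \<omega>) c x u v)"
        unfolding form2_eqD[OF d(1) c x] wedge_def conj_form_def
        by (simp add: real[OF c x] algebra_simps)
      show "ext_diff \<omega>1 c x u v = (?\<alpha> \<and>\<^sub>1 \<omega>1) c x u v"
        unfolding form2_eqD[OF d(2) c x] wedge_def conj_form_def by (simp add: algebra_simps)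
      note W = dom_nbhd[OF A c]
      note g = one_formD(1)[OF f(3) c] chart_form_conj[OF W one_formD(1)[OF f(3) c]] one_formD(1)[OF f(1) c]
      note t = s[THEN smooth_funD, OF c]
      note mf = chart_form_mult[OF W t(3) g(1)] chart_form_mult[OF W t(4) g(2)] chart_form_mult[OF W t(2) g(3)]
      show "ext_diff ?\<alpha> c x u v = of_real (K1 x) * (\<omega>1 \<and>\<^sub>1 conj_form \<omega>1) c x u v + (\<omega>1 \<and>\<^sub>1 \<omega>) c x u v"
        unfolding ext_diff_add[OF W chart_form_add[OF W mf(1,2)] mf(3) x] ext_diff_add[OF W mf(1,2) x]
          ext_diff_mult[OF W t(3) g(1) x] ext_diff_mult[OF W t(4) g(2) x] ext_diff_mult[OF W t(2) g(3) x]
          ext_diff_conj[OF W g(1) x] form2_eqD[OF d(1) c x] form2_eqD[OF d(2) c x]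
        unfolding wedge_def conj_form_def form_eqD[OF dZ(1) c x] form_eqD[OF dZ(2) c x] form_eqD[OF dZ(3) c x]
        by (simp add: real[OF c x] algebra_simps)
    qed
  qed
qed

text \<open>A normal system is a base system with twist 1 and k2 = 1, since a constant twist has no
  differential.\<close>

lemma base_system_of_normal_system:
  assumes "chart_nbhd c W" "normal_system c W \<omega> \<omega>1 \<alpha> K1"
  shows "base_system c W \<omega> \<omega>1 (\<lambda>x. 1) \<alpha> K1 (\<lambda>x. 1)"
  unfolding base_system_def
proof (intro ballI allI conjI)
  fix x u v assume x: "x \<in> W"
  note S = normal_systemD[OF assms(2) x, of u v]
  show "ext_diff \<omega>1 c x u v = (\<alpha> \<and>\<^sub>1 \<omega>1) c x u v" by (rule S)
  have "(fun_diff (\<lambda>x. complex_of_real 1) \<and>\<^sub>1 \<omega>) c x u v = 0"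
    unfolding wedge_def fun_diff_const[OF assms(1)] by simp
  then show "complex_of_real 1 * ext_diff \<omega> c x u v =
       \<i> * complex_of_real 1 * complex_of_real 1 * (\<omega>1 \<and>\<^sub>1 conj_form \<omega>1) c x u v +
       (fun_diff (\<lambda>x. complex_of_real 1) \<and>\<^sub>1 \<omega>) c x u v +
       complex_of_real 1 * ((\<alpha> \<and>\<^sub>1 \<omega>) c x u v + (conj_form \<alpha> \<and>\<^sub>1 \<omega>) c x u v)"
    using S(1) by simp
  show "complex_of_real 1 * ext_diff \<alpha> c x u v = complex_of_real 1 * of_real (K1 x) * (\<omega>1 \<and>\<^sub>1 conj_form \<omega>1) c x u v +
       1 * (\<omega>1 \<and>\<^sub>1 \<omega>) c x u v"
    using S(3) by simp
qed

section \<open>Realization and existence of invariant coframes\<close>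

lemma normal_coframe_congruence_pair:
  "normal_coframe A \<omega> \<omega>1 \<alpha> K1 \<Longrightarrow> congruence_pair A \<omega> \<omega>1"
  unfolding normal_coframe_def congruence_pair_iff by simp

lemma congruence_class_self:
  assumes "smooth_atlas A" "congruence_pair A \<kappa> \<mu>"
  shows "(\<kappa>, \<mu>) \<in> congruence_class A \<kappa> \<mu>"
proof -
  have "proportional A \<kappa> \<mu> \<kappa> \<mu> (\<lambda>x. 1) (\<lambda>x. 1)"
    unfolding proportional_def by (simp add: smooth_fun_const[OF assms(1)] form_eqI)
  then show ?thesis unfolding congruence_class_iff using assms(2) by blast
qed

text \<open>The coframe itself is used as representative. Its twist and k2 are 1, so the normalizing
  section is z = 1, which pulls the forms of the bundle back to \<omega>, \<omega>1 and the
  combination with coefficients Z1, Z2, Z0.\<close>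

lemma invariant_system_realized:
  fixes A :: "('a::{t2_space,second_countable_topology}, real ^ 3) atlas"
  assumes A: "smooth_atlas A" and sys: "invariant_system A \<omega> \<omega>1 K1 Z0 Z1 Z2"
  shows "admissible_congruence A (congruence_class A \<omega> \<omega>1)"
    "invariant_coframe A (congruence_class A \<omega> \<omega>1) \<omega> \<omega>1 K1 Z0 Z1 Z2"
proof -
  let ?\<alpha> = "\<lambda>c x v. Z1 x * \<omega>1 c x v + Z2 x * conj_form \<omega>1 c x v + Z0 x * \<omega> c x v"
  let ?\<Omega> = "\<lambda>C p v. pullback A fst ?\<alpha> C p v + snd v / snd p"
  let ?one = "\<lambda>x :: 'a. 1"
  note n = normal_coframe_of_invariant_system[OF A sys]
  note N = normal_coframeD[OF n]
  have pair: "congruence_pair A \<omega> \<omega>1" by (rule normal_coframe_congruence_pair[OF n])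
  have bc: "bundle_coframe A \<omega> \<omega>1 ?one ?\<Omega> K1 ?one"
    by (rule bundle_coframe_of_base_system[OF A N(1,3,4) _ N(6) smooth_fun_const[OF A] _ N(5) smooth_fun_const[OF A]
          base_system_of_normal_system[OF dom_nbhd[OF A] N(7)]]) simp_all
  have sZ: "smooth_fun A Z0" "smooth_fun A Z1" "smooth_fun A Z2"
    and d: "form2_eq A (ext_diff \<omega>) (\<lambda>c x u v.
        \<i> * (\<omega>1 \<and>\<^sub>1 conj_form \<omega>1) c x u v +
        (Z1 x + cnj (Z2 x)) * (\<omega>1 \<and>\<^sub>1 \<omega>) c x u v +
        (Z2 x + cnj (Z1 x)) * (conj_form \<omega>1 \<and>\<^sub>1 \<omega>) c x u v)"
      "form2_eq A (ext_diff \<omega>1) (\<lambda>c x u v.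
        - Z2 x * (\<omega>1 \<and>\<^sub>1 conj_form \<omega>1) c x u v - Z0 x * (\<omega>1 \<and>\<^sub>1 \<omega>) c x u v)"
    using sys unfolding invariant_system_def by simp_all
  \<comment> \<open>Read off from the system: twist 1, b = Z1 + cnj Z2, p = - Z2, q = - Z0, and
    shear 0 because d\<omega>1 has no term in cnj \<omega>1 \<and> \<omega>.\<close>
  have "structure_functions A \<omega> \<omega>1 ?one (\<lambda>x. Z1 x + cnj (Z2 x)) (\<lambda>x. - Z2 x) (\<lambda>x. - Z0 x) (\<lambda>x. 0)"
    unfolding structure_functions_def
    by (intro conjI smooth_fun_const[OF A] smooth_fun_add[OF A] smooth_fun_minus[OF A] smooth_fun_cnj[OF A] sZ)
      (use d in \<open>simp_all add: form2_eq_def\<close>)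
  moreover have "bundle_K2 ?one y \<noteq> 0" if "y \<in> points (bundle_atlas A)" for y
    using that by (auto simp: points_bundle_atlas bundle_K2_def)
  ultimately have adm: "admissible_pair A \<omega> \<omega>1 ?one ?\<Omega> K1 ?one"
    unfolding admissible_pair_def using bc by auto
  note self = congruence_class_self[OF A pair]
  show "admissible_congruence A (congruence_class A \<omega> \<omega>1)"
    unfolding admissible_congruence_def oriented_congruence_def using pair self adm by blast
  \<comment> \<open>For k2 = 1 the fibre coordinate has modulus 1 and argument 0, hence is constant,
    and dh = 0 in the pullbacks.\<close>
  have \<sigma>: "normal_section ?one = (\<lambda>x. (x, 1))"
    by (simp add: normal_section_def fun_eq_iff)
  have ps: "pullback (bundle_atlas A) (normal_section ?one) \<Psi> c x v = \<Psi> (bundle_chart c) (x, 1) (v, 0)"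
    if c: "c \<in> A" and x: "x \<in> chart_dom c" and \<Psi>: "form_compatible (bundle_atlas A) \<Psi>" for \<Psi> c x v
    using pullback_section[OF A c chart_smooth_const[OF dom_nbhd[OF A c], of 1] _ \<Psi> x, of v]
      fun_diff_const[OF dom_nbhd[OF A c]] by (simp add: \<sigma>)
  have p: "(x, 1) \<in> bundle_dom c" if "x \<in> chart_dom c" for c :: "('a, real ^ 3) chart" and x
    using that by simp
  have pw: "pullback (bundle_atlas A) (normal_section ?one) (bundle_omega A \<omega> ?one) c x v = \<omega> c x v"
    "pullback (bundle_atlas A) (normal_section ?one) (bundle_omega1 A \<omega>1) c x v = \<omega>1 c x v"
    "pullback (bundle_atlas A) (normal_section ?one) ?\<Omega> c x v = ?\<alpha> c x v" if c: "c \<in> A" and x: "x \<in> chart_dom c" for c x v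
    using ps[OF c x form_compatible_bundle_omega[OF A one_formD(2)[OF N(1)]], of ?one v]
      ps[OF c x form_compatible_bundle_omega1[OF A one_formD(2)[OF N(3)]], of v]
      ps[OF c x one_formD(2)[OF bundle_coframeD(1)[OF bc]], of v]
    by (simp_all add: bundle_omega_eq[OF A c one_formD(2)[OF N(1)] p[OF x]]
        bundle_omega1_eq[OF A c one_formD(2)[OF N(3)] p[OF x]] pullback_fst[OF A c one_formD(2)[OF N(4)] p[OF x]])
  show "invariant_coframe A (congruence_class A \<omega> \<omega>1) \<omega> \<omega>1 K1 Z0 Z1 Z2"
    unfolding invariant_coframe_def Let_def
  proof (rule bexI[OF _ self], simp only: prod.case, intro exI conjI)
    show "admissible_pair A \<omega> \<omega>1 ?one ?\<Omega> K1 ?one" by (rule adm)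
    show "form_eq A \<omega> (pullback (bundle_atlas A) (normal_section ?one) (bundle_omega A \<omega> ?one))"
      "form_eq A \<omega>1 (pullback (bundle_atlas A) (normal_section ?one) (bundle_omega1 A \<omega>1))"
      "form_eq A (pullback (bundle_atlas A) (normal_section ?one) ?\<Omega>) ?\<alpha>"
      by (rule form_eqI, simp only: pw)+
    show "\<forall>x\<in>points A. K1 x = bundle_K1 K1 (normal_section ?one x)"
      by (simp add: \<sigma> bundle_K1_def)
  qed
qed

text \<open>\<open>invariant_coframe\<close> keeps the representative and the bundle behind
  existential quantifiers. Later arguments need only the normalized triple on the base, where
  \<alpha> is the pullback of \<Omega>.\<close>

lemma invariant_coframe_normal:
  assumes A: "smooth_atlas A" and S: "oriented_congruence A S"
    and inv: "invariant_coframe A S \<omega> \<omega>1 K1 Z0 Z1 Z2"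
  obtains \<alpha> where "normal_coframe A \<omega> \<omega>1 \<alpha> K1" "(\<omega>, \<omega>1) \<in> S"
    "\<And>c x v. c \<in> A \<Longrightarrow> x \<in> chart_dom c \<Longrightarrow> \<alpha> c x v = Z1 x * \<omega>1 c x v + Z2 x * cnj (\<omega>1 c x v) + Z0 x * \<omega> c x v"
proof -
  obtain \<kappa>0 \<mu>0 where S': "S = congruence_class A \<kappa>0 \<mu>0" using S unfolding oriented_congruence_def by blast
  obtain \<kappa> \<mu> a \<Omega> k1 k2 where \<kappa>\<mu>: "(\<kappa>, \<mu>) \<in> S" and adm: "admissible_pair A \<kappa> \<mu> a \<Omega> k1 k2"
    and e: "form_eq A \<omega> (pullback (bundle_atlas A) (normal_section k2) (bundle_omega A \<kappa> a))"
      "form_eq A \<omega>1 (pullback (bundle_atlas A) (normal_section k2) (bundle_omega1 A \<mu>))"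
      "form_eq A (pullback (bundle_atlas A) (normal_section k2) \<Omega>) (\<lambda>c x v.
            Z1 x * \<omega>1 c x v + Z2 x * conj_form \<omega>1 c x v + Z0 x * \<omega> c x v)"
      "\<forall>x\<in>points A. K1 x = bundle_K1 k1 (normal_section k2 x)"
    using inv unfolding invariant_coframe_def Let_def by blast
  have pair: "congruence_pair A \<kappa> \<mu>" and pr0: "\<exists>f h. proportional A \<kappa>0 \<mu>0 \<kappa> \<mu> f h"
    using \<kappa>\<mu> unfolding S' congruence_class_iff by simp_all
  note n = normal_coframe_of_admissible[OF A pair adm e(1,2) bspec[OF e(4)]]
  show ?thesis
  proof (rule that[OF n(1)])
    show "(\<omega>, \<omega>1) \<in> S"
      unfolding S' congruence_class_iff
      using normal_coframe_congruence_pair[OF n(1)] pr0 n(2) proportional_trans[OF A] by blast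
    show "pullback (bundle_atlas A) (normal_section k2) \<Omega> c x v =
      Z1 x * \<omega>1 c x v + Z2 x * cnj (\<omega>1 c x v) + Z0 x * \<omega> c x v" if "c \<in> A" "x \<in> chart_dom c" for c x v
      using form_eqD[OF e(3) that] by (simp add: conj_form_def)
  qed
qed

text \<open>The pullbacks along the normal section are a coframe, and the scalars Z0, Z1, Z2 are the
  coefficients of the pulled back \<Omega> in it.\<close>

lemma invariant_coframe_exists:
  fixes A :: "('a::{t2_space,second_countable_topology}, real ^ 3) atlas"
  assumes A: "smooth_atlas A" and S: "admissible_congruence A S"
  shows "\<exists>\<omega> \<omega>1 K1 Z0 Z1 Z2. invariant_coframe A S \<omega> \<omega>1 K1 Z0 Z1 Z2"
proof -
  obtain \<kappa> \<mu> a \<Omega> k1 k2 where \<kappa>\<mu>: "(\<kappa>, \<mu>) \<in> S" and adm: "admissible_pair A \<kappa> \<mu> a \<Omega> k1 k2"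
    using S unfolding admissible_congruence_def by blast
  have "congruence_pair A \<kappa> \<mu>"
    using S \<kappa>\<mu> unfolding admissible_congruence_def oriented_congruence_def by (auto simp: congruence_class_iff)
  let ?\<sigma> = "normal_section k2" and ?P = "bundle_atlas A"
  let ?\<omega> = "pullback ?P ?\<sigma> (bundle_omega A \<kappa> a)" and ?\<omega>1 = "pullback ?P ?\<sigma> (bundle_omega1 A \<mu>)"
  let ?K = "\<lambda>x. bundle_K1 k1 (?\<sigma> x)"
  have "normal_coframe A ?\<omega> ?\<omega>1 (pullback ?P ?\<sigma> \<Omega>) ?K"
    by (rule normal_coframe_of_admissible(1)[OF A \<open>congruence_pair A \<kappa> \<mu>\<close> adm]) (simp_all add: form_eqI)
  note N = normal_coframeD[OF this]
  obtain Z1 Z2 Z0 where Z: "\<And>c x v. c \<in> A \<Longrightarrow> x \<in> chart_dom c \<Longrightarrow> pullback ?P ?\<sigma> \<Omega> c x v =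
      Z1 x * ?\<omega>1 c x v + Z2 x * cnj (?\<omega>1 c x v) + Z0 x * ?\<omega> c x v"
    by (rule one_form_coefficients[OF A N(1,3,4) N(6)]) blast+
  have "invariant_coframe A S ?\<omega> ?\<omega>1 ?K Z0 Z1 Z2"
    unfolding invariant_coframe_def Let_def
  proof (rule bexI[OF _ \<kappa>\<mu>], simp only: prod.case, intro exI conjI)
    show "admissible_pair A \<kappa> \<mu> a \<Omega> k1 k2" by (rule adm)
  qed (simp_all add: form_eqI Z conj_form_def)
  then show ?thesis by blast
qed

subsection \<open>Local equivalences\<close>

text \<open>\<open>form_eq\<close> constrains forms only in charts around points of the manifold; as
  \<phi> x is such a point, the chart chosen inside \<open>pullback\<close> does contain it.\<close>

lemma pullback_scaled:
  assumes "form_eq B \<beta> (\<lambda>c x v. g x * \<gamma> c x v)" "\<phi> x \<in> points B"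
  shows "pullback B \<phi> \<beta> c x v = g (\<phi> x) * pullback B \<phi> \<gamma> c x v"
proof -
  define d where "d = (SOME d. d \<in> B \<and> \<phi> x \<in> chart_dom d)"
  have "\<exists>d. d \<in> B \<and> \<phi> x \<in> chart_dom d" using assms(2) unfolding points_def by blast
  then have "d \<in> B \<and> \<phi> x \<in> chart_dom d" unfolding d_def by (rule someI_ex)
  then show ?thesis
    unfolding pullback_def Let_def d_def[symmetric] by (simp add: form_eqD[OF assms(1)])
qed

text \<open>W is the part of a chart domain on which \<phi> is defined and stays in one chart of the
  target. Sets of this kind are open and cover U, so an identity of forms on U can be checked on
  each of them.\<close>

lemma local_diffeo_chart:
  fixes A :: "('a::{t2_space,second_countable_topology}, 'e::euclidean_space) atlas"
    and A' :: "('b::{t2_space,second_countable_topology}, 'f::euclidean_space) atlas"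
  assumes A: "smooth_atlas A" and A': "smooth_atlas A'" and \<phi>: "local_diffeo A A' U V \<phi>"
    and c: "c \<in> A" and d: "d \<in> A'"
  defines "W \<equiv> chart_dom c \<inter> U \<inter> \<phi> -` chart_dom d"
  shows "chart_nbhd c W" "smooth_on (chart_map c ` W) (chart_map d \<circ> \<phi> \<circ> chart_inv c)"
    "\<phi> ` W \<subseteq> chart_dom d"
    "smooth_fun A' g \<Longrightarrow> chart_smooth c W (\<lambda>x. g (\<phi> x))"
proof -
  note rc = smooth_atlas_regular[OF A c] and rd = smooth_atlas_regular[OF A' d]
  have oU: "open U" and cont: "continuous_on U \<phi>"
    and sm: "smooth_on (chart_map c ` W) (chart_map d \<circ> \<phi> \<circ> chart_inv c)"
    using \<phi> c d unfolding local_diffeo_def smooth_map_on_def W_def by simp_all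
  have "open (\<phi> -` chart_dom d \<inter> U)"
    using cont oU rd unfolding regular_chart_def by (simp add: continuous_on_open_vimage)
  then have "open W"
    using rc unfolding regular_chart_def W_def by (simp add: Int_assoc Int_commute[of U] open_Int)
  then show n: "chart_nbhd c W" using rc unfolding chart_nbhd_def W_def by auto
  show "smooth_on (chart_map c ` W) (chart_map d \<circ> \<phi> \<circ> chart_inv c)" by (rule sm)
  show im: "\<phi> ` W \<subseteq> chart_dom d" unfolding W_def by auto
  show "chart_smooth c W (\<lambda>x. g (\<phi> x))" if g: "smooth_fun A' g"
  proof -
    let ?\<psi> = "chart_map d \<circ> \<phi> \<circ> chart_inv c"
    note o = chart_nbhd_open_image[OF n] and nd = dom_nbhd[OF A' d]
    have "?\<psi> ` (chart_map c ` W) \<subseteq> chart_map d ` chart_dom d"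
      using im chart_nbhd_inv_map[OF n] by auto
    then have "smooth_on (chart_map c ` W) (\<lambda>y. g (chart_inv d (?\<psi> y)))"
      by (rule smooth_on_compose[OF o chart_nbhd_open_image[OF nd] _ sm
            smooth_funD[OF g d, unfolded chart_smooth_def]])
    then show ?thesis unfolding chart_smooth_def
    proof (rule smooth_on_cong[OF o])
      fix y assume "y \<in> chart_map c ` W"
      then have "\<phi> (chart_inv c y) \<in> chart_dom d" using chart_nbhd_inv(1)[OF n] im by blast
      then show "g (chart_inv d (?\<psi> y)) = g (\<phi> (chart_inv c y))"
        by (simp add: chart_nbhd_inv_map[OF nd])
    qed
  qed
qed

text \<open>d commutes with pullback and the wedge product and conjugation are pointwise, so each
  equation at \<phi> x, evaluated on the images of tangent vectors, is the pulled back equation at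
  x.\<close>

lemma normal_system_pullback:
  fixes A :: "('a::{t2_space,second_countable_topology}, 'e::euclidean_space) atlas"
    and A' :: "('b::{t2_space,second_countable_topology}, 'f::euclidean_space) atlas"
  assumes A: "smooth_atlas A" and A': "smooth_atlas A'" and \<phi>: "local_diffeo A A' U V \<phi>"
    and c: "c \<in> A" and d: "d \<in> A'" and m: "normal_coframe A' \<theta> \<theta>1 \<beta> L"
  shows "normal_system c (chart_dom c \<inter> U \<inter> \<phi> -` chart_dom d)
    (pullback A' \<phi> \<theta>) (pullback A' \<phi> \<theta>1) (pullback A' \<phi> \<beta>) (L \<circ> \<phi>)"
  unfolding normal_system_def
proof (intro ballI allI conjI)
  let ?W = "chart_dom c \<inter> U \<inter> \<phi> -` chart_dom d"
  fix x u v assume x: "x \<in> ?W"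
  note ch = local_diffeo_chart[OF A A' \<phi> c d] and M = normal_coframeD[OF m]
  define D where "D = \<D> (chart_map d \<circ> \<phi> \<circ> chart_inv c) (chart_map c x)"
  have p: "pullback A' \<phi> \<gamma> c x v = \<gamma> d (\<phi> x) (\<D> (chart_map d \<circ> \<phi> \<circ> chart_inv c) (chart_map c x) v)"
    if "one_form A' \<gamma>" "x \<in> ?W" for \<gamma> x v
    by (rule pullback_eq[OF A' one_formD(2)[OF that(1)] ch(1) d ch(3) ch(2) that(2)])
  have e: "ext_diff (pullback A' \<phi> \<gamma>) c x u v = ext_diff \<gamma> d (\<phi> x) (D u) (D v)" if "one_form A' \<gamma>" for \<gamma>
    unfolding D_def
    by (rule ext_diff_pullback[where \<theta> = "pullback A' \<phi> \<gamma>", OF ch(1) dom_nbhd[OF A' d] ch(3) ch(2) one_formD(1)[OF that d] p[OF that] x])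
  have px: "pullback A' \<phi> \<gamma> c x v = \<gamma> d (\<phi> x) (D v)" if "one_form A' \<gamma>" for \<gamma> v
    unfolding D_def by (rule p[OF that x])
  have \<phi>x: "\<phi> x \<in> chart_dom d" using x by simp
  note S = normal_systemD[OF M(7)[OF d] \<phi>x]
  show "ext_diff (pullback A' \<phi> \<theta>) c x u v = \<i> * (pullback A' \<phi> \<theta>1 \<and>\<^sub>1 conj_form (pullback A' \<phi> \<theta>1)) c x u v +
      ((pullback A' \<phi> \<beta> \<and>\<^sub>1 pullback A' \<phi> \<theta>) c x u v + (conj_form (pullback A' \<phi> \<beta>) \<and>\<^sub>1 pullback A' \<phi> \<theta>) c x u v)"
    "ext_diff (pullback A' \<phi> \<theta>1) c x u v = (pullback A' \<phi> \<beta> \<and>\<^sub>1 pullback A' \<phi> \<theta>1) c x u v"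
    "ext_diff (pullback A' \<phi> \<beta>) c x u v = of_real ((L \<circ> \<phi>) x) * (pullback A' \<phi> \<theta>1 \<and>\<^sub>1 conj_form (pullback A' \<phi> \<theta>1)) c x u v +
      (pullback A' \<phi> \<theta>1 \<and>\<^sub>1 pullback A' \<phi> \<theta>) c x u v"
    unfolding e[OF M(1)] e[OF M(3)] e[OF M(4)] S wedge_def conj_form_def px[OF M(1)] px[OF M(3)] px[OF M(4)]
    by simp_all
qed

lemma congruence_class_proportional:
  assumes "smooth_atlas A" "oriented_congruence A S" "(\<kappa>, \<mu>) \<in> S" "(\<kappa>', \<mu>') \<in> S"
  obtains f h where "proportional A \<kappa> \<mu> \<kappa>' \<mu>' f h"
proof -
  obtain \<kappa>0 \<mu>0 where S: "S = congruence_class A \<kappa>0 \<mu>0" using assms(2) unfolding oriented_congruence_def by blast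
  obtain f h g k where "proportional A \<kappa>0 \<mu>0 \<kappa> \<mu> f h" "proportional A \<kappa>0 \<mu>0 \<kappa>' \<mu>' g k"
    using assms(3,4) unfolding S congruence_class_iff by blast
  from that[OF proportional_ratio[OF assms(1) this]] show ?thesis .
qed

text \<open>An equivalence of the structures multiplies the invariant coframe by functions \<open>f\<close>, \<open>h\<close>, and
  both coframes are normalized, so \<open>f = h = 1\<close>.\<close>
lemma coframe_equivalence_of_congruence_equivalence:
  fixes A :: "('a::{t2_space,second_countable_topology}, 'e::euclidean_space) atlas"
    and A' :: "('b::{t2_space,second_countable_topology}, 'e) atlas"
  assumes A: "smooth_atlas A" and A': "smooth_atlas A'"
    and S: "oriented_congruence A S" and S': "oriented_congruence A' S'"
    and n: "normal_coframe A \<omega> \<omega>1 \<alpha> K" "(\<omega>, \<omega>1) \<in> S"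
    and m: "normal_coframe A' \<theta> \<theta>1 \<beta> L" "(\<theta>, \<theta>1) \<in> S'"
    and eqv: "congruence_equivalence A S A' S' U V \<phi>"
  shows "coframe_equivalence A \<omega> \<omega>1 A' \<theta> \<theta>1 U V \<phi>"
proof -
  obtain \<kappa> \<mu> \<kappa>' \<mu>' and f :: "'a \<Rightarrow> real" and h :: "'a \<Rightarrow> complex"
    where ld: "local_diffeo A A' U V \<phi>" and \<kappa>: "(\<kappa>, \<mu>) \<in> S" and \<kappa>': "(\<kappa>', \<mu>') \<in> S'"
    and sf: "smooth_fun_on A U f" and sh: "smooth_fun_on A U h" and fh: "\<forall>x\<in>U. f x \<noteq> 0 \<and> h x \<noteq> 0"
    and pf: "form_eq_on A U (pullback A' \<phi> \<kappa>') (\<lambda>c x v. of_real (f x) * \<kappa> c x v)"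
    and ph: "form_eq_on A U (pullback A' \<phi> \<mu>') (\<lambda>c x v. h x * \<mu> c x v)"
    using eqv unfolding congruence_equivalence_def by blast
  obtain f1 h1 where pr1: "proportional A \<omega> \<omega>1 \<kappa> \<mu> f1 h1"
    by (rule congruence_class_proportional[OF A S n(2) \<kappa>])
  obtain f2 h2 where pr2: "proportional A' \<kappa>' \<mu>' \<theta> \<theta>1 f2 h2"
    by (rule congruence_class_proportional[OF A' S' \<kappa>' m(2)])
  note P1 = proportionalD[OF pr1] and P2 = proportionalD[OF pr2] and N = normal_coframeD[OF n(1)]
  have img: "\<phi> x \<in> points A'" if "x \<in> U" for x
    using ld that unfolding local_diffeo_def smooth_map_on_def by blast
  \<comment> \<open>The three factors belong to the change from \<omega> to \<kappa>, the
    equivalence, and the change from \<kappa>' to \<theta>, the last taken at \<phi> x; likewise for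
    H.\<close>
  define F where "F x = f2 (\<phi> x) * (f x * f1 x)" for x
  define H where "H x = h2 (\<phi> x) * (h x * h1 x)" for x
  have F: "pullback A' \<phi> \<theta> c x v = of_real (F x) * \<omega> c x v"
    and H: "pullback A' \<phi> \<theta>1 c x v = H x * \<omega>1 c x v" if c: "c \<in> A" and x: "x \<in> chart_dom c" and U: "x \<in> U" for c x v
  proof -
    have "form_eq A' \<theta> (\<lambda>c x v. of_real (f2 x) * \<kappa>' c x v)" "form_eq A' \<theta>1 (\<lambda>c x v. h2 x * \<mu>' c x v)"
      using pr2 unfolding proportional_def by simp_all
    note ps = pullback_scaled[where \<phi> = \<phi> and x = x and g = "\<lambda>x. complex_of_real (f2 x)" and \<gamma> = \<kappa>' and \<beta> = \<theta>, OF this(1) img[OF U]] pullback_scaled[where \<phi> = \<phi> and x = x and g = h2 and \<gamma> = \<mu>' and \<beta> = \<theta>1, OF this(2) img[OF U]]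
    have "pullback A' \<phi> \<kappa>' c x v = of_real (f x) * \<kappa> c x v" "pullback A' \<phi> \<mu>' c x v = h x * \<mu> c x v"
      using pf ph c x U unfolding form_eq_on_def by simp_all
    then show "pullback A' \<phi> \<theta> c x v = of_real (F x) * \<omega> c x v" "pullback A' \<phi> \<theta>1 c x v = H x * \<omega>1 c x v"
      unfolding ps by (simp_all add: P1(5,6)[OF c x] F_def H_def)
  qed
  have one: "F x = 1 \<and> H x = 1" if c: "c \<in> A" and x: "x \<in> chart_dom c" and U: "x \<in> U" for c x
  proof -
    obtain d where d: "d \<in> A'" "\<phi> x \<in> chart_dom d" using img[OF U] unfolding points_def by blast
    define W where "W = chart_dom c \<inter> U \<inter> \<phi> -` chart_dom d"
    have xW: "x \<in> W" using x U d(2) by (simp add: W_def)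
    have sub: "W \<subseteq> chart_dom c" "W \<subseteq> chart_dom c \<inter> U" by (auto simp: W_def)
    note ch = local_diffeo_chart[OF A A' ld c d(1), folded W_def]
    note nW = ch(1)
    have s: "chart_smooth c W f" "chart_smooth c W h"
      using sf sh c unfolding smooth_fun_on_def chart_smooth_def o_def
      by (auto intro: smooth_on_subset[OF _ image_mono[OF sub(2)]])
    note s1 = chart_smooth_subset[OF smooth_funD[OF P1(1) c] sub(1)] chart_smooth_subset[OF smooth_funD[OF P1(2) c] sub(1)]
    have sF: "chart_smooth c W F" "chart_smooth c W H"
      unfolding F_def[abs_def] H_def[abs_def]
      by (intro chart_smooth_mult[OF nW] s s1 ch(4) P2(1,2))+
    have H0: "H x \<noteq> 0" if "x \<in> W" for x
      using that fh P2(4)[OF img] P1(4)[OF points_memI[OF c]] sub by (auto simp: H_def W_def)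
    have "normal_system c W \<omega> \<omega>1 \<alpha> K"
      using N(7)[OF c] sub(1) unfolding normal_system_def by blast
    moreover have "normal_system c W (pullback A' \<phi> \<theta>) (pullback A' \<phi> \<theta>1) (pullback A' \<phi> \<beta>) (L \<circ> \<phi>)"
      unfolding W_def by (rule normal_system_pullback[OF A A' ld c d(1) m(1)])
    moreover have "independent_pair (\<omega> c x) (\<omega>1 c x)" if "x \<in> W" for x
      using N(6)[OF c] that sub(1) by blast
    moreover have "pullback A' \<phi> \<theta> c x v = of_real (F x) * \<omega> c x v" "pullback A' \<phi> \<theta>1 c x v = H x * \<omega>1 c x v"
      if "x \<in> W" for x v
      using that sub(2) by (auto intro: F[OF c] H[OF c])
    ultimately show ?thesis
      using normal_system_unique(1,2)[OF nW chart_form_subset[OF one_formD(1)[OF N(1) c] sub(1)]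
          chart_form_subset[OF one_formD(1)[OF N(3) c] sub(1)] chart_form_subset[OF one_formD(1)[OF N(4) c] sub(1)]
          _ _ _ sF H0 _ _ xW, where K = K and L = "L \<circ> \<phi>" and \<theta> = "pullback A' \<phi> \<theta>" and
            ?\<theta>1.0 = "pullback A' \<phi> \<theta>1" and \<beta> = "pullback A' \<phi> \<beta>"]
      by blast
  qed
  show ?thesis
    unfolding coframe_equivalence_def form_eq_on_def using ld F H one by auto
qed

text \<open>The invariant coframes are themselves representatives of the two structures, so they
  witness the equivalence with f = h = 1.\<close>

lemma congruence_equivalence_of_coframe_equivalence:
  assumes "smooth_atlas A" "(\<omega>, \<omega>1) \<in> S" "(\<theta>, \<theta>1) \<in> S'" "coframe_equivalence A \<omega> \<omega>1 A' \<theta> \<theta>1 U V \<phi>"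
  shows "congruence_equivalence A S A' S' U V \<phi>"
proof -
  have 1: "smooth_fun_on A U (\<lambda>x. 1 :: real)" "smooth_fun_on A U (\<lambda>x. 1 :: complex)"
    unfolding smooth_fun_on_def o_def by (simp_all add: smooth_on_const)
  have "local_diffeo A A' U V \<phi>" "form_eq_on A U (pullback A' \<phi> \<theta>) (\<lambda>c x v. of_real 1 * \<omega> c x v)"
    "form_eq_on A U (pullback A' \<phi> \<theta>1) (\<lambda>c x v. 1 * \<omega>1 c x v)"
    using assms(4) unfolding coframe_equivalence_def form_eq_on_def by simp_all
  then show ?thesis
    unfolding congruence_equivalence_def
    by (intro conjI bexI[OF _ assms(2)] bexI[OF _ assms(3)] case_prodI
        exI[of _ "\<lambda>x. 1 :: real"] exI[of _ "\<lambda>x. 1 :: complex"] 1) simp_all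
qed

text \<open>The definition admits any representative of S together with its \<Omega>. Two outcomes
  are proportional, being members of the same class, and both are normalized, so rigidity makes the
  coframes, the connection forms and K1 agree.\<close>

lemma invariant_coframe_unique:
  assumes A: "smooth_atlas A" and S: "oriented_congruence A S"
    and inv: "invariant_coframe A S \<omega> \<omega>1 K1 Z0 Z1 Z2" "invariant_coframe A S \<theta> \<theta>1 L1 Y0 Y1 Y2"
  shows "form_eq A \<omega> \<theta>" "form_eq A \<omega>1 \<theta>1"
    "x \<in> points A \<Longrightarrow> K1 x = L1 x \<and> Z0 x = Y0 x \<and> Z1 x = Y1 x \<and> Z2 x = Y2 x"
proof -
  obtain \<alpha> where n: "normal_coframe A \<omega> \<omega>1 \<alpha> K1" "(\<omega>, \<omega>1) \<in> S"
    and \<alpha>: "\<And>c x v. c \<in> A \<Longrightarrow> x \<in> chart_dom c \<Longrightarrow>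
      \<alpha> c x v = Z1 x * \<omega>1 c x v + Z2 x * cnj (\<omega>1 c x v) + Z0 x * \<omega> c x v"
    by (rule invariant_coframe_normal[OF A S inv(1)]) blast
  obtain \<beta> where m: "normal_coframe A \<theta> \<theta>1 \<beta> L1" "(\<theta>, \<theta>1) \<in> S"
    and \<beta>: "\<And>c x v. c \<in> A \<Longrightarrow> x \<in> chart_dom c \<Longrightarrow>
      \<beta> c x v = Y1 x * \<theta>1 c x v + Y2 x * cnj (\<theta>1 c x v) + Y0 x * \<theta> c x v"
    by (rule invariant_coframe_normal[OF A S inv(2)]) blast
  obtain f h where pr: "proportional A \<omega> \<omega>1 \<theta> \<theta>1 f h"
    by (rule congruence_class_proportional[OF A S n(2) m(2)])
  note u = normal_coframe_unique[OF A n(1) m(1) pr]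
  show "form_eq A \<omega> \<theta>" "form_eq A \<omega>1 \<theta>1" by (rule form_eqI, simp only: u)+
  show "K1 x = L1 x \<and> Z0 x = Y0 x \<and> Z1 x = Y1 x \<and> Z2 x = Y2 x" if x: "x \<in> points A"
  proof -
    obtain c where c: "c \<in> A" "x \<in> chart_dom c" using x unfolding points_def by blast
    \<comment> \<open>The two connection forms coincide and are expanded in the same coframe, so
      their coefficients coincide.\<close>
    have "(Y0 x - Z0 x) * \<omega> c x v + (Y1 x - Z1 x) * \<omega>1 c x v + (Y2 x - Z2 x) * cnj (\<omega>1 c x v) = 0" for v
      using u(3)[OF c, of v] unfolding \<alpha>[OF c] \<beta>[OF c] u(1,2)[OF c] by (simp add: algebra_simps)
    from independent_pairD[OF normal_coframeD(6)[OF n(1) c] this] u(4)[OF c] show ?thesis by simp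
  qed
qed

lemma congruence_equivalence_iff:
  fixes A :: "('a::{t2_space,second_countable_topology}, 'e::euclidean_space) atlas"
    and A' :: "('b::{t2_space,second_countable_topology}, 'e) atlas"
  assumes A: "smooth_atlas A" and A': "smooth_atlas A'"
    and S: "oriented_congruence A S" and S': "oriented_congruence A' S'"
    and inv: "invariant_coframe A S \<omega> \<omega>1 K1 Z0 Z1 Z2" and inv': "invariant_coframe A' S' \<theta> \<theta>1 L1 Y0 Y1 Y2"
  shows "congruence_equivalence A S A' S' U V \<phi> \<longleftrightarrow> coframe_equivalence A \<omega> \<omega>1 A' \<theta> \<theta>1 U V \<phi>"
proof -
  obtain \<alpha> where n: "normal_coframe A \<omega> \<omega>1 \<alpha> K1" "(\<omega>, \<omega>1) \<in> S"
    by (rule invariant_coframe_normal[OF A S inv])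
  obtain \<beta> where m: "normal_coframe A' \<theta> \<theta>1 \<beta> L1" "(\<theta>, \<theta>1) \<in> S'"
    by (rule invariant_coframe_normal[OF A' S' inv'])
  show ?thesis
    using coframe_equivalence_of_congruence_equivalence[OF A A' S S' n m]
      congruence_equivalence_of_coframe_equivalence[OF A n(2) m(2)] by blast
qed

lemma admissible_oriented: "admissible_congruence A S \<Longrightarrow> oriented_congruence A S"
  unfolding admissible_congruence_def by simp

lemma invariant_coframe_system:
  fixes A :: "('a::{t2_space,second_countable_topology}, real ^ 3) atlas"
  assumes A: "smooth_atlas A" and S: "oriented_congruence A S"
    and inv: "invariant_coframe A S \<omega> \<omega>1 K1 Z0 Z1 Z2"
  shows "(\<omega>, \<omega>1) \<in> S" "invariant_system A \<omega> \<omega>1 K1 Z0 Z1 Z2"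
proof -
  obtain \<alpha> where n: "normal_coframe A \<omega> \<omega>1 \<alpha> K1" and S: "(\<omega>, \<omega>1) \<in> S"
    and \<alpha>: "\<And>c x v. c \<in> A \<Longrightarrow> x \<in> chart_dom c \<Longrightarrow>
      \<alpha> c x v = Z1 x * \<omega>1 c x v + Z2 x * cnj (\<omega>1 c x v) + Z0 x * \<omega> c x v"
    by (rule invariant_coframe_normal[OF A S inv]) blast
  show "(\<omega>, \<omega>1) \<in> S" by (rule S)
  show "invariant_system A \<omega> \<omega>1 K1 Z0 Z1 Z2" by (rule invariant_system_of_normal_coframe[OF A n \<alpha>])
qed

theorem theorem7p20:
  fixes A :: "('a::{t2_space,second_countable_topology}, real ^ 3) atlas"
    and A' :: "('b::{t2_space,second_countable_topology}, real ^ 3) atlas"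
  assumes "smooth_atlas A" and "smooth_atlas A'"
  shows
    "(\<forall>S. admissible_congruence A S \<longrightarrow>
        (\<exists>\<omega> \<omega>\<^sub>1 K\<^sub>1 Z\<^sub>0 Z\<^sub>1 Z\<^sub>2. invariant_coframe A S \<omega> \<omega>\<^sub>1 K\<^sub>1 Z\<^sub>0 Z\<^sub>1 Z\<^sub>2) \<and>
        (\<forall>\<omega> \<omega>\<^sub>1 K\<^sub>1 Z\<^sub>0 Z\<^sub>1 Z\<^sub>2 \<theta> \<theta>\<^sub>1 L\<^sub>1 Y\<^sub>0 Y\<^sub>1 Y\<^sub>2.
           invariant_coframe A S \<omega> \<omega>\<^sub>1 K\<^sub>1 Z\<^sub>0 Z\<^sub>1 Z\<^sub>2 \<and> invariant_coframe A S \<theta> \<theta>\<^sub>1 L\<^sub>1 Y\<^sub>0 Y\<^sub>1 Y\<^sub>2 \<longrightarrow>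
           form_eq A \<omega> \<theta> \<and> form_eq A \<omega>\<^sub>1 \<theta>\<^sub>1 \<and>
           (\<forall>x\<in>points A. K\<^sub>1 x = L\<^sub>1 x \<and> Z\<^sub>0 x = Y\<^sub>0 x \<and> Z\<^sub>1 x = Y\<^sub>1 x \<and> Z\<^sub>2 x = Y\<^sub>2 x)) \<and>
        (\<forall>\<omega> \<omega>\<^sub>1 K\<^sub>1 Z\<^sub>0 Z\<^sub>1 Z\<^sub>2. invariant_coframe A S \<omega> \<omega>\<^sub>1 K\<^sub>1 Z\<^sub>0 Z\<^sub>1 Z\<^sub>2 \<longrightarrow>
           (\<omega>, \<omega>\<^sub>1) \<in> S \<and> invariant_system A \<omega> \<omega>\<^sub>1 K\<^sub>1 Z\<^sub>0 Z\<^sub>1 Z\<^sub>2)) \<and>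
     (\<forall>\<omega> \<omega>\<^sub>1 K\<^sub>1 Z\<^sub>0 Z\<^sub>1 Z\<^sub>2. invariant_system A \<omega> \<omega>\<^sub>1 K\<^sub>1 Z\<^sub>0 Z\<^sub>1 Z\<^sub>2 \<longrightarrow>
        admissible_congruence A (congruence_class A \<omega> \<omega>\<^sub>1) \<and>
        invariant_coframe A (congruence_class A \<omega> \<omega>\<^sub>1) \<omega> \<omega>\<^sub>1 K\<^sub>1 Z\<^sub>0 Z\<^sub>1 Z\<^sub>2) \<and>
     (\<forall>S S' \<omega> \<omega>\<^sub>1 K\<^sub>1 Z\<^sub>0 Z\<^sub>1 Z\<^sub>2 \<omega>' \<omega>\<^sub>1' K\<^sub>1' Z\<^sub>0' Z\<^sub>1' Z\<^sub>2'.
        admissible_congruence A S \<and> invariant_coframe A S \<omega> \<omega>\<^sub>1 K\<^sub>1 Z\<^sub>0 Z\<^sub>1 Z\<^sub>2 \<and>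
        admissible_congruence A' S' \<and> invariant_coframe A' S' \<omega>' \<omega>\<^sub>1' K\<^sub>1' Z\<^sub>0' Z\<^sub>1' Z\<^sub>2' \<longrightarrow>
        (locally_equivalent A S A' S' \<longleftrightarrow>
           (\<exists>U V \<phi>. U \<noteq> {} \<and> coframe_equivalence A \<omega> \<omega>\<^sub>1 A' \<omega>' \<omega>\<^sub>1' U V \<phi>)) \<and>
        (\<forall>x\<in>points A. \<forall>x'\<in>points A'.
           locally_equivalent_at A S x A' S' x' \<longleftrightarrow>
           (\<exists>U V \<phi>. x \<in> U \<and> \<phi> x = x' \<and> coframe_equivalence A \<omega> \<omega>\<^sub>1 A' \<omega>' \<omega>\<^sub>1' U V \<phi>)))"
proof (intro conjI allI impI, goal_cases)
  case (1 S)
  then show ?case by (rule invariant_coframe_exists[OF assms(1)])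
next
  case (2 S \<omega> \<omega>\<^sub>1 K\<^sub>1 Z\<^sub>0 Z\<^sub>1 Z\<^sub>2 \<theta> \<theta>\<^sub>1 L\<^sub>1 Y\<^sub>0 Y\<^sub>1 Y\<^sub>2)
  then show ?case
    using invariant_coframe_unique(1)[OF assms(1) admissible_oriented] by blast
next
  case (3 S \<omega> \<omega>\<^sub>1 K\<^sub>1 Z\<^sub>0 Z\<^sub>1 Z\<^sub>2 \<theta> \<theta>\<^sub>1 L\<^sub>1 Y\<^sub>0 Y\<^sub>1 Y\<^sub>2)
  then show ?case
    using invariant_coframe_unique(2)[OF assms(1) admissible_oriented] by blast
next
  case (4 S \<omega> \<omega>\<^sub>1 K\<^sub>1 Z\<^sub>0 Z\<^sub>1 Z\<^sub>2 \<theta> \<theta>\<^sub>1 L\<^sub>1 Y\<^sub>0 Y\<^sub>1 Y\<^sub>2)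
  then show ?case
    using invariant_coframe_unique(3)[OF assms(1) admissible_oriented] by blast
next
  case (5 S \<omega> \<omega>\<^sub>1 K\<^sub>1 Z\<^sub>0 Z\<^sub>1 Z\<^sub>2)
  then show ?case by (intro invariant_coframe_system(1)[OF assms(1) admissible_oriented])
next
  case (6 S \<omega> \<omega>\<^sub>1 K\<^sub>1 Z\<^sub>0 Z\<^sub>1 Z\<^sub>2)
  then show ?case by (intro invariant_coframe_system(2)[OF assms(1) admissible_oriented])
next
  case (7 \<omega> \<omega>\<^sub>1 K\<^sub>1 Z\<^sub>0 Z\<^sub>1 Z\<^sub>2)
  then show ?case by (rule invariant_system_realized(1)[OF assms(1)])
next
  case (8 \<omega> \<omega>\<^sub>1 K\<^sub>1 Z\<^sub>0 Z\<^sub>1 Z\<^sub>2)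
  then show ?case by (rule invariant_system_realized(2)[OF assms(1)])
next
  case (9 S S' \<omega> \<omega>\<^sub>1 K\<^sub>1 Z\<^sub>0 Z\<^sub>1 Z\<^sub>2 \<omega>' \<omega>\<^sub>1' K\<^sub>1' Z\<^sub>0' Z\<^sub>1' Z\<^sub>2')
  \<comment> \<open>The two kinds of equivalence agree for every fixed U, V and \<phi>, hence also
    after quantification over them, with or without prescribed points.\<close>
  then have "congruence_equivalence A S A' S' U V \<phi> \<longleftrightarrow> coframe_equivalence A \<omega> \<omega>\<^sub>1 A' \<omega>' \<omega>\<^sub>1' U V \<phi>" for U V \<phi>
    by (elim conjE) (rule congruence_equivalence_iff[OF assms admissible_oriented admissible_oriented])
  then show ?case unfolding locally_equivalent_def by simp
next
  case (10 S S' \<omega> \<omega>\<^sub>1 K\<^sub>1 Z\<^sub>0 Z\<^sub>1 Z\<^sub>2 \<omega>' \<omega>\<^sub>1' K\<^sub>1' Z\<^sub>0' Z\<^sub>1' Z\<^sub>2')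
  then have "congruence_equivalence A S A' S' U V \<phi> \<longleftrightarrow> coframe_equivalence A \<omega> \<omega>\<^sub>1 A' \<omega>' \<omega>\<^sub>1' U V \<phi>" for U V \<phi>
    by (elim conjE) (rule congruence_equivalence_iff[OF assms admissible_oriented admissible_oriented])
  then show ?case unfolding locally_equivalent_at_def by simp
qed

end
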